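(* Let $M$ be a smooth manifold. The map $\nabla\mapsto\nabla^s$, sending a torsion-free affine connection $\nabla$ on $M$ to its symmetric derivative $\nabla^s$, is an isomorphism of affine spaces modelled on $\Upsilon^2(M,TM)$ from the set of torsion-free connections on $M$ onto the set of geometric derivations of the algebra $\Upsilon^\bullet(M)$ of symmetric forms on $M$.
   Context: $M$ is a smooth manifold of positive dimension; everything is smooth. $\Upsilon^r(M)=\Gamma(\mathrm{Sym}^rT^*M)$ is the space of totally symmetric covariant $r$-tensor fields ($\Upsilon^0(M)=C^\infty(M)$, $\Upsilon^1(M)=\Omega^1(M)$), $\Upsilon^\bullet(M)=\bigoplus_{r\ge 0}\Upsilon^r(M)$, and $\Upsilon^2(M,TM)=\Gamma(\mathrm{Sym}^2T^*M\otimes TM)$. With $\mathrm{sym}$ the average over all permutations of the arguments, the symmetric product is $\varphi\odot\psi=\frac{(r+l)!}{r!\,l!}\mathrm{sym}(\varphi\otimes\psi)$ for $\varphi\in\Upsilon^r(M)$, $\psi\in\Upsilon^l(M)$. A derivation of degree $k$ of $\Upsilon^\bullet(M)$ is an $\mathbb{R}$-linear map $D$ with $D(\Upsilon^r(M))\subseteq\Upsilon^{r+k}(M)$ and $D(\varphi\odot\psi)=D\varphi\odot\psi+\varphi\odot D\psi$ (no signs). A geometric derivation is a derivation $D$ of $\Upsilon^\bullet(M)$ of degree $1$ with $(Df)(X)=Xf$ for all $f\in C^\infty(M)$, $X\in\mathfrak{X}(M)$. For a connection $\nabla$ on $M$ (extended to $T^*M$ by duality), the symmetric derivative $\nabla^s$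 is the unique geometric derivation with $\nabla^s\alpha=2\,\mathrm{sym}(\nabla\alpha)$ for $\alpha\in\Upsilon^1(M)$, i.e. $(\nabla^s\alpha)(X,Y)=(\nabla_X\alpha)(Y)+(\nabla_Y\alpha)(X)$. Affine structures: the difference of two torsion-free connections is an element of $\Upsilon^2(M,TM)$ (and any element may be added). The difference of two geometric derivations vanishes on functions and restricts to a $C^\infty(M)$-linear map $\Upsilon^1(M)\to\Upsilon^2(M)$, which is identified with an element $\sigma\in\Upsilon^2(M,TM)$ via $\alpha\mapsto\alpha(\sigma(\cdot,\cdot))$; the difference is determined by this restriction. An isomorphism of affine spaces is a bijective affine map, i.e. a bijection whose induced map on differences is a linear isomorphism. *)

theory Defs
  imports "HOL-Analysis.Analysis" "HOL-Library.Function_Algebras"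
    "HOL-Combinatorics.Permutations"
begin

text \<open>Tangent vectors and tensor fields are represented by functions, with the pointwise vector
  space structure: addition comes from Function_Algebras, scalar multiplication is added here.\<close>

instantiation "fun" :: (type, real_vector) real_vector
begin

definition scaleR_fun :: "real \<Rightarrow> ('a \<Rightarrow> 'b) \<Rightarrow> 'a \<Rightarrow> 'b" where
  "scaleR_fun a f = (\<lambda>x. a *\<^sub>R f x)"

instance
  by standard (simp_all add: scaleR_fun_def fun_eq_iff algebra_simps)

end

lemma scaleR_fun_apply [simp]: "(a *\<^sub>R f) x = a *\<^sub>R f x"
  by (simp add: scaleR_fun_def)


section \<open>Smooth manifolds\<close>

text \<open>The predicates Ck_on and smooth_on are meant for open sets only.\<close>

primrec Ck_on :: "nat \<Rightarrow> 'a::euclidean_space set \<Rightarrow> ('a \<Rightarrow> 'b::real_normed_vector) \<Rightarrow> bool" where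
  "Ck_on 0 S f \<longleftrightarrow> continuous_on S f"
| "Ck_on (Suc k) S f \<longleftrightarrow>
     (\<forall>x\<in>S. f differentiable (at x)) \<and>
     (\<forall>v. Ck_on k S (\<lambda>x. frechet_derivative f (at x) v))"

definition smooth_on :: "'a::euclidean_space set \<Rightarrow> ('a \<Rightarrow> 'b::real_normed_vector) \<Rightarrow> bool" where
  "smooth_on S f \<longleftrightarrow> (\<forall>k. Ck_on k S f)"

text \<open>A chart consists of its domain and a coordinate map; the values of the map outside the
  domain are irrelevant.\<close>

type_synonym ('m, 'e) chart = "'m set \<times> ('m \<Rightarrow> 'e)"

definition chart_image :: "('m, 'e) chart \<Rightarrow> 'e set" where
  "chart_image c = snd c ` fst c"

definition chart_inv :: "('m, 'e) chart \<Rightarrow> 'e \<Rightarrow> 'm" where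
  "chart_inv c = inv_into (fst c) (snd c)"

text \<open>The underlying set of the manifold is the whole type of points. Its dimension is the
  dimension of the model space, hence positive, because a Euclidean space in the sense of the type
  class has a nonempty basis. The atlas need not be maximal.\<close>

definition smooth_manifold ::
    "('m::{t2_space, second_countable_topology}, 'e::euclidean_space) chart set \<Rightarrow> bool" where
  "smooth_manifold A \<longleftrightarrow>
     (\<Union>c\<in>A. fst c) = UNIV \<and>
     (\<forall>c\<in>A. open (fst c) \<and> open (chart_image c) \<and>
        homeomorphism (fst c) (chart_image c) (snd c) (chart_inv c)) \<and>
     (\<forall>c\<in>A. \<forall>d\<in>A. smooth_on (snd c ` (fst c \<inter> fst d)) (snd d \<circ> chart_inv c))"

definition smooth_functions :: "('m, 'e::euclidean_space) chart set \<Rightarrow> ('m \<Rightarrow> real) set" where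
  "smooth_functions A = {f. \<forall>c\<in>A. smooth_on (chart_image c) (f \<circ> chart_inv c)}"


section \<open>Tangent vectors and vector fields\<close>

text \<open>A tangent vector at a point assigns to every chart around the point a coordinate vector, in
  such a way that the coordinate vectors are related by the derivatives of the transition maps. It
  is set to 0 on everything that is not a chart around the point.\<close>

type_synonym ('m, 'e) tvec = "('m, 'e) chart \<Rightarrow> 'e"

definition tangent_space ::
    "('m, 'e::euclidean_space) chart set \<Rightarrow> 'm \<Rightarrow> ('m, 'e) tvec set" where
  "tangent_space A p = {v.
     (\<forall>c\<in>A. \<forall>d\<in>A. p \<in> fst c \<longrightarrow> p \<in> fst d \<longrightarrow>
        v d = frechet_derivative (snd d \<circ> chart_inv c) (at (snd c p)) (v c)) \<and>
     (\<forall>c. \<not> (c \<in> A \<and> p \<in> fst c) \<longrightarrow> v c = 0)}"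

text \<open>The tangent vector at p whose coordinate vector in the chart c is e; for basis vectors e
  these are the coordinate vector fields of c.\<close>

definition coord_vec ::
    "('m, 'e::euclidean_space) chart set \<Rightarrow> ('m, 'e) chart \<Rightarrow> 'm \<Rightarrow> 'e \<Rightarrow> ('m, 'e) tvec" where
  "coord_vec A c p e = (\<lambda>d. if d \<in> A \<and> p \<in> fst d
     then frechet_derivative (snd d \<circ> chart_inv c) (at (snd c p)) e else 0)"

definition vector_fields ::
    "('m, 'e::euclidean_space) chart set \<Rightarrow> ('m \<Rightarrow> ('m, 'e) tvec) set" where
  "vector_fields A = {X.
     (\<forall>p. X p \<in> tangent_space A p) \<and>
     (\<forall>c\<in>A. smooth_on (chart_image c) (\<lambda>x. X (chart_inv c x) c))}"

text \<open>The derivative Xf, computed at each point in some chart around it; for a vector field X and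
  a smooth function f the choice of the chart does not matter.\<close>

definition vf_apply ::
    "('m, 'e::euclidean_space) chart set \<Rightarrow> ('m \<Rightarrow> ('m, 'e) tvec) \<Rightarrow> ('m \<Rightarrow> real) \<Rightarrow> 'm \<Rightarrow> real" where
  "vf_apply A X f p =
     (let c = (SOME c. c \<in> A \<and> p \<in> fst c)
      in frechet_derivative (f \<circ> chart_inv c) (at (snd c p)) (X p c))"

definition lie_bracket ::
    "('m, 'e::euclidean_space) chart set \<Rightarrow>
     ('m \<Rightarrow> ('m, 'e) tvec) \<Rightarrow> ('m \<Rightarrow> ('m, 'e) tvec) \<Rightarrow> 'm \<Rightarrow> ('m, 'e) tvec" where
  "lie_bracket A X Y = (THE Z. Z \<in> vector_fields A \<and>
     (\<forall>f\<in>smooth_functions A.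
        vf_apply A Z f = vf_apply A X (vf_apply A Y f) - vf_apply A Y (vf_apply A X f)))"


section \<open>Symmetric forms\<close>

text \<open>A covariant tensor of degree r at a point is a multilinear function on lists of r tangent
  vectors, set to 0 on all other lists. Since the degree is the length of the argument list, a
  finite sum of tensor fields of different degrees is again a function of the same type, and this
  is how the elements of the direct sum over all degrees are represented.\<close>

type_synonym ('m, 'e) tensor_field = "'m \<Rightarrow> ('m, 'e) tvec list \<Rightarrow> real"

definition sym_tensors ::
    "('m, 'e::euclidean_space) chart set \<Rightarrow> nat \<Rightarrow> 'm \<Rightarrow> (('m, 'e) tvec list \<Rightarrow> real) set" where
  "sym_tensors A r p = {t.
     (\<forall>vs. \<not> (length vs = r \<and> set vs \<subseteq> tangent_space A p) \<longrightarrow> t vs = 0) \<and>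
     (\<forall>vs i u w a b. length vs = r \<longrightarrow> set vs \<subseteq> tangent_space A p \<longrightarrow> i < r \<longrightarrow>
        u \<in> tangent_space A p \<longrightarrow> w \<in> tangent_space A p \<longrightarrow>
        t (vs[i := a *\<^sub>R u + b *\<^sub>R w]) = a * t (vs[i := u]) + b * t (vs[i := w])) \<and>
     (\<forall>vs \<pi>. length vs = r \<longrightarrow> set vs \<subseteq> tangent_space A p \<longrightarrow> \<pi> permutes {..<r} \<longrightarrow>
        t (permute_list \<pi> vs) = t vs)}"

definition sym_forms ::
    "('m, 'e::euclidean_space) chart set \<Rightarrow> nat \<Rightarrow> ('m, 'e) tensor_field set" where
  "sym_forms A r = {\<phi>.
     (\<forall>p. \<phi> p \<in> sym_tensors A r p) \<and>
     (\<forall>c\<in>A. \<forall>es. length es = r \<longrightarrow> set es \<subseteq> Basis \<longrightarrow>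
        smooth_on (chart_image c)
          (\<lambda>x. \<phi> (chart_inv c x) (map (coord_vec A c (chart_inv c x)) es)))}"

definition component :: "nat \<Rightarrow> ('m, 'e) tensor_field \<Rightarrow> ('m, 'e) tensor_field" where
  "component r \<phi> = (\<lambda>p vs. if length vs = r then \<phi> p vs else 0)"

definition sym_algebra ::
    "('m, 'e::euclidean_space) chart set \<Rightarrow> ('m, 'e) tensor_field set" where
  "sym_algebra A = {\<phi>. (\<forall>r. component r \<phi> \<in> sym_forms A r) \<and> finite {r. component r \<phi> \<noteq> 0}}"

text \<open>The identification of functions with forms of degree 0.\<close>

definition fun_form :: "('m \<Rightarrow> real) \<Rightarrow> ('m, 'e) tensor_field" where
  "fun_form f = (\<lambda>p vs. if vs = [] then f p else 0)"

definition symmetrise :: "('v list \<Rightarrow> real) \<Rightarrow> 'v list \<Rightarrow> real" where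
  "symmetrise t vs = (\<Sum>\<pi> | \<pi> permutes {..<length vs}. t (permute_list \<pi> vs)) / fact (length vs)"

text \<open>The summand with index r is the product of the component of degree r of the first factor
  with the component of the complementary degree of the second one. If the factors are homogeneous
  of degrees r and l, only this summand, evaluated on lists of length r + l, can be nonzero, and the
  product is (r + l)! / (r! l!) times the symmetrised tensor product.\<close>

definition sym_prod ::
    "('m, 'e) tensor_field \<Rightarrow> ('m, 'e) tensor_field \<Rightarrow> ('m, 'e) tensor_field" where
  "sym_prod \<phi> \<psi> = (\<lambda>p vs. \<Sum>r\<le>length vs.
     fact (length vs) / (fact r * fact (length vs - r)) *
     symmetrise (\<lambda>ws. \<phi> p (take r ws) * \<psi> p (drop r ws)) vs)"


section \<open>Geometric derivations and connections\<close>

text \<open>Maps between sets of forms or vector fields are extensional, so that they are equal iff they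
  agree on these sets.\<close>

definition sym_derivations ::
    "('m, 'e::euclidean_space) chart set \<Rightarrow> nat \<Rightarrow>
     (('m, 'e) tensor_field \<Rightarrow> ('m, 'e) tensor_field) set" where
  "sym_derivations A k = {D \<in> sym_algebra A \<rightarrow>\<^sub>E sym_algebra A.
     (\<forall>\<phi>\<in>sym_algebra A. \<forall>\<psi>\<in>sym_algebra A. \<forall>a b.
        D (a *\<^sub>R \<phi> + b *\<^sub>R \<psi>) = a *\<^sub>R D \<phi> + b *\<^sub>R D \<psi>) \<and>
     (\<forall>r. \<forall>\<phi>\<in>sym_forms A r. D \<phi> \<in> sym_forms A (r + k)) \<and>
     (\<forall>\<phi>\<in>sym_algebra A. \<forall>\<psi>\<in>sym_algebra A.
        D (sym_prod \<phi> \<psi>) = sym_prod (D \<phi>) \<psi> + sym_prod \<phi> (D \<psi>))}"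

definition geometric_derivations ::
    "('m, 'e::euclidean_space) chart set \<Rightarrow>
     (('m, 'e) tensor_field \<Rightarrow> ('m, 'e) tensor_field) set" where
  "geometric_derivations A = {D \<in> sym_derivations A 1.
     \<forall>f\<in>smooth_functions A. \<forall>X\<in>vector_fields A. \<forall>p. D (fun_form f) p [X p] = vf_apply A X f p}"

type_synonym ('m, 'e) connection =
  "('m \<Rightarrow> ('m, 'e) tvec) \<Rightarrow> ('m \<Rightarrow> ('m, 'e) tvec) \<Rightarrow> 'm \<Rightarrow> ('m, 'e) tvec"

definition connections ::
    "('m, 'e::euclidean_space) chart set \<Rightarrow> ('m, 'e) connection set" where
  "connections A = {N \<in> vector_fields A \<rightarrow>\<^sub>E (vector_fields A \<rightarrow>\<^sub>E vector_fields A).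
     (\<forall>X\<in>vector_fields A. \<forall>X'\<in>vector_fields A. \<forall>Y\<in>vector_fields A.
        N (X + X') Y = N X Y + N X' Y) \<and>
     (\<forall>f\<in>smooth_functions A. \<forall>X\<in>vector_fields A. \<forall>Y\<in>vector_fields A.
        N (\<lambda>p. f p *\<^sub>R X p) Y = (\<lambda>p. f p *\<^sub>R N X Y p)) \<and>
     (\<forall>X\<in>vector_fields A. \<forall>Y\<in>vector_fields A. \<forall>Y'\<in>vector_fields A. \<forall>a b.
        N X (a *\<^sub>R Y + b *\<^sub>R Y') = a *\<^sub>R N X Y + b *\<^sub>R N X Y') \<and>
     (\<forall>f\<in>smooth_functions A. \<forall>X\<in>vector_fields A. \<forall>Y\<in>vector_fields A.
        N X (\<lambda>p. f p *\<^sub>R Y p) = (\<lambda>p. vf_apply A X f p *\<^sub>R Y p + f p *\<^sub>R N X Y p))}"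

definition torsion_free_connections ::
    "('m, 'e::euclidean_space) chart set \<Rightarrow> ('m, 'e) connection set" where
  "torsion_free_connections A = {N \<in> connections A.
     \<forall>X\<in>vector_fields A. \<forall>Y\<in>vector_fields A. N X Y - N Y X - lie_bracket A X Y = 0}"

text \<open>The dual connection on 1-forms: the derivative of \<open>\<alpha>\<close> along X, evaluated on Y.\<close>

definition dual_connection ::
    "('m, 'e::euclidean_space) chart set \<Rightarrow> ('m, 'e) connection \<Rightarrow> ('m \<Rightarrow> ('m, 'e) tvec) \<Rightarrow>
     ('m, 'e) tensor_field \<Rightarrow> ('m \<Rightarrow> ('m, 'e) tvec) \<Rightarrow> 'm \<Rightarrow> real" where
  "dual_connection A N X \<alpha> Y p = vf_apply A X (\<lambda>q. \<alpha> q [Y q]) p - \<alpha> p [N X Y p]"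

definition symmetric_derivative ::
    "('m, 'e::euclidean_space) chart set \<Rightarrow> ('m, 'e) connection \<Rightarrow>
     ('m, 'e) tensor_field \<Rightarrow> ('m, 'e) tensor_field" where
  "symmetric_derivative A N = (THE D. D \<in> geometric_derivations A \<and>
     (\<forall>\<alpha>\<in>sym_forms A 1. \<forall>X\<in>vector_fields A. \<forall>Y\<in>vector_fields A. \<forall>p.
        D \<alpha> p [X p, Y p] = dual_connection A N X \<alpha> Y p + dual_connection A N Y \<alpha> X p))"


section \<open>Affine structures\<close>

text \<open>Smooth sections of the bundle of symmetric bilinear maps from the tangent bundle to itself,
  again set to 0 outside the tangent spaces.\<close>

definition tangent_valued_forms ::
    "('m, 'e::euclidean_space) chart set \<Rightarrow>
     ('m \<Rightarrow> ('m, 'e) tvec \<Rightarrow> ('m, 'e) tvec \<Rightarrow> ('m, 'e) tvec) set" where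
  "tangent_valued_forms A = {\<sigma>.
     (\<forall>p u v. u \<in> tangent_space A p \<longrightarrow> v \<in> tangent_space A p \<longrightarrow>
        \<sigma> p u v \<in> tangent_space A p \<and> \<sigma> p u v = \<sigma> p v u) \<and>
     (\<forall>p u v. \<not> (u \<in> tangent_space A p \<and> v \<in> tangent_space A p) \<longrightarrow> \<sigma> p u v = 0) \<and>
     (\<forall>p u v w a b. u \<in> tangent_space A p \<longrightarrow> v \<in> tangent_space A p \<longrightarrow> w \<in> tangent_space A p \<longrightarrow>
        \<sigma> p (a *\<^sub>R u + b *\<^sub>R v) w = a *\<^sub>R \<sigma> p u w + b *\<^sub>R \<sigma> p v w) \<and>
     (\<forall>c\<in>A. \<forall>e\<in>Basis. \<forall>e'\<in>Basis. smooth_on (chart_image c)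
        (\<lambda>x. let p = chart_inv c x in \<sigma> p (coord_vec A c p e) (coord_vec A c p e') c))}"

definition connection_diff ::
    "('m, 'e::euclidean_space) chart set \<Rightarrow> ('m, 'e) connection \<Rightarrow> ('m, 'e) connection \<Rightarrow>
     'm \<Rightarrow> ('m, 'e) tvec \<Rightarrow> ('m, 'e) tvec \<Rightarrow> ('m, 'e) tvec" where
  "connection_diff A N' N = (THE \<sigma>. \<sigma> \<in> tangent_valued_forms A \<and>
     (\<forall>X\<in>vector_fields A. \<forall>Y\<in>vector_fields A. \<forall>p. \<sigma> p (X p) (Y p) = N' X Y p - N X Y p))"

definition contract ::
    "('m \<Rightarrow> ('m, 'e) tvec \<Rightarrow> ('m, 'e) tvec \<Rightarrow> ('m, 'e) tvec) \<Rightarrow>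
     ('m, 'e) tensor_field \<Rightarrow> ('m, 'e) tensor_field" where
  "contract \<sigma> \<alpha> = (\<lambda>p vs. if length vs = 2 then \<alpha> p [\<sigma> p (vs ! 0) (vs ! 1)] else 0)"

definition derivation_diff ::
    "('m, 'e::euclidean_space) chart set \<Rightarrow>
     (('m, 'e) tensor_field \<Rightarrow> ('m, 'e) tensor_field) \<Rightarrow>
     (('m, 'e) tensor_field \<Rightarrow> ('m, 'e) tensor_field) \<Rightarrow>
     'm \<Rightarrow> ('m, 'e) tvec \<Rightarrow> ('m, 'e) tvec \<Rightarrow> ('m, 'e) tvec" where
  "derivation_diff A D' D = (THE \<sigma>. \<sigma> \<in> tangent_valued_forms A \<and>
     (\<forall>\<alpha>\<in>sym_forms A 1. D' \<alpha> - D \<alpha> = contract \<sigma> \<alpha>))"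

text \<open>Weyl's axioms: a set of points S with a subtraction map (the difference of t and s
  is \<open>diff t s\<close>) into the vector space V. The axioms do not
  require S to be nonempty.\<close>

definition affine_space_over ::
    "'v::real_vector set \<Rightarrow> 's set \<Rightarrow> ('s \<Rightarrow> 's \<Rightarrow> 'v) \<Rightarrow> bool" where
  "affine_space_over V S diff \<longleftrightarrow>
     subspace V \<and>
     (\<forall>s\<in>S. \<forall>t\<in>S. diff t s \<in> V) \<and>
     (\<forall>s\<in>S. \<forall>v\<in>V. \<exists>!t. t \<in> S \<and> diff t s = v) \<and>
     (\<forall>s\<in>S. \<forall>t\<in>S. \<forall>u\<in>S. diff u t + diff t s = diff u s)"

definition affine_isomorphism ::
    "'v::real_vector set \<Rightarrow> 's set \<Rightarrow> ('s \<Rightarrow> 's \<Rightarrow> 'v) \<Rightarrow> 't set \<Rightarrow> ('t \<Rightarrow> 't \<Rightarrow> 'v) \<Rightarrow>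
     ('s \<Rightarrow> 't) \<Rightarrow> bool" where
  "affine_isomorphism V S diff T diff' F \<longleftrightarrow>
     affine_space_over V S diff \<and> affine_space_over V T diff' \<and>
     bij_betw F S T \<and>
     (\<exists>L. bij_betw L V V \<and>
        (\<forall>v\<in>V. \<forall>w\<in>V. \<forall>a b. L (a *\<^sub>R v + b *\<^sub>R w) = a *\<^sub>R L v + b *\<^sub>R L w) \<and>
        (\<forall>s\<in>S. \<forall>t\<in>S. diff' (F t) (F s) = L (diff t s)))"

end

theory Submission
  imports Defs
begin

text \<open>The antisymmetric part of a torsion-free connection is the Lie bracket, so such a connection is
  the same thing as its symmetrised derivative \<open>S X Y = \<nabla>\<^sub>X Y + \<nabla>\<^sub>Y X\<close>. On a one-form the symmetric
  derivative is \<open>(X, Y) \<mapsto> X(\<alpha> Y) + Y(\<alpha> X) - \<alpha> (S X Y)\<close>, hence it also contains exactly the information in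
  S. This gives injectivity (\<open>inj_on_symmetric_derivative\<close>), and read backwards it is a Koszul formula
  \<open>2 \<alpha> (\<nabla>\<^sub>X Y) = X(\<alpha> Y) + Y(\<alpha> X) - (D \<alpha>)(X, Y) + \<alpha> [X, Y]\<close> that produces the connection of a given
  geometric derivation D (\<open>ex_connection_of_geometric_derivation\<close>): the right-hand side is linear in
  \<open>\<alpha>\<close> over the smooth functions, so it is the pairing of \<open>\<alpha>\<close> with a vector field. Adding \<open>\<sigma>\<close> to the
  connection adds \<open>- 2 \<alpha> \<circ> \<sigma>\<close> to the derivation. The map is therefore affine with linear part
  multiplication by \<open>- 2\<close>, and the affine structure of the geometric derivations follows from that of
  the connections by transport along the bijection.

  What needs work is that \<open>\<nabla>\<^sup>s\<close> is well defined. A geometric derivation is determined by its values on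
  one-forms (\<open>sym_derivations_eqI\<close>): by Euler's identity for homogeneous polynomials, a form of degree
  \<open>r + 1\<close> is locally a sum of products of one-forms with forms of degree r, and induction applies. For
  existence, forms are regarded as functions of lists of vector fields. The product of forms becomes
  a shuffle product, characterised by the property that inserting a fixed first argument X is a
  derivation (\<open>shuffle_prod\<close>). The symmetric derivative is defined by a recursion prescribing its
  commutator with this insertion (\<open>field_derivative\<close>), the commutator being again a derivation; the
  Leibniz rule is then an induction on the argument list that involves no combinatorics. Linearity
  over the smooth functions shows that the result is a tensor field, because tensorial functions of
  vector fields depend on the values of the fields at a point only (\<open>tensorial_pointwise\<close>). All
  passages between local and global objects use cut-off functions, which exist since the manifold
  is Hausdorff.\<close>


section \<open>Calculus of smooth maps\<close>

lemma Ck_on_SucD: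
  assumes "Ck_on (Suc k) S f" "x \<in> S"
  shows "(f has_derivative frechet_derivative f (at x)) (at x)"
  using assms frechet_derivative_works by auto

lemma Ck_on_cong:
  assumes "open S" "\<And>x. x \<in> S \<Longrightarrow> f x = g x" "Ck_on k S f"
  shows "Ck_on k S g"
  using assms(2,3)
proof (induction k arbitrary: f g)
  case 0
  then show ?case by (simp cong: continuous_on_cong)
next
  case (Suc k)
  have g: "(g has_derivative frechet_derivative f (at x)) (at x)" if "x \<in> S" for x
    by (rule has_derivative_transform_within_open[OF Ck_on_SucD[OF Suc.prems(2) that] assms(1) that])
      (rule Suc.prems(1))
  then have "frechet_derivative f (at x) = frechet_derivative g (at x)" if "x \<in> S" for x
    using frechet_derivative_at that by blast
  then have "Ck_on k S (\<lambda>x. frechet_derivative g (at x) v)" for v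
    using Suc.IH[of "\<lambda>x. frechet_derivative f (at x) v" "\<lambda>x. frechet_derivative g (at x) v"] Suc.prems(2)
    by simp
  with g show ?case by (auto simp: differentiable_def)
qed

lemma Ck_on_SucI:
  assumes "open S" "\<And>x. x \<in> S \<Longrightarrow> (f has_derivative F x) (at x)" "\<And>v. Ck_on k S (\<lambda>x. F x v)"
  shows "Ck_on (Suc k) S f"
proof -
  have "F x = frechet_derivative f (at x)" if "x \<in> S" for x
    using frechet_derivative_at[OF assms(2)[OF that]] .
  then have "Ck_on k S (\<lambda>x. frechet_derivative f (at x) v)" for v
    by (intro Ck_on_cong[OF assms(1) _ assms(3)[of v]]) simp
  then show ?thesis using assms(2) by (auto simp: differentiable_def)
qed

lemma Ck_on_mono: "Ck_on (Suc k) S f \<Longrightarrow> Ck_on k S f"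
proof (induction k arbitrary: f)
  case 0
  then show ?case
    by (auto intro!: differentiable_imp_continuous_on simp: differentiable_on_def
        differentiable_at_withinI)
qed auto

lemma Ck_on_subset: "Ck_on k S f \<Longrightarrow> T \<subseteq> S \<Longrightarrow> Ck_on k T f"
  by (induction k arbitrary: f) (auto intro: continuous_on_subset)

lemma Ck_on_local:
  assumes "\<And>x. x \<in> S \<Longrightarrow> \<exists>U. open U \<and> x \<in> U \<and> Ck_on k U f"
  shows "Ck_on k S f"
  using assms
proof (induction k arbitrary: f)
  case 0
  have "isCont f x" if "x \<in> S" for x
    using 0[OF that] continuous_on_eq_continuous_at by auto
  then show ?case by (simp add: continuous_at_imp_continuous_on)
next
  case (Suc k)
  show ?case
    unfolding Ck_on.simps
  proof (intro conjI ballI allI Suc.IH)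
    show "f differentiable at x" if "x \<in> S" for x
      using Suc.prems[OF that] by auto
    show "\<exists>U. open U \<and> x \<in> U \<and> Ck_on k U (\<lambda>x. frechet_derivative f (at x) v)" if "x \<in> S" for x v
      using Suc.prems[OF that] by auto
  qed
qed

lemma Ck_on_const: "open S \<Longrightarrow> Ck_on k S (\<lambda>x. c)"
  by (induction k arbitrary: c) auto

lemma Ck_on_add:
  assumes "open S" "Ck_on k S f" "Ck_on k S g"
  shows "Ck_on k S (\<lambda>x. f x + g x)"
  using assms(2,3)
proof (induction k arbitrary: f g)
  case 0
  then show ?case by (auto intro: continuous_intros)
next
  case (Suc k)
  show ?case
  proof (rule Ck_on_SucI[where F = "\<lambda>x v. frechet_derivative f (at x) v + frechet_derivative g (at x) v"])
    show "((\<lambda>x. f x + g x) has_derivative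
        (\<lambda>v. frechet_derivative f (at x) v + frechet_derivative g (at x) v)) (at x)" if "x \<in> S" for x
      by (rule has_derivative_add[OF Ck_on_SucD[OF Suc.prems(1) that] Ck_on_SucD[OF Suc.prems(2) that]])
  qed (use Suc assms(1) in auto)
qed

lemma Ck_on_linear:
  assumes "open S" "bounded_linear h" "Ck_on k S f"
  shows "Ck_on k S (\<lambda>x. h (f x))"
  using assms(3)
proof (induction k arbitrary: f)
  case 0
  then show ?case using assms(2) by (auto intro: bounded_linear.continuous_on)
next
  case (Suc k)
  show ?case
  proof (rule Ck_on_SucI[where F = "\<lambda>x v. h (frechet_derivative f (at x) v)"])
    show "((\<lambda>x. h (f x)) has_derivative (\<lambda>v. h (frechet_derivative f (at x) v))) (at x)" if "x \<in> S" for x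
      by (rule bounded_linear.has_derivative[OF assms(2) Ck_on_SucD[OF Suc.prems that]])
  qed (use Suc assms(1) in auto)
qed

lemma Ck_on_bounded_linear:
  assumes "open S" "bounded_linear h"
  shows "Ck_on k S h"
proof (cases k)
  case 0
  then show ?thesis using assms(2) by (simp add: linear_continuous_on)
next
  case (Suc n)
  have "Ck_on (Suc n) S h"
    by (rule Ck_on_SucI[where F = "\<lambda>x. h"])
      (use assms in \<open>auto intro: Ck_on_const bounded_linear_imp_has_derivative\<close>)
  then show ?thesis by (simp add: Suc)
qed

lemma Ck_on_scaleR:
  fixes f :: "'a::euclidean_space \<Rightarrow> real"
  assumes "open S" "Ck_on k S f" "Ck_on k S g"
  shows "Ck_on k S (\<lambda>x. f x *\<^sub>R g x)"
  using assms(2,3)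
proof (induction k arbitrary: f g)
  case 0
  then show ?case by (auto intro: continuous_intros)
next
  case (Suc k)
  show ?case
  proof (rule Ck_on_SucI[where F = "\<lambda>x v. f x *\<^sub>R frechet_derivative g (at x) v
      + frechet_derivative f (at x) v *\<^sub>R g x"])
    show "((\<lambda>x. f x *\<^sub>R g x) has_derivative (\<lambda>v. f x *\<^sub>R frechet_derivative g (at x) v
      + frechet_derivative f (at x) v *\<^sub>R g x)) (at x)" if "x \<in> S" for x
      by (rule has_derivative_scaleR[OF Ck_on_SucD[OF Suc.prems(1) that] Ck_on_SucD[OF Suc.prems(2) that]])
    show "Ck_on k S (\<lambda>x. f x *\<^sub>R frechet_derivative g (at x) v + frechet_derivative f (at x) v *\<^sub>R g x)" for v
      using Suc.prems Ck_on_mono[OF Suc.prems(1)] Ck_on_mono[OF Suc.prems(2)]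
      by (intro Ck_on_add Suc.IH assms(1)) auto
  qed (use assms(1) in auto)
qed

lemma Ck_on_sum:
  assumes "open S" "\<And>i. i \<in> I \<Longrightarrow> Ck_on k S (f i)"
  shows "Ck_on k S (\<lambda>x. \<Sum>i\<in>I. f i x)"
  using assms(2)
proof (induction I rule: infinite_finite_induct)
  case (insert i I)
  then show ?case using Ck_on_add[OF assms(1), of k "f i" "\<lambda>x. \<Sum>i\<in>I. f i x"] by auto
qed (auto intro: Ck_on_const assms(1))

lemma linear_eq_sum_Basis:
  fixes h :: "'a::euclidean_space \<Rightarrow> 'b::real_vector"
  assumes "linear h"
  shows "h v = (\<Sum>b\<in>Basis. (v \<bullet> b) *\<^sub>R h b)"
proof -
  have "h v = h (\<Sum>b\<in>Basis. (v \<bullet> b) *\<^sub>R b)" by (simp add: euclidean_representation)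
  then show ?thesis by (simp only: linear_sum[OF assms] linear_scale[OF assms])
qed

lemma Ck_on_compose:
  fixes f :: "'a::euclidean_space \<Rightarrow> 'b::euclidean_space" and g :: "'b \<Rightarrow> 'c::real_normed_vector"
  assumes "open S" "open T" "f ` S \<subseteq> T" "Ck_on k S f" "Ck_on k T g"
  shows "Ck_on k S (\<lambda>x. g (f x))"
  using assms(4,5)
proof (induction k arbitrary: g)
  case 0
  then show ?case using assms(3) continuous_on_compose2 by auto
next
  case (Suc k)
  note f = Suc.prems(1) and g = Suc.prems(2)
  let ?F = "\<lambda>x v. \<Sum>b\<in>Basis. (frechet_derivative f (at x) v \<bullet> b) *\<^sub>R frechet_derivative g (at (f x)) b"
  show ?case
  proof (rule Ck_on_SucI[where F = ?F])
    show "((\<lambda>x. g (f x)) has_derivative ?F x) (at x)" if x: "x \<in> S" for x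
    proof -
      have "f x \<in> T" using x assms(3) by auto
      note gd = Ck_on_SucD[OF g this]
      have "((\<lambda>x. g (f x)) has_derivative (\<lambda>v. frechet_derivative g (at (f x)) (frechet_derivative f (at x) v))) (at x)"
        using diff_chain_at[OF Ck_on_SucD[OF f x] gd] by (simp add: o_def)
      then show ?thesis
        unfolding linear_eq_sum_Basis[OF has_derivative_linear[OF gd],
            of "frechet_derivative f (at x) v" for v] .
    qed
    show "Ck_on k S (\<lambda>x. ?F x v)" for v
    proof (intro Ck_on_sum Ck_on_scaleR assms(1))
      fix b :: 'b
      show "Ck_on k S (\<lambda>x. frechet_derivative f (at x) v \<bullet> b)"
        using f by (intro Ck_on_linear[OF assms(1) bounded_linear_inner_left]) auto
      show "Ck_on k S (\<lambda>x. frechet_derivative g (at (f x)) b)"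
        using Suc.IH[of "\<lambda>y. frechet_derivative g (at y) b"] Ck_on_mono[OF f] g by auto
    qed
  qed (use assms(1) in auto)
qed

lemma smooth_on_cong:
  "open S \<Longrightarrow> smooth_on S f \<Longrightarrow> (\<And>x. x \<in> S \<Longrightarrow> f x = g x) \<Longrightarrow> smooth_on S g"
  unfolding smooth_on_def by (intro allI) (rule Ck_on_cong[of S f g], auto)

lemma smooth_on_subset: "smooth_on S f \<Longrightarrow> T \<subseteq> S \<Longrightarrow> smooth_on T f"
  unfolding smooth_on_def by (auto intro: Ck_on_subset)

lemma smooth_on_local:
  "(\<And>x. x \<in> S \<Longrightarrow> \<exists>U. open U \<and> x \<in> U \<and> smooth_on U f) \<Longrightarrow> smooth_on S f"
  unfolding smooth_on_def by (intro allI Ck_on_local) blast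

lemma smooth_on_const: "open S \<Longrightarrow> smooth_on S (\<lambda>x. c)"
  by (simp add: smooth_on_def Ck_on_const)

lemma smooth_on_add:
  "open S \<Longrightarrow> smooth_on S f \<Longrightarrow> smooth_on S g \<Longrightarrow> smooth_on S (\<lambda>x. f x + g x)"
  by (simp add: smooth_on_def Ck_on_add)

lemma smooth_on_bounded_linear: "open S \<Longrightarrow> bounded_linear h \<Longrightarrow> smooth_on S h"
  by (simp add: smooth_on_def Ck_on_bounded_linear)

lemma smooth_on_linear:
  "open S \<Longrightarrow> bounded_linear h \<Longrightarrow> smooth_on S f \<Longrightarrow> smooth_on S (\<lambda>x. h (f x))"
  by (simp add: smooth_on_def Ck_on_linear)

lemma smooth_on_scaleR:
  fixes f :: "'a::euclidean_space \<Rightarrow> real"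
  shows "open S \<Longrightarrow> smooth_on S f \<Longrightarrow> smooth_on S g \<Longrightarrow> smooth_on S (\<lambda>x. f x *\<^sub>R g x)"
  by (simp add: smooth_on_def Ck_on_scaleR)

lemma smooth_on_sum:
  "open S \<Longrightarrow> (\<And>i. i \<in> I \<Longrightarrow> smooth_on S (f i)) \<Longrightarrow> smooth_on S (\<lambda>x. \<Sum>i\<in>I. f i x)"
  by (simp add: smooth_on_def Ck_on_sum)

lemma smooth_on_compose:
  fixes f :: "'a::euclidean_space \<Rightarrow> 'b::euclidean_space" and g :: "'b \<Rightarrow> 'c::real_normed_vector"
  shows "open S \<Longrightarrow> open T \<Longrightarrow> f ` S \<subseteq> T \<Longrightarrow> smooth_on S f \<Longrightarrow> smooth_on T g \<Longrightarrow> smooth_on S (\<lambda>x. g (f x))"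
  by (simp add: smooth_on_def Ck_on_compose)

lemma smooth_on_has_derivative:
  "smooth_on S f \<Longrightarrow> x \<in> S \<Longrightarrow> (f has_derivative frechet_derivative f (at x)) (at x)"
  unfolding smooth_on_def by (rule Ck_on_SucD[of 0]) (erule allE)

lemma smooth_on_frechet_derivative_const:
  "smooth_on S f \<Longrightarrow> smooth_on S (\<lambda>x. frechet_derivative f (at x) v)"
  unfolding smooth_on_def
proof
  fix k assume "\<forall>k. Ck_on k S f"
  then have "Ck_on (Suc k) S f" by blast
  then show "Ck_on k S (\<lambda>x. frechet_derivative f (at x) v)" by simp
qed

lemma smooth_on_frechet_derivative:
  assumes "open S" "smooth_on S f" "smooth_on S g"
  shows "smooth_on S (\<lambda>x. frechet_derivative f (at x) (g x))"
proof (rule smooth_on_cong[OF assms(1)])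
  show "smooth_on S (\<lambda>x. \<Sum>b\<in>Basis. (g x \<bullet> b) *\<^sub>R frechet_derivative f (at x) b)"
    by (intro smooth_on_sum smooth_on_scaleR smooth_on_frechet_derivative_const assms
        smooth_on_linear[OF _ bounded_linear_inner_left])
  show "(\<Sum>b\<in>Basis. (g x \<bullet> b) *\<^sub>R frechet_derivative f (at x) b) = frechet_derivative f (at x) (g x)"
    if "x \<in> S" for x
    by (rule linear_eq_sum_Basis[symmetric, OF has_derivative_linear[OF smooth_on_has_derivative[OF assms(2) that]]])
qed

text \<open>The mean value theorem, applied in the direction of u and then of v, turns the second difference
  into the value of a mixed second derivative at a nearby point. The second difference is symmetric
  in u and v; this yields the symmetry of second derivatives.\<close>

lemma second_difference_mean_value:
  fixes f :: "'a::euclidean_space \<Rightarrow> real"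
  assumes "0 < t" and f: "smooth_on S f"
    and box: "\<forall>a\<in>{0..t}. \<forall>b\<in>{0..t}. x + a *\<^sub>R u + b *\<^sub>R v \<in> S"
  obtains a b where "0 < a" "a < t" "0 < b" "b < t"
    "f (x + t *\<^sub>R u + t *\<^sub>R v) - f (x + t *\<^sub>R u) - f (x + t *\<^sub>R v) + f x =
       t * t * frechet_derivative (\<lambda>y. frechet_derivative f (at y) u) (at (x + a *\<^sub>R u + b *\<^sub>R v)) v"
proof -
  let ?D = "\<lambda>y. frechet_derivative f (at y) u"
  have along_u: "((\<lambda>s. f (x + s *\<^sub>R u + b *\<^sub>R v)) has_real_derivative ?D (x + s *\<^sub>R u + b *\<^sub>R v)) (at s)"
    if "0 \<le> s" "s \<le> t" "0 \<le> b" "b \<le> t" for s b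
  proof -
    have "x + s *\<^sub>R u + b *\<^sub>R v \<in> S" using box that by auto
    note fd = smooth_on_has_derivative[OF f this]
    let ?line = "\<lambda>s. x + s *\<^sub>R u + b *\<^sub>R v"
    have "(?line has_derivative (\<lambda>h. h *\<^sub>R u)) (at s)"
      by (auto intro!: derivative_eq_intros)
    moreover have "frechet_derivative f (at (x + s *\<^sub>R u + b *\<^sub>R v)) \<circ> (\<lambda>h. h *\<^sub>R u)
        = (*) (?D (x + s *\<^sub>R u + b *\<^sub>R v))"
      by (simp add: fun_eq_iff linear_scale[OF has_derivative_linear[OF fd]])
    ultimately show ?thesis
      using diff_chain_at[where f = "?line" and x = s and f' = "\<lambda>h. h *\<^sub>R u", OF _ fd]
      by (simp add: o_def has_field_derivative_def)
  qed
  have along_v: "((\<lambda>s. ?D (x + a *\<^sub>R u + s *\<^sub>R v)) has_real_derivative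
      frechet_derivative ?D (at (x + a *\<^sub>R u + s *\<^sub>R v)) v) (at s)"
    if "0 \<le> a" "a \<le> t" "0 \<le> s" "s \<le> t" for s a
  proof -
    have "x + a *\<^sub>R u + s *\<^sub>R v \<in> S" using box that by auto
    note fd = smooth_on_has_derivative[OF smooth_on_frechet_derivative_const[OF f, of u] this]
    let ?line = "\<lambda>s. x + a *\<^sub>R u + s *\<^sub>R v"
    have "(?line has_derivative (\<lambda>h. h *\<^sub>R v)) (at s)"
      by (auto intro!: derivative_eq_intros)
    moreover have "frechet_derivative ?D (at (x + a *\<^sub>R u + s *\<^sub>R v)) \<circ> (\<lambda>h. h *\<^sub>R v)
        = (*) (frechet_derivative ?D (at (x + a *\<^sub>R u + s *\<^sub>R v)) v)"
      by (simp add: fun_eq_iff linear_scale[OF has_derivative_linear[OF fd]])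
    ultimately show ?thesis
      using diff_chain_at[where f = "?line" and x = s and f' = "\<lambda>h. h *\<^sub>R v", OF _ fd]
      by (simp add: o_def has_field_derivative_def)
  qed
  define g where "g s = f (x + s *\<^sub>R u + t *\<^sub>R v) - f (x + s *\<^sub>R u)" for s
  have "\<exists>a>0. a < t \<and> g t - g 0 = (t - 0) * (?D (x + a *\<^sub>R u + t *\<^sub>R v) - ?D (x + a *\<^sub>R u + 0 *\<^sub>R v))"
    using \<open>0 < t\<close> DERIV_diff[OF along_u[of _ t] along_u[of _ 0]]
    by (intro MVT2) (auto simp: g_def)
  then obtain a where a: "0 < a" "a < t"
    "g t - g 0 = t * (?D (x + a *\<^sub>R u + t *\<^sub>R v) - ?D (x + a *\<^sub>R u + 0 *\<^sub>R v))" by auto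
  have "\<exists>b>0. b < t \<and> ?D (x + a *\<^sub>R u + t *\<^sub>R v) - ?D (x + a *\<^sub>R u + 0 *\<^sub>R v)
      = (t - 0) * frechet_derivative ?D (at (x + a *\<^sub>R u + b *\<^sub>R v)) v"
    using \<open>0 < t\<close> a(1,2) along_v[of a]
    by (intro MVT2[where f = "\<lambda>s. ?D (x + a *\<^sub>R u + s *\<^sub>R v)"]) auto
  then obtain b where "0 < b" "b < t"
    "?D (x + a *\<^sub>R u + t *\<^sub>R v) - ?D (x + a *\<^sub>R u + 0 *\<^sub>R v)
      = t * frechet_derivative ?D (at (x + a *\<^sub>R u + b *\<^sub>R v)) v" by auto
  with a that[of a b] show thesis by (simp add: g_def)
qed

lemma frechet_derivative_commute:
  fixes f :: "'a::euclidean_space \<Rightarrow> real"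
  assumes S: "open S" and f: "smooth_on S f" and x: "x \<in> S"
  shows "frechet_derivative (\<lambda>y. frechet_derivative f (at y) u) (at x) v =
         frechet_derivative (\<lambda>y. frechet_derivative f (at y) v) (at x) u"
proof (rule ccontr)
  define F where "F u v y = frechet_derivative (\<lambda>y. frechet_derivative f (at y) u) (at y) v" for u v y
  assume "\<not> ?thesis"
  then have e: "\<bar>F u v x - F v u x\<bar> / 2 > 0" by (simp add: F_def)
  have "smooth_on S (F u v)" "smooth_on S (F v u)"
    unfolding F_def by (intro smooth_on_frechet_derivative_const f)+
  then have "continuous_on S (F u v)" "continuous_on S (F v u)"
    unfolding smooth_on_def by (metis Ck_on.simps(1))+
  then have "isCont (F u v) x" "isCont (F v u) x"
    using S x continuous_on_eq_continuous_at by auto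
  then obtain d1 d2 where d: "d1 > 0" "d2 > 0"
      "\<And>y. dist y x < d1 \<Longrightarrow> dist (F u v y) (F u v x) < \<bar>F u v x - F v u x\<bar> / 2"
      "\<And>y. dist y x < d2 \<Longrightarrow> dist (F v u y) (F v u x) < \<bar>F u v x - F v u x\<bar> / 2"
    using e unfolding continuous_at_eps_delta by metis
  obtain d3 where d3: "d3 > 0" "ball x d3 \<subseteq> S" using S x openE by blast
  define m where "m = min d1 (min d2 d3)"
  have m: "m > 0" using d d3 by (simp add: m_def)
  define K where "K = norm u + norm v + 1"
  have K: "K > 0" unfolding K_def by (smt (verit) norm_ge_zero)
  define t where "t = m / (2 * K)"
  have t: "t > 0" using m K by (simp add: t_def)
  have near: "dist (x + a *\<^sub>R u + b *\<^sub>R v) x < m" if "0 \<le> a" "a \<le> t" "0 \<le> b" "b \<le> t" for a b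
  proof -
    have "dist (x + a *\<^sub>R u + b *\<^sub>R v) x \<le> norm (a *\<^sub>R u) + norm (b *\<^sub>R v)"
      using norm_triangle_ineq[of "a *\<^sub>R u" "b *\<^sub>R v"] by (simp add: dist_norm add.assoc)
    also have "\<dots> \<le> t * norm u + t * norm v"
      using that by (intro add_mono) (auto intro: mult_right_mono)
    also have "\<dots> \<le> t * K" using t by (simp add: K_def algebra_simps)
    also have "\<dots> = m / 2" using K by (simp add: t_def)
    finally show ?thesis using m by simp
  qed
  have box: "x + a *\<^sub>R u + b *\<^sub>R v \<in> S" if "a \<in> {0..t}" "b \<in> {0..t}" for a b
    using near[of a b] that d3 by (auto simp: m_def dist_commute)
  then have box': "\<forall>a\<in>{0..t}. \<forall>b\<in>{0..t}. x + a *\<^sub>R v + b *\<^sub>R u \<in> S"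
    by (metis add.assoc add.commute)
  obtain a b where ab: "0 < a" "a < t" "0 < b" "b < t"
    "f (x + t *\<^sub>R u + t *\<^sub>R v) - f (x + t *\<^sub>R u) - f (x + t *\<^sub>R v) + f x
      = t * t * F u v (x + a *\<^sub>R u + b *\<^sub>R v)"
    unfolding F_def by (rule second_difference_mean_value[OF t f, of x u v]) (use box in auto)
  obtain b' a' where ab': "0 < b'" "b' < t" "0 < a'" "a' < t"
    "f (x + t *\<^sub>R v + t *\<^sub>R u) - f (x + t *\<^sub>R v) - f (x + t *\<^sub>R u) + f x
      = t * t * F v u (x + b' *\<^sub>R v + a' *\<^sub>R u)"
    unfolding F_def by (rule second_difference_mean_value[OF t f box'])
  have "t * t * F u v (x + a *\<^sub>R u + b *\<^sub>R v) = t * t * F v u (x + b' *\<^sub>R v + a' *\<^sub>R u)"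
    using ab(5) ab'(5) by (simp add: algebra_simps)
  then have "F u v (x + a *\<^sub>R u + b *\<^sub>R v) = F v u (x + a' *\<^sub>R u + b' *\<^sub>R v)"
    using t by (simp add: algebra_simps)
  moreover have "dist (F u v (x + a *\<^sub>R u + b *\<^sub>R v)) (F u v x) < \<bar>F u v x - F v u x\<bar> / 2"
    using near[of a b] ab by (intro d) (auto simp: m_def)
  moreover have "dist (F v u (x + a' *\<^sub>R u + b' *\<^sub>R v)) (F v u x) < \<bar>F u v x - F v u x\<bar> / 2"
    using near[of a' b'] ab' by (intro d) (auto simp: m_def)
  ultimately show False by (auto simp: dist_real_def abs_if split: if_splits)
qed


text \<open>Symmetry of the second derivative puts the direction of differentiation and the field on an equal
  footing; this is what cancels the second-order terms in a commutator of vector fields.\<close>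

lemma has_derivative_along_field:
  fixes F :: "'a::euclidean_space \<Rightarrow> real" and G :: "'a \<Rightarrow> 'a"
  assumes S: "open S" and F: "smooth_on S F" and G: "smooth_on S G" and x: "x \<in> S"
  shows "((\<lambda>y. frechet_derivative F (at y) (G y)) has_derivative
    (\<lambda>u. frechet_derivative (\<lambda>y. frechet_derivative F (at y) (G x)) (at x) u
       + frechet_derivative F (at x) (frechet_derivative G (at x) u))) (at x)"
proof -
  let ?D = "\<lambda>b y. frechet_derivative F (at y) b"
  let ?H = "\<lambda>b. frechet_derivative (?D b) (at x)"
  let ?G' = "frechet_derivative G (at x)"
  note Dd = smooth_on_has_derivative[OF smooth_on_frechet_derivative_const[OF F] x]
  note Gd = smooth_on_has_derivative[OF G x]
  have lin: "linear (frechet_derivative F (at y))" if "y \<in> S" for y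
    using has_derivative_linear[OF smooth_on_has_derivative[OF F that]] .
  have "((\<lambda>y. \<Sum>b\<in>Basis. (G y \<bullet> b) * ?D b y) has_derivative
      (\<lambda>u. \<Sum>b\<in>Basis. (G x \<bullet> b) * ?H b u + (?G' u \<bullet> b) * ?D b x)) (at x)"
    by (intro has_derivative_sum has_derivative_mult Dd has_derivative_inner_left Gd)
  then have 1: "((\<lambda>y. frechet_derivative F (at y) (G y)) has_derivative
      (\<lambda>u. \<Sum>b\<in>Basis. (G x \<bullet> b) * ?H b u + (?G' u \<bullet> b) * ?D b x)) (at x)"
  proof (rule has_derivative_transform_within_open[OF _ S x])
    show "(\<Sum>b\<in>Basis. (G y \<bullet> b) * ?D b y) = frechet_derivative F (at y) (G y)" if "y \<in> S" for y
      using linear_eq_sum_Basis[OF lin[OF that], of "G y"] by (simp only: real_scaleR_def)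
  qed
  have 2: "(\<Sum>b\<in>Basis. (G x \<bullet> b) * ?H b u + (?G' u \<bullet> b) * ?D b x) = ?H (G x) u + ?D (?G' u) x" for u
  proof -
    have "(\<Sum>b\<in>Basis. (G x \<bullet> b) * ?H b u) = (\<Sum>b\<in>Basis. (G x \<bullet> b) * ?H u b)"
      by (simp only: frechet_derivative_commute[OF S F x, of u])
    also have "\<dots> = ?H u (G x)"
      using linear_eq_sum_Basis[OF has_derivative_linear[OF Dd[of u]], of "G x"] by (simp only: real_scaleR_def)
    also have "\<dots> = ?H (G x) u" by (rule frechet_derivative_commute[OF S F x])
    finally show ?thesis
      using linear_eq_sum_Basis[OF lin[OF x], of "?G' u"] by (simp only: sum.distrib real_scaleR_def)
  qed
  show ?thesis using 1 unfolding 2 .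
qed

section \<open>Smooth bump functions\<close>

text \<open>The functions \<open>t\<^sup>-\<^sup>n exp (- 1 / t)\<close>, extended by 0 to the negative half line, are closed under
  differentiation up to linear combinations; this makes all of them smooth at once.\<close>

definition flat_exp :: "nat \<Rightarrow> real \<Rightarrow> real" where
  "flat_exp n t = (if t > 0 then inverse t ^ n * exp (- inverse t) else 0)"

lemma flat_exp_tendsto_0: "(flat_exp n \<longlongrightarrow> 0) (at 0)"
proof -
  have "((\<lambda>t. inverse t ^ n * exp (- inverse t)) \<longlongrightarrow> 0) (at_right (0::real))"
    using filterlim_compose[OF tendsto_power_div_exp_0[of n] filterlim_inverse_at_top_right]
    by (simp add: exp_minus divide_inverse)
  then have "(flat_exp n \<longlongrightarrow> 0) (at_right 0)"
    by (rule Lim_transform_eventually) (auto simp: flat_exp_def eventually_at_right_less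
        intro: eventually_mono[OF eventually_at_right_less])
  moreover have "(flat_exp n \<longlongrightarrow> 0) (at_left 0)"
    by (rule Lim_transform_eventually[OF tendsto_const]) 
      (auto simp: flat_exp_def intro: eventually_mono[OF eventually_at_left_real[of "-1"]])
  ultimately show ?thesis by (simp add: filterlim_at_split)
qed

lemma flat_exp_has_derivative:
  "(flat_exp n has_real_derivative (flat_exp (n + 2) t - real n * flat_exp (n + 1) t)) (at t)"
proof -
  consider "t > 0" | "t = 0" | "t < 0" by linarith
  then show ?thesis
  proof cases
    case 1
    have inv: "(inverse has_real_derivative - (inverse t * inverse t)) (at t)"
      using DERIV_inverse[of t UNIV] 1 by (simp add: power2_eq_square)
    have "((\<lambda>t. exp (- inverse t)) has_real_derivative exp (- inverse t) * (inverse t * inverse t)) (at t)"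
      using DERIV_fun_exp[OF DERIV_minus[OF inv]] by simp
    from DERIV_mult[OF DERIV_power[OF inv, of n] this]
    have "((\<lambda>t. inverse t ^ n * exp (- inverse t)) has_real_derivative
        (flat_exp (n + 2) t - real n * flat_exp (n + 1) t)) (at t)"
      by (rule DERIV_cong) (use 1 in \<open>cases n; simp add: flat_exp_def algebra_simps\<close>)
    then show ?thesis
      by (rule has_field_derivative_transform_within_open[where S = "{0<..}"]) (use 1 in \<open>auto simp: flat_exp_def\<close>)
  next
    case 2
    have "(\<lambda>h. (flat_exp n (0 + h) - flat_exp n 0) / h) = flat_exp (Suc n)"
      by (auto simp: fun_eq_iff flat_exp_def divide_inverse mult.commute)
    then have "(flat_exp n has_real_derivative 0) (at 0)"
      unfolding DERIV_def using flat_exp_tendsto_0[of "Suc n"] by metis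
    then show ?thesis
      using 2 by (simp add: flat_exp_def)
  next
    case 3
    have "((\<lambda>t. 0) has_real_derivative (flat_exp (n + 2) t - real n * flat_exp (n + 1) t)) (at t)"
      using 3 by (simp add: flat_exp_def)
    then show ?thesis
      by (rule has_field_derivative_transform_within_open[where S = "{..<0}"]) (use 3 in \<open>auto simp: flat_exp_def\<close>)
  qed
qed

lemma smooth_on_flat_exp: "smooth_on UNIV (flat_exp n)"
  unfolding smooth_on_def
proof
  fix k show "Ck_on k UNIV (flat_exp n)"
  proof (induction k arbitrary: n)
    case 0
    show ?case
      using DERIV_isCont[OF flat_exp_has_derivative] by (simp add: continuous_at_imp_continuous_on)
  next
    case (Suc k)
    show ?case
    proof (rule Ck_on_SucI[where F = "\<lambda>t h. (flat_exp (n + 2) t - real n * flat_exp (n + 1) t) * h"])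
      show "(flat_exp n has_derivative (\<lambda>h. (flat_exp (n + 2) t - real n * flat_exp (n + 1) t) * h)) (at t)" for t
        using flat_exp_has_derivative[of n t] by (simp add: has_field_derivative_def)
      have "Ck_on k UNIV (\<lambda>t. h *\<^sub>R (flat_exp (n + 2) t + (- real n) *\<^sub>R flat_exp (n + 1) t))" for h
        by (intro Ck_on_scaleR Ck_on_add Ck_on_const Suc.IH open_UNIV)
      then show "Ck_on k UNIV (\<lambda>t. (flat_exp (n + 2) t - real n * flat_exp (n + 1) t) * h)" for h
        by (simp add: mult.commute)
    qed auto
  qed
qed

text \<open>Applying the flat exponential twice makes the step constant on both sides without any
  division by a function.\<close>

definition smooth_step :: "real \<Rightarrow> real" where
  "smooth_step t = 1 - flat_exp 0 (1 - flat_exp 0 t / flat_exp 0 1) / flat_exp 0 1"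

lemma smooth_step_0: "t \<le> 0 \<Longrightarrow> smooth_step t = 0"
  by (simp add: smooth_step_def flat_exp_def)

lemma smooth_step_1: "t \<ge> 1 \<Longrightarrow> smooth_step t = 1"
  by (simp add: smooth_step_def flat_exp_def field_simps)

lemma smooth_on_smooth_step: "smooth_on UNIV smooth_step"
proof -
  let ?c = "- inverse (flat_exp 0 1)"
  have reflect: "smooth_on UNIV (\<lambda>t. 1 + ?c *\<^sub>R f t)" if "smooth_on UNIV f" for f :: "real \<Rightarrow> real"
    by (rule smooth_on_add[OF open_UNIV smooth_on_const[OF open_UNIV]
          smooth_on_scaleR[OF open_UNIV smooth_on_const[OF open_UNIV] that]])
  have "smooth_on UNIV (\<lambda>t. flat_exp 0 (1 + ?c *\<^sub>R flat_exp 0 t))"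
    by (rule smooth_on_compose[OF _ _ _ reflect[OF smooth_on_flat_exp] smooth_on_flat_exp]) auto
  from reflect[OF this] show ?thesis
    by (simp add: smooth_step_def[abs_def] divide_inverse mult.commute)
qed

lemma bump_function_euclidean:
  fixes x :: "'a::euclidean_space"
  assumes "0 < r"
  obtains g :: "'a \<Rightarrow> real" where "smooth_on UNIV g" "\<And>y. y \<in> ball x r \<Longrightarrow> g y = 1"
    "\<And>y. y \<notin> cball x (2 * r) \<Longrightarrow> g y = 0"
proof
  let ?q = "\<lambda>y. 2 + (- inverse (r * r)) *\<^sub>R (\<Sum>b\<in>Basis. ((y - x) \<bullet> b) *\<^sub>R ((y - x) \<bullet> b))"
  have q: "?q y = 2 - (dist x y / r)\<^sup>2" for y
  proof -
    have "(\<Sum>b\<in>Basis. ((y - x) \<bullet> b) *\<^sub>R ((y - x) \<bullet> b)) = (dist x y)\<^sup>2"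
      using euclidean_inner[of "y - x" "y - x"]
      by (simp add: dist_norm norm_minus_commute[of x] dot_square_norm)
    then show ?thesis by (simp add: power2_eq_square divide_inverse)
  qed
  have lin: "smooth_on UNIV (\<lambda>y. (y - x) \<bullet> b)" for b
    using smooth_on_add[OF open_UNIV smooth_on_bounded_linear[OF open_UNIV bounded_linear_inner_left[of b]]
        smooth_on_const[OF open_UNIV, of "- (x \<bullet> b)"]]
    by (simp add: inner_diff_left)
  show "smooth_on UNIV (\<lambda>y. smooth_step (?q y))"
    by (rule smooth_on_compose[OF open_UNIV open_UNIV _ _ smooth_on_smooth_step], simp)
      (intro smooth_on_add smooth_on_const smooth_on_sum smooth_on_scaleR lin open_UNIV)
  show "smooth_step (?q y) = 1" if "y \<in> ball x r" for y
  proof -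
    have "(dist x y / r)\<^sup>2 \<le> 1"
      using that assms by (auto intro!: power_le_one)
    then show ?thesis unfolding q by (intro smooth_step_1) simp
  qed
  show "smooth_step (?q y) = 0" if "y \<notin> cball x (2 * r)" for y
  proof -
    have "2 \<le> dist x y / r" using that assms by (simp add: field_simps)
    then have "2\<^sup>2 \<le> (dist x y / r)\<^sup>2" by (intro power_mono) auto
    then show ?thesis unfolding q by (intro smooth_step_0) simp
  qed
qed


section \<open>Smooth functions on open subsets of a manifold\<close>

lemma sum_fun_apply: "(\<Sum>i\<in>I. f i) x = (\<Sum>i\<in>I. f i x)"
  by (induction I rule: infinite_finite_induct) auto

locale smooth_mfd =
  fixes A :: "('m::{t2_space, second_countable_topology}, 'e::euclidean_space) chart set"
  assumes smooth_manifold: "smooth_manifold A"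
begin

abbreviation "V \<equiv> vector_fields A"
abbreviation "C \<equiv> smooth_functions A"
abbreviation "T \<equiv> tangent_space A"

lemma ex_chart: obtains c where "c \<in> A" "p \<in> fst c"
  using smooth_manifold unfolding smooth_manifold_def by blast

lemma chart_homeomorphism: "c \<in> A \<Longrightarrow> homeomorphism (fst c) (chart_image c) (snd c) (chart_inv c)"
  and chart_open: "c \<in> A \<Longrightarrow> open (fst c)"
  and chart_image_open: "c \<in> A \<Longrightarrow> open (chart_image c)"
  using smooth_manifold unfolding smooth_manifold_def by auto

lemma transition_smooth:
  "c \<in> A \<Longrightarrow> d \<in> A \<Longrightarrow> smooth_on (snd c ` (fst c \<inter> fst d)) (snd d \<circ> chart_inv c)"
  using smooth_manifold unfolding smooth_manifold_def by auto

lemma chart_inv_left: "c \<in> A \<Longrightarrow> p \<in> fst c \<Longrightarrow> chart_inv c (snd c p) = p"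
  using homeomorphism_apply1[OF chart_homeomorphism] .

lemma chart_inv_right: "c \<in> A \<Longrightarrow> x \<in> chart_image c \<Longrightarrow> snd c (chart_inv c x) = x"
  using homeomorphism_apply2[OF chart_homeomorphism] .

lemma chart_inv_in: "c \<in> A \<Longrightarrow> x \<in> chart_image c \<Longrightarrow> chart_inv c x \<in> fst c"
  using homeomorphism_image2[OF chart_homeomorphism] by blast

lemma chart_image_eq:
  assumes "c \<in> A"
  shows "snd c ` (fst c \<inter> U) = chart_image c \<inter> chart_inv c -` U"
proof (intro equalityI subsetI)
  fix x assume "x \<in> snd c ` (fst c \<inter> U)"
  then show "x \<in> chart_image c \<inter> chart_inv c -` U"
    using assms by (auto simp: chart_image_def chart_inv_left)
next
  fix x assume "x \<in> chart_image c \<inter> chart_inv c -` U"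
  then have "x = snd c (chart_inv c x)" "chart_inv c x \<in> fst c \<inter> U"
    using assms by (auto simp: chart_inv_right chart_inv_in)
  then show "x \<in> snd c ` (fst c \<inter> U)" by (rule image_eqI)
qed

lemma open_chart_image:
  assumes "c \<in> A" "open U"
  shows "open (snd c ` (fst c \<inter> U))"
  unfolding chart_image_eq[OF assms(1)]
  by (rule continuous_open_preimage[OF _ chart_image_open[OF assms(1)] assms(2)])
    (use homeomorphism_cont2[OF chart_homeomorphism[OF assms(1)]] in simp)

lemma open_chart_preimage:
  assumes "c \<in> A" "open W"
  shows "open (fst c \<inter> snd c -` W)"
  by (rule continuous_open_preimage[OF _ chart_open[OF assms(1)] assms(2)])
    (use homeomorphism_cont1[OF chart_homeomorphism[OF assms(1)]] in simp)

text \<open>Testing smoothness in all charts at once makes the notion independent of the chart and local; by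
  smoothness of the transition maps one chart around each point is sufficient.\<close>

definition smooth_fun_on :: "'m set \<Rightarrow> ('m \<Rightarrow> 'b::real_normed_vector) \<Rightarrow> bool" where
  "smooth_fun_on U f \<longleftrightarrow> (\<forall>c\<in>A. smooth_on (snd c ` (fst c \<inter> U)) (f \<circ> chart_inv c))"

lemma smooth_functions_iff: "f \<in> C \<longleftrightarrow> smooth_fun_on UNIV f"
  by (simp add: smooth_functions_def smooth_fun_on_def chart_image_def)

lemma smooth_fun_on_chartD:
  assumes "smooth_fun_on U f" "c \<in> A" "U \<subseteq> fst c"
  shows "smooth_on (snd c ` U) (f \<circ> chart_inv c)"
proof -
  have "fst c \<inter> U = U" using assms(3) by auto
  then show ?thesis using assms(1,2) by (auto simp: smooth_fun_on_def)
qed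

lemma smooth_fun_on_chartI:
  assumes c: "c \<in> A" and U: "open U" "U \<subseteq> fst c" and f: "smooth_on (snd c ` U) (f \<circ> chart_inv c)"
  shows "smooth_fun_on U f"
  unfolding smooth_fun_on_def
proof
  fix d assume d: "d \<in> A"
  have "U = fst c \<inter> U" using U by auto
  then have oU: "open (snd c ` U)" using open_chart_image[OF c U(1)] by simp
  let ?S = "snd d ` (fst d \<inter> U)"
  have "smooth_on ?S (\<lambda>x. (f \<circ> chart_inv c) ((snd c \<circ> chart_inv d) x))"
  proof (rule smooth_on_compose[OF open_chart_image[OF d U(1)] oU _ _ f])
    show "(snd c \<circ> chart_inv d) ` ?S \<subseteq> snd c ` U"
      using d by (auto simp: chart_inv_left)
    show "smooth_on ?S (snd c \<circ> chart_inv d)"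
      by (rule smooth_on_subset[OF transition_smooth[OF d c]]) (use U in auto)
  qed
  then show "smooth_on ?S (f \<circ> chart_inv d)"
    by (rule smooth_on_cong[OF open_chart_image[OF d U(1)]])
      (use c d U in \<open>auto simp: chart_inv_left subset_eq\<close>)
qed

lemma smooth_fun_on_subset: "smooth_fun_on U f \<Longrightarrow> W \<subseteq> U \<Longrightarrow> smooth_fun_on W f"
  unfolding smooth_fun_on_def by (meson smooth_on_subset Int_mono image_mono order_refl)

lemma smooth_fun_on_cong:
  assumes "open U" "smooth_fun_on U f" "\<And>p. p \<in> U \<Longrightarrow> f p = g p"
  shows "smooth_fun_on U g"
  unfolding smooth_fun_on_def
proof
  fix c assume c: "c \<in> A"
  show "smooth_on (snd c ` (fst c \<inter> U)) (g \<circ> chart_inv c)"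
    by (rule smooth_on_cong[OF open_chart_image[OF c assms(1)], of "f \<circ> chart_inv c"])
      (use assms c in \<open>auto simp: smooth_fun_on_def chart_inv_left\<close>)
qed

lemma smooth_fun_on_local:
  assumes "\<And>p. p \<in> U \<Longrightarrow> \<exists>W. open W \<and> p \<in> W \<and> smooth_fun_on W f"
  shows "smooth_fun_on U f"
  unfolding smooth_fun_on_def
proof (intro ballI smooth_on_local)
  fix c x assume c: "c \<in> A" and "x \<in> snd c ` (fst c \<inter> U)"
  then obtain p where p: "p \<in> fst c" "p \<in> U" "x = snd c p" by auto
  then obtain W where "open W" "p \<in> W" "smooth_fun_on W f" using assms by blast
  then show "\<exists>S. open S \<and> x \<in> S \<and> smooth_on S (f \<circ> chart_inv c)"
    using c p open_chart_image[OF c] by (intro exI[of _ "snd c ` (fst c \<inter> W)"]) (auto simp: smooth_fun_on_def)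
qed

lemma smooth_fun_on_const: "open U \<Longrightarrow> smooth_fun_on U (\<lambda>p. k)"
  by (simp add: smooth_fun_on_def o_def smooth_on_const open_chart_image)

lemma smooth_fun_on_add:
  "open U \<Longrightarrow> smooth_fun_on U f \<Longrightarrow> smooth_fun_on U g \<Longrightarrow> smooth_fun_on U (\<lambda>p. f p + g p)"
  by (simp add: smooth_fun_on_def o_def smooth_on_add open_chart_image)

lemma smooth_fun_on_scaleR:
  fixes f :: "'m \<Rightarrow> real"
  shows "open U \<Longrightarrow> smooth_fun_on U f \<Longrightarrow> smooth_fun_on U g \<Longrightarrow> smooth_fun_on U (\<lambda>p. f p *\<^sub>R g p)"
  by (simp add: smooth_fun_on_def o_def smooth_on_scaleR open_chart_image)

lemma smooth_fun_on_mult: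
  fixes f g :: "'m \<Rightarrow> real"
  shows "open U \<Longrightarrow> smooth_fun_on U f \<Longrightarrow> smooth_fun_on U g \<Longrightarrow> smooth_fun_on U (\<lambda>p. f p * g p)"
  using smooth_fun_on_scaleR[of U f g] by simp

lemma smooth_fun_on_linear:
  "open U \<Longrightarrow> bounded_linear h \<Longrightarrow> smooth_fun_on U f \<Longrightarrow> smooth_fun_on U (\<lambda>p. h (f p))"
  by (auto simp: smooth_fun_on_def o_def intro: smooth_on_linear[of _ h] open_chart_image)

lemmas smooth_fun_on_inner = smooth_fun_on_linear[OF _ bounded_linear_inner_left]

lemma smooth_fun_on_sum:
  "open U \<Longrightarrow> (\<And>i. i \<in> I \<Longrightarrow> smooth_fun_on U (f i)) \<Longrightarrow> smooth_fun_on U (\<lambda>p. \<Sum>i\<in>I. f i p)"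
  by (simp add: smooth_fun_on_def o_def smooth_on_sum open_chart_image)

lemma smooth_fun_on_compose:
  fixes f :: "'m \<Rightarrow> 'b::euclidean_space"
  assumes "open U" "smooth_fun_on U f" "smooth_on UNIV g"
  shows "smooth_fun_on U (\<lambda>p. g (f p))"
  unfolding smooth_fun_on_def o_def
proof
  fix c assume c: "c \<in> A"
  show "smooth_on (snd c ` (fst c \<inter> U)) (\<lambda>x. g (f (chart_inv c x)))"
    by (rule smooth_on_compose[OF open_chart_image[OF c assms(1)] open_UNIV _ _ assms(3)])
      (use assms(2) c in \<open>auto simp: smooth_fun_on_def o_def\<close>)
qed

lemma smooth_fun_on_coord: 
  assumes c: "c \<in> A"
  shows "smooth_fun_on (fst c) (snd c)"
proof (rule smooth_fun_on_chartI[OF c chart_open[OF c] order_refl])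
  have o: "open (snd c ` fst c)" using chart_image_open[OF c] unfolding chart_image_def .
  show "smooth_on (snd c ` fst c) (snd c \<circ> chart_inv c)"
    by (rule smooth_on_cong[OF o smooth_on_bounded_linear[OF o bounded_linear_ident]])
      (use c in \<open>auto simp: chart_inv_left\<close>)
qed

lemma smooth_functionsI:
  "(\<And>p. \<exists>W. open W \<and> p \<in> W \<and> smooth_fun_on W f) \<Longrightarrow> f \<in> C"
  unfolding smooth_functions_iff by (rule smooth_fun_on_local) blast

lemma C_const: "(\<lambda>p. k) \<in> C"
  by (simp add: smooth_functions_iff smooth_fun_on_const)

lemma C_zero: "0 \<in> C"
  using C_const[of 0] by (simp add: zero_fun_def)

lemma C_one: "1 \<in> C"
  using C_const[of 1] by (simp add: one_fun_def)

lemma C_add: "f \<in> C \<Longrightarrow> g \<in> C \<Longrightarrow> f + g \<in> C"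
  using smooth_fun_on_add[of UNIV f g] by (simp add: smooth_functions_iff plus_fun_def)

lemma C_mult: "f \<in> C \<Longrightarrow> g \<in> C \<Longrightarrow> f * g \<in> C"
  using smooth_fun_on_mult[of UNIV f g] by (simp add: smooth_functions_iff times_fun_def)

lemma C_scaleR: "f \<in> C \<Longrightarrow> a *\<^sub>R f \<in> C"
  using C_mult[OF C_const[of a], of f] by (simp add: scaleR_fun_def times_fun_def)

lemma C_uminus: "f \<in> C \<Longrightarrow> - f \<in> C"
  using C_scaleR[of f "- 1"] by simp

lemma C_diff: "f \<in> C \<Longrightarrow> g \<in> C \<Longrightarrow> f - g \<in> C"
  using C_add[OF _ C_uminus, of f g] by simp

section \<open>Tangent vectors\<close>

abbreviation transition_deriv :: "('m, 'e) chart \<Rightarrow> ('m, 'e) chart \<Rightarrow> 'm \<Rightarrow> 'e \<Rightarrow> 'e" where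
  "transition_deriv c d p \<equiv> frechet_derivative (snd d \<circ> chart_inv c) (at (snd c p))"

lemma transition_has_derivative:
  assumes "c \<in> A" "d \<in> A" "p \<in> fst c" "p \<in> fst d"
  shows "((snd d \<circ> chart_inv c) has_derivative transition_deriv c d p) (at (snd c p))"
  by (rule smooth_on_has_derivative[OF transition_smooth[OF assms(1,2)]]) (use assms in auto)

text \<open>The chain rule for transition maps; applied to coordinate maps it gives the cocycle property of
  their derivatives, applied to functions the independence of the chart of directional derivatives.\<close>

lemma has_derivative_change_chart:
  assumes c: "c \<in> A" "p \<in> fst c" and d: "d \<in> A" "p \<in> fst d"
    and f: "((f \<circ> chart_inv d) has_derivative F) (at (snd d p))"
  shows "((f \<circ> chart_inv c) has_derivative F \<circ> transition_deriv c d p) (at (snd c p))"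
proof -
  have "snd d p = (snd d \<circ> chart_inv c) (snd c p)"
    using c by (simp add: chart_inv_left)
  with f have "((f \<circ> chart_inv d \<circ> (snd d \<circ> chart_inv c)) has_derivative F \<circ> transition_deriv c d p) (at (snd c p))"
    by (intro diff_chain_at transition_has_derivative c d) simp
  then show ?thesis
    by (rule has_derivative_transform_within_open[OF _ open_chart_image[OF c(1) chart_open[OF d(1)]]])
      (use c d in \<open>auto simp: chart_inv_left\<close>)
qed

lemma transition_deriv_compose:
  assumes "c \<in> A" "p \<in> fst c" "d \<in> A" "p \<in> fst d" "b \<in> A" "p \<in> fst b"
  shows "transition_deriv d b p (transition_deriv c d p v) = transition_deriv c b p v"
proof -
  have "((snd b \<circ> chart_inv c) has_derivative transition_deriv d b p \<circ> transition_deriv c d p) (at (snd c p))"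
    by (intro has_derivative_change_chart transition_has_derivative assms)
  from frechet_derivative_at[OF this] show ?thesis by (metis comp_apply)
qed

lemma transition_deriv_self:
  assumes "c \<in> A" "p \<in> fst c"
  shows "transition_deriv c c p v = v"
proof -
  have "((\<lambda>x. x) has_derivative (\<lambda>v. v)) (at (snd c p))" by (rule has_derivative_ident)
  then have "((snd c \<circ> chart_inv c) has_derivative (\<lambda>v. v)) (at (snd c p))"
    by (rule has_derivative_transform_within_open[OF _ open_chart_image[OF assms(1) open_UNIV]])
      (use assms in \<open>auto simp: chart_inv_left\<close>)
  from frechet_derivative_at[OF this] show ?thesis by metis
qed

lemma linear_transition_deriv:
  "c \<in> A \<Longrightarrow> p \<in> fst c \<Longrightarrow> d \<in> A \<Longrightarrow> p \<in> fst d \<Longrightarrow> linear (transition_deriv c d p)"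
  using has_derivative_linear[OF transition_has_derivative] .

lemma smooth_transition_deriv:
  assumes c: "c \<in> A" and d: "d \<in> A"
  shows "smooth_fun_on (fst c \<inter> fst d) (\<lambda>p. transition_deriv c d p v)"
proof (rule smooth_fun_on_chartI[OF c])
  show "smooth_on (snd c ` (fst c \<inter> fst d)) ((\<lambda>p. transition_deriv c d p v) \<circ> chart_inv c)"
    by (rule smooth_on_cong[OF open_chart_image[OF c chart_open[OF d]]
          smooth_on_frechet_derivative_const[OF transition_smooth[OF c d], of v]])
      (use c in \<open>auto simp: chart_inv_left\<close>)
qed (use c d in \<open>auto intro: open_Int chart_open\<close>)

lemma tangent_spaceD:
  "v \<in> T p \<Longrightarrow> c \<in> A \<Longrightarrow> p \<in> fst c \<Longrightarrow> d \<in> A \<Longrightarrow> p \<in> fst d \<Longrightarrow> v d = transition_deriv c d p (v c)"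
  unfolding tangent_space_def by blast

lemma tangent_space_outside: "v \<in> T p \<Longrightarrow> \<not> (c \<in> A \<and> p \<in> fst c) \<Longrightarrow> v c = 0"
  unfolding tangent_space_def by blast

lemma tangent_spaceI:
  assumes "\<And>c d. c \<in> A \<Longrightarrow> p \<in> fst c \<Longrightarrow> d \<in> A \<Longrightarrow> p \<in> fst d \<Longrightarrow> v d = transition_deriv c d p (v c)"
    and "\<And>c. \<not> (c \<in> A \<and> p \<in> fst c) \<Longrightarrow> v c = 0"
  shows "v \<in> T p"
  using assms unfolding tangent_space_def by blast

lemma tangent_space_eqI:
  assumes "v \<in> T p" "w \<in> T p" "c \<in> A" "p \<in> fst c" "v c = w c"
  shows "v = w"
proof
  fix d show "v d = w d"
  proof (cases "d \<in> A \<and> p \<in> fst d")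
    case True
    then show ?thesis
      using tangent_spaceD[OF assms(1,3,4), of d] tangent_spaceD[OF assms(2,3,4), of d] assms(5) by metis
  next
    case False
    then show ?thesis using tangent_space_outside assms(1,2) by metis
  qed
qed

lemma T_zero: "0 \<in> T p"
  by (rule tangent_spaceI) (simp_all add: linear_0[OF linear_transition_deriv])

lemma T_add:
  assumes "v \<in> T p" "w \<in> T p"
  shows "v + w \<in> T p"
proof (rule tangent_spaceI)
  fix c d assume "c \<in> A" "p \<in> fst c" "d \<in> A" "p \<in> fst d"
  then show "(v + w) d = transition_deriv c d p ((v + w) c)"
    using tangent_spaceD[OF assms(1), of c d] tangent_spaceD[OF assms(2), of c d]
    by (simp only: plus_fun_apply linear_add[OF linear_transition_deriv])
qed (use assms in \<open>simp add: tangent_space_outside\<close>)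

lemma T_scaleR:
  assumes "v \<in> T p"
  shows "a *\<^sub>R v \<in> T p"
proof (rule tangent_spaceI)
  fix c d assume "c \<in> A" "p \<in> fst c" "d \<in> A" "p \<in> fst d"
  then show "(a *\<^sub>R v) d = transition_deriv c d p ((a *\<^sub>R v) c)"
    using tangent_spaceD[OF assms, of c d]
    by (simp only: scaleR_fun_apply linear_scale[OF linear_transition_deriv])
qed (use assms in \<open>simp add: tangent_space_outside\<close>)

lemma T_sum: "(\<And>i. i \<in> I \<Longrightarrow> v i \<in> T p) \<Longrightarrow> (\<Sum>i\<in>I. v i) \<in> T p"
  by (induction I rule: infinite_finite_induct) (auto intro: T_add T_zero)

lemma coord_vec_in_T:
  assumes "c \<in> A" "p \<in> fst c"
  shows "coord_vec A c p x \<in> T p"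
  by (rule tangent_spaceI) (use assms in \<open>auto simp: coord_vec_def transition_deriv_compose\<close>)

lemma coord_vec_self: "c \<in> A \<Longrightarrow> p \<in> fst c \<Longrightarrow> coord_vec A c p x c = x"
  by (simp add: coord_vec_def transition_deriv_self)

lemma coord_vec_eq: "v \<in> T p \<Longrightarrow> c \<in> A \<Longrightarrow> p \<in> fst c \<Longrightarrow> coord_vec A c p (v c) = v"
  by (rule tangent_space_eqI[of _ p _ c]) (auto simp: coord_vec_in_T coord_vec_self)

lemma coord_vec_expand:
  assumes "v \<in> T p" "c \<in> A" "p \<in> fst c"
  shows "v = (\<Sum>b\<in>Basis. (v c \<bullet> b) *\<^sub>R coord_vec A c p b)"
proof (rule tangent_space_eqI[OF assms(1) _ assms(2,3)])
  show "v c = (\<Sum>b\<in>Basis. (v c \<bullet> b) *\<^sub>R coord_vec A c p b) c"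
    by (simp add: sum_fun_apply coord_vec_self[OF assms(2,3)] euclidean_representation)
qed (intro T_sum T_scaleR coord_vec_in_T assms)


section \<open>Vector fields\<close>

definition module_scale :: "('m \<Rightarrow> real) \<Rightarrow> ('m \<Rightarrow> 'w::real_vector) \<Rightarrow> 'm \<Rightarrow> 'w"  (infixr "\<cdot>" 75) where
  "f \<cdot> X = (\<lambda>p. f p *\<^sub>R X p)"

lemma module_scale_apply [simp]: "(f \<cdot> X) p = f p *\<^sub>R X p"
  by (simp add: module_scale_def)

lemma vector_fields_tangent: "X \<in> V \<Longrightarrow> X p \<in> T p"
  by (simp add: vector_fields_def)

lemma vector_fields_smooth:
  assumes "X \<in> V" "c \<in> A"
  shows "smooth_fun_on (fst c) (\<lambda>p. X p c)"
  by (rule smooth_fun_on_chartI[OF assms(2)])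
    (use assms chart_open in \<open>auto simp: vector_fields_def o_def chart_image_def\<close>)

text \<open>The components in another chart are obtained by applying the derivative of the transition map,
  whose entries are smooth.\<close>

lemma vector_fieldsI:
  assumes tangent: "\<And>p. X p \<in> T p"
    and smooth: "\<And>p. \<exists>c\<in>A. \<exists>W. open W \<and> p \<in> W \<and> W \<subseteq> fst c \<and> smooth_fun_on W (\<lambda>q. X q c)"
  shows "X \<in> V"
proof -
  have "smooth_on (chart_image d) (\<lambda>x. X (chart_inv d x) d)" if d: "d \<in> A" for d
  proof -
    have "smooth_fun_on (fst d) (\<lambda>q. X q d)"
    proof (rule smooth_fun_on_local)
      fix p assume p: "p \<in> fst d"
      obtain c W where c: "c \<in> A" "open W" "p \<in> W" "W \<subseteq> fst c" "smooth_fun_on W (\<lambda>q. X q c)"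
        using smooth by blast
      let ?W = "W \<inter> fst d"
      have W: "open ?W" using c(2) chart_open[OF d] by (rule open_Int)
      have "smooth_fun_on ?W (\<lambda>q. \<Sum>b\<in>Basis. (X q c \<bullet> b) *\<^sub>R transition_deriv c d q b)"
      proof (intro smooth_fun_on_sum smooth_fun_on_scaleR smooth_fun_on_inner W)
        show "smooth_fun_on ?W (\<lambda>q. X q c)" by (rule smooth_fun_on_subset[OF c(5)]) auto
        show "smooth_fun_on ?W (\<lambda>q. transition_deriv c d q b)" for b
          by (rule smooth_fun_on_subset[OF smooth_transition_deriv[OF c(1) d]]) (use c in auto)
      qed
      then have "smooth_fun_on ?W (\<lambda>q. X q d)"
      proof (rule smooth_fun_on_cong[OF W])
        fix q assume q: "q \<in> ?W"
        then have "transition_deriv c d q (X q c)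
            = (\<Sum>b\<in>Basis. (X q c \<bullet> b) *\<^sub>R transition_deriv c d q b)"
          using c d by (intro linear_eq_sum_Basis linear_transition_deriv) auto
        then show "(\<Sum>b\<in>Basis. (X q c \<bullet> b) *\<^sub>R transition_deriv c d q b) = X q d"
          using tangent_spaceD[OF tangent, of c q d] q c d by auto
      qed
      then show "\<exists>W. open W \<and> p \<in> W \<and> smooth_fun_on W (\<lambda>q. X q d)"
        using W c p by blast
    qed
    from smooth_fun_on_chartD[OF this d order_refl] show ?thesis
      by (simp add: chart_image_def o_def)
  qed
  then show ?thesis using tangent by (simp add: vector_fields_def)
qed

lemma vector_fieldsI':
  assumes "\<And>p. X p \<in> T p" "\<And>c. c \<in> A \<Longrightarrow> smooth_fun_on (fst c) (\<lambda>q. X q c)"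
  shows "X \<in> V"
proof (rule vector_fieldsI[OF assms(1)])
  fix p
  obtain c where "c \<in> A" "p \<in> fst c" by (rule ex_chart)
  then show "\<exists>c\<in>A. \<exists>W. open W \<and> p \<in> W \<and> W \<subseteq> fst c \<and> smooth_fun_on W (\<lambda>q. X q c)"
    using assms(2) chart_open by blast
qed

lemma V_zero: "0 \<in> V"
  by (rule vector_fieldsI') (auto intro: T_zero smooth_fun_on_const chart_open)

lemma V_add: "X \<in> V \<Longrightarrow> Y \<in> V \<Longrightarrow> X + Y \<in> V"
  by (rule vector_fieldsI')
    (auto intro: T_add vector_fields_tangent smooth_fun_on_add chart_open vector_fields_smooth)

lemma V_scale:
  assumes "f \<in> C" "X \<in> V"
  shows "f \<cdot> X \<in> V"
proof (rule vector_fieldsI')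
  fix c assume c: "c \<in> A"
  have "smooth_fun_on (fst c) f"
    using assms(1) smooth_fun_on_subset unfolding smooth_functions_iff by blast
  then show "smooth_fun_on (fst c) (\<lambda>q. (f \<cdot> X) q c)"
    using smooth_fun_on_scaleR[OF chart_open[OF c] _ vector_fields_smooth[OF assms(2) c]] by simp
qed (use assms in \<open>simp add: T_scaleR vector_fields_tangent\<close>)

lemma V_scaleR: "X \<in> V \<Longrightarrow> a *\<^sub>R X \<in> V"
  using V_scale[OF C_const[of a], of X] by (simp add: module_scale_def scaleR_fun_def)

lemma V_uminus: "X \<in> V \<Longrightarrow> - X \<in> V"
  using V_scaleR[of X "-1"] by simp

lemma V_diff: "X \<in> V \<Longrightarrow> Y \<in> V \<Longrightarrow> X - Y \<in> V"
  using V_add[OF _ V_uminus, of X Y] by simp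

lemma V_sum: "(\<And>i. i \<in> I \<Longrightarrow> X i \<in> V) \<Longrightarrow> (\<Sum>i\<in>I. X i) \<in> V"
  by (induction I rule: infinite_finite_induct) (auto intro: V_add V_zero)

lemma smooth_has_derivative:
  assumes "open U" "smooth_fun_on U f" "p \<in> U" "c \<in> A" "p \<in> fst c"
  shows "((f \<circ> chart_inv c) has_derivative frechet_derivative (f \<circ> chart_inv c) (at (snd c p))) (at (snd c p))"
  by (rule smooth_on_has_derivative[of "snd c ` (fst c \<inter> U)"]) (use assms in \<open>auto simp: smooth_fun_on_def\<close>)

lemma vf_apply_chart:
  assumes X: "X p \<in> T p" and f: "open U" "smooth_fun_on U f" "p \<in> U" and c: "c \<in> A" "p \<in> fst c"
  shows "vf_apply A X f p = frechet_derivative (f \<circ> chart_inv c) (at (snd c p)) (X p c)"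
proof -
  define d where "d = (SOME c. c \<in> A \<and> p \<in> fst c)"
  have d: "d \<in> A" "p \<in> fst d"
    using someI[of "\<lambda>c. c \<in> A \<and> p \<in> fst c" c] c by (auto simp: d_def)
  have "((f \<circ> chart_inv c) has_derivative frechet_derivative (f \<circ> chart_inv d) (at (snd d p)) \<circ> transition_deriv c d p)
      (at (snd c p))"
    by (intro has_derivative_change_chart smooth_has_derivative[OF f] c d)
  from frechet_derivative_at[OF this]
  have "frechet_derivative (f \<circ> chart_inv c) (at (snd c p)) (X p c)
      = frechet_derivative (f \<circ> chart_inv d) (at (snd d p)) (transition_deriv c d p (X p c))"
    by (metis comp_apply)
  then show ?thesis
    using tangent_spaceD[OF X c d] by (simp add: vf_apply_def Let_def d_def)
qed

lemma vf_apply_tangent: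
  assumes X: "X p \<in> T p" and c: "c \<in> A" "p \<in> fst c" and f: "f \<in> C"
    and F: "((f \<circ> chart_inv c) has_derivative F) (at (snd c p))"
  shows "vf_apply A X f p = F (X p c)"
  using vf_apply_chart[where X = X and p = p and f = f and U = UNIV and c = c] X c f
    frechet_derivative_at[OF F]
  by (simp add: smooth_functions_iff)

lemma vf_apply_has_derivative:
  assumes X: "X \<in> V" and c: "c \<in> A" "p \<in> fst c" and f: "f \<in> C"
    and F: "((f \<circ> chart_inv c) has_derivative F) (at (snd c p))"
  shows "vf_apply A X f p = F (X p c)"
  using vf_apply_tangent[where X = X and p = p, OF vector_fields_tangent[OF X] c f F] .

lemma C_has_derivative:
  assumes "f \<in> C" "c \<in> A" "p \<in> fst c"
  shows "((f \<circ> chart_inv c) has_derivative frechet_derivative (f \<circ> chart_inv c) (at (snd c p))) (at (snd c p))"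
  using smooth_has_derivative[of UNIV f p c] assms by (simp add: smooth_functions_iff)

lemma vf_apply_C:
  assumes X: "X \<in> V" and f: "f \<in> C"
  shows "vf_apply A X f \<in> C"
proof (rule smooth_functionsI)
  fix p
  obtain c where c: "c \<in> A" "p \<in> fst c" by (rule ex_chart)
  have "smooth_fun_on (fst c) (vf_apply A X f)"
  proof (rule smooth_fun_on_chartI[OF c(1) chart_open[OF c(1)] order_refl])
    have o: "open (snd c ` fst c)" using open_chart_image[OF c(1) open_UNIV] by simp
    have "smooth_on (snd c ` fst c) (f \<circ> chart_inv c)"
      using f c by (simp add: smooth_functions_def chart_image_def)
    moreover have "smooth_on (snd c ` fst c) (\<lambda>x. X (chart_inv c x) c)"
      using X c by (simp add: vector_fields_def chart_image_def)
    ultimately have "smooth_on (snd c ` fst c)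
        (\<lambda>x. frechet_derivative (f \<circ> chart_inv c) (at x) (X (chart_inv c x) c))"
      by (rule smooth_on_frechet_derivative[OF o])
    then show "smooth_on (snd c ` fst c) (vf_apply A X f \<circ> chart_inv c)"
    proof (rule smooth_on_cong[OF o])
      fix x assume "x \<in> snd c ` fst c"
      then obtain q where q: "q \<in> fst c" "x = snd c q" by auto
      then show "frechet_derivative (f \<circ> chart_inv c) (at x) (X (chart_inv c x) c) = (vf_apply A X f \<circ> chart_inv c) x"
        using c vf_apply_has_derivative[OF X c(1) q(1) f C_has_derivative[OF f c(1) q(1)]]
        by (simp add: chart_inv_left)
    qed
  qed
  then show "\<exists>W. open W \<and> p \<in> W \<and> smooth_fun_on W (vf_apply A X f)"
    using c chart_open by blast
qed

lemma vf_apply_add: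
  assumes X: "X \<in> V" and f: "f \<in> C" and g: "g \<in> C"
  shows "vf_apply A X (f + g) = vf_apply A X f + vf_apply A X g"
proof
  fix p
  obtain c where c: "c \<in> A" "p \<in> fst c" by (rule ex_chart)
  note fd = C_has_derivative[OF f c] and gd = C_has_derivative[OF g c]
  have *: "((f + g) \<circ> chart_inv c) = (\<lambda>x. (f \<circ> chart_inv c) x + (g \<circ> chart_inv c) x)"
    by (simp add: fun_eq_iff)
  show "vf_apply A X (f + g) p = (vf_apply A X f + vf_apply A X g) p"
    using vf_apply_has_derivative[OF X c C_add[OF f g]] has_derivative_add[OF fd gd]
      vf_apply_has_derivative[OF X c f fd] vf_apply_has_derivative[OF X c g gd]
    unfolding * by simp
qed

lemma vf_apply_mult:
  assumes X: "X \<in> V" and f: "f \<in> C" and g: "g \<in> C"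
  shows "vf_apply A X (f * g) = vf_apply A X f * g + f * vf_apply A X g"
proof
  fix p
  obtain c where c: "c \<in> A" "p \<in> fst c" by (rule ex_chart)
  note fd = C_has_derivative[OF f c] and gd = C_has_derivative[OF g c]
  have *: "((f * g) \<circ> chart_inv c) = (\<lambda>x. (f \<circ> chart_inv c) x * (g \<circ> chart_inv c) x)"
    by (simp add: fun_eq_iff)
  show "vf_apply A X (f * g) p = (vf_apply A X f * g + f * vf_apply A X g) p"
    using vf_apply_has_derivative[OF X c C_mult[OF f g]] has_derivative_mult[OF fd gd]
      vf_apply_has_derivative[OF X c f fd] vf_apply_has_derivative[OF X c g gd] c
    unfolding * by (simp add: chart_inv_left algebra_simps)
qed

lemma vf_apply_const:
  assumes X: "X \<in> V"
  shows "vf_apply A X (\<lambda>p. k) = 0"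
proof
  fix p
  obtain c where c: "c \<in> A" "p \<in> fst c" by (rule ex_chart)
  show "vf_apply A X (\<lambda>p. k) p = 0 p"
    using vf_apply_has_derivative[OF X c C_const, of k "\<lambda>x. 0"]
    by (simp add: o_def)
qed

lemma vf_apply_zero: "X \<in> V \<Longrightarrow> vf_apply A X 0 = 0"
  using vf_apply_const[of X 0] by (simp add: zero_fun_def)

lemma vf_apply_field_add:
  assumes X: "X \<in> V" and Y: "Y \<in> V" and f: "f \<in> C"
  shows "vf_apply A (X + Y) f = vf_apply A X f + vf_apply A Y f"
proof
  fix p
  obtain c where c: "c \<in> A" "p \<in> fst c" by (rule ex_chart)
  note fd = C_has_derivative[OF f c]
  show "vf_apply A (X + Y) f p = (vf_apply A X f + vf_apply A Y f) p"
    using vf_apply_has_derivative[OF X c f fd]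
      vf_apply_has_derivative[OF Y c f fd]
      vf_apply_has_derivative[OF V_add[OF X Y] c f fd]
      linear_add[OF has_derivative_linear[OF fd]]
    by simp
qed

lemma vf_apply_field_scale:
  assumes X: "X \<in> V" and g: "g \<in> C" and f: "f \<in> C"
  shows "vf_apply A (g \<cdot> X) f = g * vf_apply A X f"
proof
  fix p
  obtain c where c: "c \<in> A" "p \<in> fst c" by (rule ex_chart)
  note fd = C_has_derivative[OF f c]
  show "vf_apply A (g \<cdot> X) f p = (g * vf_apply A X f) p"
    using vf_apply_has_derivative[OF X c f fd]
      vf_apply_has_derivative[OF V_scale[OF g X] c f fd]
      linear_scale[OF has_derivative_linear[OF fd]]
    by simp
qed


section \<open>Cut-off functions and frames\<close>

text \<open>Local coordinate expressions multiplied with such a function extend by 0 to the whole manifold,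
  and they keep their derivatives at p. Closedness of the set K in the manifold, not just in the
  chart, makes the extension smooth.\<close>

definition bump_at :: "('m, 'e) chart \<Rightarrow> ('m \<Rightarrow> real) \<Rightarrow> 'm \<Rightarrow> bool" where
  "bump_at c \<eta> p \<longleftrightarrow> c \<in> A \<and> \<eta> \<in> C \<and>
     (\<exists>W. open W \<and> p \<in> W \<and> W \<subseteq> fst c \<and> (\<forall>q\<in>W. \<eta> q = 1)) \<and>
     (\<exists>K. closed K \<and> K \<subseteq> fst c \<and> (\<forall>q. q \<notin> K \<longrightarrow> \<eta> q = 0))"

lemma bump_atD: "bump_at c \<eta> p \<Longrightarrow> c \<in> A" "bump_at c \<eta> p \<Longrightarrow> p \<in> fst c"
  "bump_at c \<eta> p \<Longrightarrow> \<eta> p = 1" "bump_at c \<eta> p \<Longrightarrow> \<eta> \<in> C" "bump_at c \<eta> p \<Longrightarrow> q \<notin> fst c \<Longrightarrow> \<eta> q = 0"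
  unfolding bump_at_def by blast+

text \<open>The support of the bump function in the chart is compact; since the manifold is Hausdorff,
  it is closed in the manifold.\<close>

lemma ex_bump_at_chart:
  assumes c: "c \<in> A" "p \<in> fst c"
  obtains \<eta> where "bump_at c \<eta> p"
proof -
  have "snd c p \<in> chart_image c" using c by (simp add: chart_image_def)
  then obtain R where R: "R > 0" "cball (snd c p) R \<subseteq> chart_image c"
    using chart_image_open[OF c(1)] open_contains_cball by blast
  obtain g :: "'e \<Rightarrow> real" where g: "smooth_on UNIV g" "\<And>y. y \<in> ball (snd c p) (R / 2) \<Longrightarrow> g y = 1"
      "\<And>y. y \<notin> cball (snd c p) R \<Longrightarrow> g y = 0"
    using bump_function_euclidean[of "R / 2" "snd c p"] R(1) by auto
  define \<eta> where "\<eta> q = (if q \<in> fst c then g (snd c q) else 0)" for q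
  define K where "K = chart_inv c ` cball (snd c p) R"
  define W where "W = fst c \<inter> snd c -` ball (snd c p) (R / 2)"
  have "continuous_on (cball (snd c p) R) (chart_inv c)"
    using homeomorphism_cont2[OF chart_homeomorphism[OF c(1)]] R(2) continuous_on_subset by blast
  then have "compact K" unfolding K_def by (intro compact_continuous_image) auto
  then have K: "closed K" by (rule compact_imp_closed)
  have Kc: "K \<subseteq> fst c" using R(2) c by (auto simp: K_def chart_inv_in subset_eq)
  have zero: "\<eta> q = 0" if "q \<notin> K" for q
  proof (cases "q \<in> fst c")
    case True
    then have "snd c q \<notin> cball (snd c p) R"
      using that chart_inv_left[OF c(1) True] unfolding K_def by (metis imageI)
    then show ?thesis by (simp add: \<eta>_def g)
  qed (simp add: \<eta>_def)
  have "\<eta> \<in> C"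
  proof (rule smooth_functionsI)
    fix q
    show "\<exists>W. open W \<and> q \<in> W \<and> smooth_fun_on W \<eta>"
    proof (cases "q \<in> fst c")
      case True
      have "smooth_fun_on (fst c) (\<lambda>q. g (snd c q))"
        by (rule smooth_fun_on_compose[OF chart_open[OF c(1)] smooth_fun_on_coord[OF c(1)] g(1)])
      then have "smooth_fun_on (fst c) \<eta>"
        by (rule smooth_fun_on_cong[OF chart_open[OF c(1)]]) (simp add: \<eta>_def)
      then show ?thesis using True chart_open[OF c(1)] by blast
    next
      case False
      have "smooth_fun_on (- K) \<eta>"
        by (rule smooth_fun_on_cong[OF _ smooth_fun_on_const[of _ 0]]) (use K zero in auto)
      then show ?thesis using False K Kc by blast
    qed
  qed
  moreover have "open W" unfolding W_def by (rule open_chart_preimage[OF c(1) open_ball])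
  moreover have "p \<in> W" "W \<subseteq> fst c" "\<forall>q\<in>W. \<eta> q = 1" using c R(1) g by (auto simp: W_def \<eta>_def)
  ultimately have "bump_at c \<eta> p" unfolding bump_at_def using K Kc zero c(1) by blast
  then show thesis by (rule that)
qed

lemma ex_bump_at:
  obtains c \<eta> where "bump_at c \<eta> p"
  using ex_chart ex_bump_at_chart by metis

lemma bump_at_extension:
  fixes g :: "'m \<Rightarrow> real"
  assumes "bump_at c \<eta> p" "smooth_fun_on (fst c) g"
  shows "(\<lambda>q. if q \<in> fst c then \<eta> q * g q else 0) \<in> C"
proof (rule smooth_functionsI)
  fix q
  have c: "c \<in> A" "\<eta> \<in> C" using assms bump_atD by auto
  obtain K where K: "closed K" "K \<subseteq> fst c" "\<And>q. q \<notin> K \<Longrightarrow> \<eta> q = 0"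
    using assms(1) unfolding bump_at_def by blast
  let ?f = "\<lambda>q. if q \<in> fst c then \<eta> q * g q else 0"
  show "\<exists>W. open W \<and> q \<in> W \<and> smooth_fun_on W ?f"
  proof (cases "q \<in> fst c")
    case True
    have "smooth_fun_on (fst c) \<eta>"
      using smooth_fun_on_subset c(2) unfolding smooth_functions_iff by blast
    then have "smooth_fun_on (fst c) ?f"
      using smooth_fun_on_cong[OF chart_open[OF c(1)] smooth_fun_on_mult[OF chart_open[OF c(1)] _ assms(2)]]
      by simp
    then show ?thesis using True chart_open[OF c(1)] by blast
  next
    case False
    have "smooth_fun_on (- K) ?f"
      by (rule smooth_fun_on_cong[OF _ smooth_fun_on_const[of _ 0]]) (use K in auto)
    then show ?thesis using False K by blast
  qed
qed

definition cut_coord :: "('m, 'e) chart \<Rightarrow> ('m \<Rightarrow> real) \<Rightarrow> 'e \<Rightarrow> 'm \<Rightarrow> real" where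
  "cut_coord c \<eta> b q = (if q \<in> fst c then \<eta> q * (snd c q \<bullet> b) else 0)"

definition cut_component ::
    "('m, 'e) chart \<Rightarrow> ('m \<Rightarrow> real) \<Rightarrow> 'e \<Rightarrow> ('m \<Rightarrow> ('m, 'e) tvec) \<Rightarrow> 'm \<Rightarrow> real" where
  "cut_component c \<eta> b X q = (if q \<in> fst c then \<eta> q * (X q c \<bullet> b) else 0)"

definition cut_field :: "('m, 'e) chart \<Rightarrow> ('m \<Rightarrow> real) \<Rightarrow> 'e \<Rightarrow> 'm \<Rightarrow> ('m, 'e) tvec" where
  "cut_field c \<eta> b q = (if q \<in> fst c then \<eta> q *\<^sub>R coord_vec A c q b else 0)"

lemma cut_coord_C: "bump_at c \<eta> p \<Longrightarrow> cut_coord c \<eta> b \<in> C"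
  unfolding cut_coord_def[abs_def]
  by (intro bump_at_extension smooth_fun_on_inner smooth_fun_on_coord) (auto dest: bump_atD chart_open)

lemma cut_component_C: "bump_at c \<eta> p \<Longrightarrow> X \<in> V \<Longrightarrow> cut_component c \<eta> b X \<in> C"
  unfolding cut_component_def[abs_def]
  by (intro bump_at_extension smooth_fun_on_inner vector_fields_smooth) (auto dest: bump_atD chart_open)

lemma cut_field_tangent: "bump_at c \<eta> p \<Longrightarrow> cut_field c \<eta> b q \<in> T q"
  by (auto simp: cut_field_def intro!: T_scaleR T_zero coord_vec_in_T dest: bump_atD)

lemma cut_field_V:
  assumes "bump_at c \<eta> p"
  shows "cut_field c \<eta> b \<in> V"
proof (rule vector_fieldsI[OF cut_field_tangent[OF assms]])
  fix q
  have c: "c \<in> A" "\<eta> \<in> C" using assms bump_atD by auto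
  obtain K where K: "closed K" "K \<subseteq> fst c" "\<And>q. q \<notin> K \<Longrightarrow> \<eta> q = 0"
    using assms(1) unfolding bump_at_def by blast
  show "\<exists>d\<in>A. \<exists>W. open W \<and> q \<in> W \<and> W \<subseteq> fst d \<and> smooth_fun_on W (\<lambda>q. cut_field c \<eta> b q d)"
  proof (cases "q \<in> fst c")
    case True
    have "smooth_fun_on (fst c) (\<lambda>q. \<eta> q *\<^sub>R b)"
      using smooth_fun_on_scaleR[OF chart_open[OF c(1)] _ smooth_fun_on_const[OF chart_open[OF c(1)]]]
        smooth_fun_on_subset c(2) unfolding smooth_functions_iff by blast
    then have "smooth_fun_on (fst c) (\<lambda>q. cut_field c \<eta> b q c)"
      by (rule smooth_fun_on_cong[OF chart_open[OF c(1)]]) (simp add: cut_field_def coord_vec_self c)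
    then show ?thesis using True c chart_open by blast
  next
    case False
    obtain d where d: "d \<in> A" "q \<in> fst d" by (rule ex_chart)
    have W: "open (- K \<inter> fst d)" by (rule open_Int[OF open_Compl[OF K(1)] chart_open[OF d(1)]])
    have "smooth_fun_on (- K \<inter> fst d) (\<lambda>q. cut_field c \<eta> b q d)"
      by (rule smooth_fun_on_cong[OF W smooth_fun_on_const[OF W, of 0]])
        (use K d in \<open>auto simp: cut_field_def\<close>)
    then show ?thesis using d False K(2) W
      by (intro bexI[of _ d] exI[of _ "- K \<inter> fst d"]) auto
  qed
qed

lemma ex_vector_field:
  assumes "v \<in> T p"
  shows "\<exists>X\<in>V. X p = v"
proof -
  obtain c \<eta> where "bump_at c \<eta> p" by (rule ex_bump_at)
  then have "cut_field c \<eta> (v c) \<in> V" "cut_field c \<eta> (v c) p = v"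
    using bump_atD[of c \<eta> p] assms by (auto simp: cut_field_V cut_field_def coord_vec_eq)
  then show ?thesis by blast
qed

definition extend :: "'m \<Rightarrow> ('m, 'e) tvec \<Rightarrow> 'm \<Rightarrow> ('m, 'e) tvec" where
  "extend p v = (SOME X. X \<in> V \<and> X p = v)"

lemma extend: assumes "v \<in> T p" shows "extend p v \<in> V" "extend p v p = v"
  using someI_ex[of "\<lambda>X. X \<in> V \<and> X p = v"] ex_vector_field[OF assms] unfolding extend_def by auto

text \<open>The square appears because both the components and the frame have to be cut off to be globally
  defined.\<close>

lemma cut_square_expand:
  assumes "bump_at c \<eta> p" "X \<in> V"
  shows "(\<eta> * \<eta>) \<cdot> X = (\<Sum>b\<in>Basis. cut_component c \<eta> b X \<cdot> cut_field c \<eta> b)"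
proof
  fix q
  have s: "(\<Sum>b\<in>Basis. cut_component c \<eta> b X \<cdot> cut_field c \<eta> b) q
      = (\<Sum>b\<in>Basis. cut_component c \<eta> b X q *\<^sub>R cut_field c \<eta> b q)"
    by (simp only: sum_fun_apply module_scale_apply)
  show "((\<eta> * \<eta>) \<cdot> X) q = (\<Sum>b\<in>Basis. cut_component c \<eta> b X \<cdot> cut_field c \<eta> b) q"
  proof (cases "q \<in> fst c")
    case True
    have "(\<eta> q * \<eta> q) *\<^sub>R X q = (\<eta> q * \<eta> q) *\<^sub>R (\<Sum>b\<in>Basis. (X q c \<bullet> b) *\<^sub>R coord_vec A c q b)"
      using coord_vec_expand[OF vector_fields_tangent[OF assms(2)] bump_atD(1)[OF assms(1)] True] by simp
    then show ?thesis
      unfolding s by (simp add: True cut_component_def cut_field_def scaleR_sum_right mult_ac)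
  next
    case False
    then show ?thesis unfolding s by (simp add: cut_component_def bump_atD(5)[OF assms(1)])
  qed
qed

text \<open>Splitting X into its components in a cut-off frame and the remainder, which carries the
  factor \<open>1 - \<eta>\<^sup>2\<close>, exhibits X as a combination of fields with coefficients vanishing at p.\<close>

lemma tensorial_vanishes:
  fixes a :: "('m \<Rightarrow> ('m, 'e) tvec) \<Rightarrow> 'm \<Rightarrow> 'w::real_vector"
  assumes add: "\<And>X Y. X \<in> V \<Longrightarrow> Y \<in> V \<Longrightarrow> a (X + Y) = a X + a Y"
    and scale: "\<And>f X. f \<in> C \<Longrightarrow> X \<in> V \<Longrightarrow> a (f \<cdot> X) = f \<cdot> a X"
    and X: "X \<in> V" "X p = 0"
  shows "a X p = 0"
proof -
  obtain c \<eta> where c: "bump_at c \<eta> p" by (rule ex_bump_at)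
  have zero: "a 0 = 0"
  proof -
    have "0 \<cdot> Z = 0" for Z :: "'m \<Rightarrow> 'x::real_vector"
      by (rule ext) simp
    then show ?thesis using scale[OF C_zero V_zero] by metis
  qed
  have sum: "a (\<Sum>b\<in>I. Y b) p = (\<Sum>b\<in>I. a (Y b) p)" if "\<And>b. b \<in> I \<Longrightarrow> Y b \<in> V" for I :: "'e set" and Y
    using that by (induction I rule: infinite_finite_induct) (auto simp: zero add V_sum)
  have chi2: "\<eta> * \<eta> \<in> C" "1 - \<eta> * \<eta> \<in> C" using bump_atD(4)[OF c] by (auto intro: C_mult C_diff C_one)
  have "X = (\<eta> * \<eta>) \<cdot> X + (1 - \<eta> * \<eta>) \<cdot> X"
    by (auto simp: fun_eq_iff algebra_simps)
  then have "a X = a ((\<eta> * \<eta>) \<cdot> X) + a ((1 - \<eta> * \<eta>) \<cdot> X)"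
    using add[OF V_scale[OF chi2(1) X(1)] V_scale[OF chi2(2) X(1)]] by simp
  also have "a ((1 - \<eta> * \<eta>) \<cdot> X) = (1 - \<eta> * \<eta>) \<cdot> a X" by (rule scale[OF chi2(2) X(1)])
  finally have "a X p = (a ((\<eta> * \<eta>) \<cdot> X) + (1 - \<eta> * \<eta>) \<cdot> a X) p" by (rule fun_cong)
  also have "\<dots> = a ((\<eta> * \<eta>) \<cdot> X) p" by (simp add: bump_atD(3)[OF c])
  also have "\<dots> = (\<Sum>b\<in>Basis. a (cut_component c \<eta> b X \<cdot> cut_field c \<eta> b) p)"
    unfolding cut_square_expand[OF c X(1)]
    by (intro sum V_scale cut_component_C[OF c] cut_field_V[OF c] X(1))
  also have "\<dots> = 0"
    by (intro sum.neutral ballI)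
      (simp add: scale[OF cut_component_C[OF c X(1)] cut_field_V[OF c]], simp add: cut_component_def X(2))
  finally show ?thesis .
qed

lemma tensorial_pointwise:
  fixes a :: "('m \<Rightarrow> ('m, 'e) tvec) \<Rightarrow> 'm \<Rightarrow> 'w::real_vector"
  assumes add: "\<And>X Y. X \<in> V \<Longrightarrow> Y \<in> V \<Longrightarrow> a (X + Y) = a X + a Y"
    and scale: "\<And>f X. f \<in> C \<Longrightarrow> X \<in> V \<Longrightarrow> a (f \<cdot> X) = f \<cdot> a X"
    and X: "X \<in> V" "Y \<in> V" "X p = Y p"
  shows "a X p = a Y p"
proof -
  have "a (X - Y) p = 0"
    by (rule tensorial_vanishes[OF add scale V_diff[OF X(1,2)]]) (use X in auto)
  moreover have "a X = a (X - Y) + a Y"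
    using add[OF V_diff[OF X(1,2)] X(2)] by simp
  ultimately show ?thesis by simp
qed

section \<open>The Lie bracket\<close>


lemma vf_apply_cut_coord:
  assumes \<eta>: "bump_at c \<eta> p" and W: "open W" "W \<subseteq> fst c" "\<And>q. q \<in> W \<Longrightarrow> \<eta> q = 1"
    and q: "q \<in> W" and X: "X q \<in> T q"
  shows "vf_apply A X (cut_coord c \<eta> b) q = X q c \<bullet> b"
proof -
  have c: "c \<in> A" "q \<in> fst c" using bump_atD(1)[OF \<eta>] W q by auto
  have "((\<lambda>x. x \<bullet> b) has_derivative (\<lambda>v. v \<bullet> b)) (at (snd c q))"
    by (rule bounded_linear_imp_has_derivative[OF bounded_linear_inner_left])
  then have "((cut_coord c \<eta> b \<circ> chart_inv c) has_derivative (\<lambda>v. v \<bullet> b)) (at (snd c q))"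
    by (rule has_derivative_transform_within_open[OF _ open_chart_image[OF c(1) W(1)]])
      (use c q W in \<open>auto simp: cut_coord_def chart_inv_left\<close>)
  from vf_apply_tangent[where X = X and p = q, OF X c cut_coord_C[OF \<eta>] this] show ?thesis .
qed

lemma bump_at_nbhd:
  assumes "bump_at c \<eta> p"
  obtains W where "open W" "p \<in> W" "W \<subseteq> fst c" "\<And>q. q \<in> W \<Longrightarrow> \<eta> q = 1"
  using assms unfolding bump_at_def by blast

text \<open>The derivatives of the cut-off coordinate functions are the components of the field.\<close>

lemma vector_field_eqI:
  assumes X: "X \<in> V" and Y: "Y \<in> V" and eq: "\<And>f. f \<in> C \<Longrightarrow> vf_apply A X f = vf_apply A Y f"
  shows "X = Y"
proof
  fix p
  obtain c \<eta> where \<eta>: "bump_at c \<eta> p" by (rule ex_bump_at)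
  obtain W where W: "open W" "p \<in> W" "W \<subseteq> fst c" "\<And>q. q \<in> W \<Longrightarrow> \<eta> q = 1"
    using bump_at_nbhd[OF \<eta>] by blast
  show "X p = Y p"
  proof (rule tangent_space_eqI[OF vector_fields_tangent[OF X] vector_fields_tangent[OF Y] bump_atD(1,2)[OF \<eta>]])
    show "X p c = Y p c"
    proof (rule euclidean_eqI)
      fix b :: 'e
      note ev = vf_apply_cut_coord[OF \<eta> W(1,3,4,2)]
      show "X p c \<bullet> b = Y p c \<bullet> b"
        using ev[where X = X and b = b] ev[where X = Y and b = b]
          eq[OF cut_coord_C[OF \<eta>], of b] vector_fields_tangent[OF X] vector_fields_tangent[OF Y] by simp
    qed
  qed
qed

text \<open>Near p the components of Z are its derivatives of the cut-off coordinate functions.\<close>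

lemma vector_fieldsI_derivative:
  assumes tangent: "\<And>p. Z p \<in> T p" and smooth: "\<And>f. f \<in> C \<Longrightarrow> vf_apply A Z f \<in> C"
  shows "Z \<in> V"
proof (rule vector_fieldsI[OF tangent])
  fix p
  obtain c \<eta> where \<eta>: "bump_at c \<eta> p" by (rule ex_bump_at)
  obtain W where W: "open W" "p \<in> W" "W \<subseteq> fst c" "\<And>q. q \<in> W \<Longrightarrow> \<eta> q = 1"
    using bump_at_nbhd[OF \<eta>] by blast
  have "smooth_fun_on W (vf_apply A Z (cut_coord c \<eta> b))" for b
    using smooth[OF cut_coord_C[OF \<eta>], of b] smooth_fun_on_subset unfolding smooth_functions_iff by blast
  then have "smooth_fun_on W (\<lambda>q. \<Sum>b\<in>Basis. vf_apply A Z (cut_coord c \<eta> b) q *\<^sub>R b)"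
    by (intro smooth_fun_on_sum smooth_fun_on_scaleR smooth_fun_on_const W(1))
  then have "smooth_fun_on W (\<lambda>q. Z q c)"
  proof (rule smooth_fun_on_cong[OF W(1)])
    fix q assume q: "q \<in> W"
    show "(\<Sum>b\<in>Basis. vf_apply A Z (cut_coord c \<eta> b) q *\<^sub>R b) = Z q c"
      using vf_apply_cut_coord[OF \<eta> W(1,3,4) q, where X = Z] tangent
      by (simp add: euclidean_representation)
  qed
  then show "\<exists>c\<in>A. \<exists>W. open W \<and> p \<in> W \<and> W \<subseteq> fst c \<and> smooth_fun_on W (\<lambda>q. Z q c)"
    using bump_atD(1)[OF \<eta>] W by blast
qed

text \<open>In a chart the second-order terms of the two compositions agree, and what remains is the derivative
  of f along the vector with components \<open>DY(X) - DX(Y)\<close>.\<close>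

lemma commutator_at_point:
  assumes X: "X \<in> V" and Y: "Y \<in> V"
  shows "\<exists>z\<in>T p. \<forall>f\<in>C. vf_apply A (\<lambda>_. z) f p
    = (vf_apply A X (vf_apply A Y f) - vf_apply A Y (vf_apply A X f)) p"
proof -
  obtain c where c: "c \<in> A" "p \<in> fst c" by (rule ex_chart)
  define S where "S = chart_image c"
  define loc where "loc X x = X (chart_inv c x) c" for X :: "'m \<Rightarrow> ('m, 'e) tvec" and x
  have S: "open S" "snd c p \<in> S" using chart_image_open[OF c(1)] c by (auto simp: S_def chart_image_def)
  have loc_smooth: "smooth_on S (loc X)" if "X \<in> V" for X
    using that c by (simp add: vector_fields_def S_def loc_def[abs_def])
  have loc_at: "loc X (snd c p) = X p c" for X
    by (simp add: loc_def chart_inv_left[OF c])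
  define z where "z = coord_vec A c p (frechet_derivative (loc Y) (at (snd c p)) (X p c)
      - frechet_derivative (loc X) (at (snd c p)) (Y p c))"
  have z: "z \<in> T p" "z c = frechet_derivative (loc Y) (at (snd c p)) (X p c)
      - frechet_derivative (loc X) (at (snd c p)) (Y p c)"
    unfolding z_def by (rule coord_vec_in_T[OF c], rule coord_vec_self[OF c])
  have "vf_apply A (\<lambda>_. z) f p = vf_apply A X (vf_apply A Y f) p - vf_apply A Y (vf_apply A X f) p"
    if f: "f \<in> C" for f
  proof -
    define F where "F = f \<circ> chart_inv c"
    have F: "smooth_on S F" using f c by (simp add: smooth_functions_def F_def S_def)
    let ?H = "\<lambda>a b. frechet_derivative (\<lambda>y. frechet_derivative F (at y) a) (at (snd c p)) b"
    let ?D = "frechet_derivative F (at (snd c p))"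
    have second: "vf_apply A X (vf_apply A Y f) p
        = ?H (Y p c) (X p c) + ?D (frechet_derivative (loc Y) (at (snd c p)) (X p c))"
      if X: "X \<in> V" and Y: "Y \<in> V" for X Y
    proof (rule vf_apply_has_derivative[OF X c vf_apply_C[OF Y f]])
      show "((vf_apply A Y f \<circ> chart_inv c) has_derivative
          (\<lambda>u. ?H (Y p c) u + ?D (frechet_derivative (loc Y) (at (snd c p)) u))) (at (snd c p))"
      proof (rule has_derivative_transform_within_open[OF
            has_derivative_along_field[OF S(1) F loc_smooth[OF Y] S(2), unfolded loc_at] S])
        fix x assume x: "x \<in> S"
        then have q: "chart_inv c x \<in> fst c" "snd c (chart_inv c x) = x"
          using c by (auto simp: S_def chart_inv_in chart_inv_right)
        show "frechet_derivative F (at x) (loc Y x) = (vf_apply A Y f \<circ> chart_inv c) x"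
          using vf_apply_has_derivative[OF Y c(1) q(1) f C_has_derivative[OF f c(1) q(1)]]
          by (simp add: F_def loc_def q(2))
      qed
    qed
    have "vf_apply A (\<lambda>_. z) f p = ?D (z c)"
      using vf_apply_tangent[where X = "\<lambda>_. z" and p = p, OF z(1) c f C_has_derivative[OF f c]] by (simp add: F_def)
    also have "\<dots> = ?D (frechet_derivative (loc Y) (at (snd c p)) (X p c))
        - ?D (frechet_derivative (loc X) (at (snd c p)) (Y p c))"
      unfolding z(2) by (rule linear_diff[OF has_derivative_linear[OF smooth_on_has_derivative[OF F S(2)]]])
    finally show ?thesis
      using second[OF X Y] second[OF Y X] frechet_derivative_commute[OF S(1) F S(2), of "X p c" "Y p c"] by simp
  qed
  then show ?thesis using z(1) by (intro bexI[of _ z]) auto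
qed

lemma vf_apply_cong_point: "X p = Y p \<Longrightarrow> vf_apply A X f p = vf_apply A Y f p"
  by (simp add: vf_apply_def)

lemma lie_bracket:
  assumes X: "X \<in> V" and Y: "Y \<in> V"
  shows lie_bracket_V: "lie_bracket A X Y \<in> V"
    and vf_apply_lie_bracket: "f \<in> C \<Longrightarrow> vf_apply A (lie_bracket A X Y) f
      = vf_apply A X (vf_apply A Y f) - vf_apply A Y (vf_apply A X f)"
proof -
  let ?P = "\<lambda>Z. Z \<in> V \<and> (\<forall>f\<in>C. vf_apply A Z f
      = vf_apply A X (vf_apply A Y f) - vf_apply A Y (vf_apply A X f))"
  have "\<exists>!Z. ?P Z"
  proof (rule ex_ex1I)
    have "\<forall>p. \<exists>z\<in>T p. \<forall>f\<in>C. vf_apply A (\<lambda>_. z) f p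
        = (vf_apply A X (vf_apply A Y f) - vf_apply A Y (vf_apply A X f)) p"
      using commutator_at_point[OF X Y] by blast
    then obtain Z where Z: "\<And>p. Z p \<in> T p" "\<And>p f. f \<in> C \<Longrightarrow> vf_apply A (\<lambda>_. Z p) f p
        = (vf_apply A X (vf_apply A Y f) - vf_apply A Y (vf_apply A X f)) p" by metis
    have eq: "vf_apply A Z f = vf_apply A X (vf_apply A Y f) - vf_apply A Y (vf_apply A X f)" if "f \<in> C" for f
    proof
      fix p
      have "vf_apply A Z f p = vf_apply A (\<lambda>_. Z p) f p" by (rule vf_apply_cong_point) simp
      then show "vf_apply A Z f p = (vf_apply A X (vf_apply A Y f) - vf_apply A Y (vf_apply A X f)) p"
        using Z(2)[OF that, of p] by simp
    qed
    moreover have "Z \<in> V"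
      by (rule vector_fieldsI_derivative[OF Z(1)]) (simp add: eq C_diff vf_apply_C X Y)
    ultimately show "\<exists>Z. ?P Z" by blast
  qed (auto intro: vector_field_eqI)
  from theI'[OF this] have "?P (lie_bracket A X Y)" unfolding lie_bracket_def .
  then show "lie_bracket A X Y \<in> V" and "f \<in> C \<Longrightarrow> vf_apply A (lie_bracket A X Y) f
      = vf_apply A X (vf_apply A Y f) - vf_apply A Y (vf_apply A X f)" by auto
qed

lemma lie_bracket_antisym:
  assumes "X \<in> V" "Y \<in> V"
  shows "lie_bracket A Y X = - lie_bracket A X Y"
proof (rule vector_field_eqI)
  fix f assume f: "f \<in> C"
  note L = lie_bracket_V[OF assms]
  have "vf_apply A (- lie_bracket A X Y) f = - vf_apply A (lie_bracket A X Y) f"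
    using vf_apply_field_scale[OF L C_const[of "-1"] f] by (simp add: module_scale_def fun_eq_iff fun_Compl_def)
  then show "vf_apply A (lie_bracket A Y X) f = vf_apply A (- lie_bracket A X Y) f"
    using assms f by (simp add: vf_apply_lie_bracket)
qed (use assms in \<open>auto intro: lie_bracket_V V_uminus\<close>)

lemma lie_bracket_add_right:
  assumes "X \<in> V" "Y \<in> V" "Y' \<in> V"
  shows "lie_bracket A X (Y + Y') = lie_bracket A X Y + lie_bracket A X Y'"
proof (rule vector_field_eqI)
  fix f assume f: "f \<in> C"
  show "vf_apply A (lie_bracket A X (Y + Y')) f = vf_apply A (lie_bracket A X Y + lie_bracket A X Y') f"
    using assms f by (simp add: vf_apply_lie_bracket vf_apply_field_add V_add lie_bracket_V vf_apply_add vf_apply_C)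
qed (use assms in \<open>auto intro: lie_bracket_V V_add\<close>)

lemma lie_bracket_scale_right:
  assumes "X \<in> V" "Y \<in> V" "g \<in> C"
  shows "lie_bracket A X (g \<cdot> Y) = vf_apply A X g \<cdot> Y + g \<cdot> lie_bracket A X Y"
proof (rule vector_field_eqI)
  fix f assume f: "f \<in> C"
  show "vf_apply A (lie_bracket A X (g \<cdot> Y)) f
      = vf_apply A (vf_apply A X g \<cdot> Y + g \<cdot> lie_bracket A X Y) f"
    using assms f
    by (simp add: vf_apply_lie_bracket vf_apply_field_add vf_apply_field_scale V_add V_scale
        lie_bracket_V vf_apply_mult vf_apply_C algebra_simps)
qed (use assms in \<open>auto intro: lie_bracket_V V_add V_scale vf_apply_C\<close>)

lemma lie_bracket_scale_left:
  assumes "X \<in> V" "Y \<in> V" "g \<in> C"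
  shows "lie_bracket A (g \<cdot> X) Y = g \<cdot> lie_bracket A X Y - vf_apply A Y g \<cdot> X"
  using lie_bracket_scale_right[OF assms(2,1,3)] lie_bracket_antisym[OF assms(1,2)]
    lie_bracket_antisym[OF assms(2) V_scale[OF assms(3,1)]]
  by (simp add: fun_eq_iff)

lemma lie_bracket_add_left:
  assumes "X \<in> V" "X' \<in> V" "Y \<in> V"
  shows "lie_bracket A (X + X') Y = lie_bracket A X Y + lie_bracket A X' Y"
  using lie_bracket_add_right[OF assms(3,1,2)] lie_bracket_antisym[OF assms(1,3)]
    lie_bracket_antisym[OF assms(2,3)] lie_bracket_antisym[OF assms(3) V_add[OF assms(1,2)]]
  by (simp add: fun_eq_iff)

section \<open>Symmetric forms as functions of vector fields\<close>


definition symmetric_multilinear :: "'m \<Rightarrow> (('m, 'e) tvec list \<Rightarrow> real) \<Rightarrow> bool" where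
  "symmetric_multilinear p t \<longleftrightarrow>
     (\<forall>vs. \<not> set vs \<subseteq> T p \<longrightarrow> t vs = 0) \<and>
     (\<forall>u w vs a b. u \<in> T p \<longrightarrow> w \<in> T p \<longrightarrow> set vs \<subseteq> T p \<longrightarrow>
        t ((a *\<^sub>R u + b *\<^sub>R w) # vs) = a * t (u # vs) + b * t (w # vs)) \<and>
     (\<forall>vs ws. mset vs = mset ws \<longrightarrow> t vs = t ws)"

lemma symmetric_multilinearD:
  assumes "symmetric_multilinear p t"
  shows "\<not> set vs \<subseteq> T p \<Longrightarrow> t vs = 0"
    and "u \<in> T p \<Longrightarrow> w \<in> T p \<Longrightarrow> set vs \<subseteq> T p \<Longrightarrow>
        t ((a *\<^sub>R u + b *\<^sub>R w) # vs) = a * t (u # vs) + b * t (w # vs)"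
    and "mset vs = mset ws \<Longrightarrow> t vs = t ws"
  using assms unfolding symmetric_multilinear_def by blast+

lemma symmetric_multilinear_zero:
  assumes "symmetric_multilinear p t"
  shows "t (0 # vs) = 0"
proof (cases "set vs \<subseteq> T p")
  case True
  then show ?thesis using symmetric_multilinearD(2)[OF assms T_zero T_zero True, of 0 0] by simp
next
  case False
  then show ?thesis using symmetric_multilinearD(1)[OF assms, of "0 # vs"] by auto
qed

lemma symmetric_multilinear_sum:
  assumes t: "symmetric_multilinear p t" and v: "\<And>i. i \<in> I \<Longrightarrow> v i \<in> T p" and vs: "set vs \<subseteq> T p"
  shows "t ((\<Sum>i\<in>I. k i *\<^sub>R v i) # vs) = (\<Sum>i\<in>I. k i * t (v i # vs))"
  using v
proof (induction I rule: infinite_finite_induct)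
  case (insert i I)
  then have "(\<Sum>i\<in>I. k i *\<^sub>R v i) \<in> T p" by (intro T_sum T_scaleR) auto
  then have "t ((k i *\<^sub>R v i + 1 *\<^sub>R (\<Sum>i\<in>I. k i *\<^sub>R v i)) # vs)
      = k i * t (v i # vs) + 1 * t ((\<Sum>i\<in>I. k i *\<^sub>R v i) # vs)"
    using insert.prems by (intro symmetric_multilinearD(2)[OF t _ _ vs]) auto
  moreover have "t ((\<Sum>i\<in>I. k i *\<^sub>R v i) # vs) = (\<Sum>i\<in>I. k i * t (v i # vs))"
    by (rule insert.IH) (use insert.prems in auto)
  ultimately show ?case
    by (simp only: sum.insert[OF insert.hyps(1,2)] scaleR_one mult_1_left)
qed (simp_all add: symmetric_multilinear_zero[OF t])

lemma symmetric_multilinear_coord_expand: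
  assumes t: "symmetric_multilinear p t" and v: "v \<in> T p" and vs: "set vs \<subseteq> T p" and c: "c \<in> A" "p \<in> fst c"
  shows "t (v # vs) = (\<Sum>b\<in>Basis. (v c \<bullet> b) * t (coord_vec A c p b # vs))"
proof -
  have "t ((\<Sum>b\<in>Basis. (v c \<bullet> b) *\<^sub>R coord_vec A c p b) # vs)
      = (\<Sum>b\<in>Basis. (v c \<bullet> b) * t (coord_vec A c p b # vs))"
    by (rule symmetric_multilinear_sum[OF t coord_vec_in_T[OF c] vs])
  then show ?thesis using coord_vec_expand[OF v c] by metis
qed

text \<open>Permutations act transitively on the arrangements of a list, so invariance under them is dependence
  on the multiset of arguments only; linearity in one argument then suffices.\<close>

lemma sym_tensors_iff:
  "t \<in> sym_tensors A r p \<longleftrightarrow> symmetric_multilinear p t \<and> (\<forall>vs. length vs \<noteq> r \<longrightarrow> t vs = 0)"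
proof
  assume t: "t \<in> sym_tensors A r p"
  then have out: "t vs = 0" if "\<not> (length vs = r \<and> set vs \<subseteq> T p)" for vs
    using that unfolding sym_tensors_def by blast
  have lin: "t (vs[i := a *\<^sub>R u + b *\<^sub>R w]) = a * t (vs[i := u]) + b * t (vs[i := w])"
    if "length vs = r" "set vs \<subseteq> T p" "i < r" "u \<in> T p" "w \<in> T p" for vs i u w a b
    using t that unfolding sym_tensors_def by blast
  have perm: "t (permute_list \<pi> vs) = t vs"
    if "length vs = r" "set vs \<subseteq> T p" "\<pi> permutes {..<r}" for vs \<pi>
    using t that unfolding sym_tensors_def by blast
  have "t ((a *\<^sub>R u + b *\<^sub>R w) # vs) = a * t (u # vs) + b * t (w # vs)"
    if "u \<in> T p" "w \<in> T p" "set vs \<subseteq> T p" for u w vs a b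
  proof (cases "length (u # vs) = r")
    case True
    then show ?thesis using lin[of "u # vs" 0 u w a b] that by auto
  next
    case False
    then show ?thesis using out by simp
  qed
  moreover have "t vs = t ws" if eq: "mset vs = mset ws" for vs ws
  proof (cases "length ws = r \<and> set ws \<subseteq> T p")
    case True
    obtain \<pi> where "\<pi> permutes {..<length ws}" "permute_list \<pi> ws = vs"
      by (rule mset_eq_permutation[OF eq])
    then show ?thesis using perm True by blast
  next
    case False
    then show ?thesis using out mset_eq_length[OF eq] mset_eq_setD[OF eq] by metis
  qed
  ultimately show "symmetric_multilinear p t \<and> (\<forall>vs. length vs \<noteq> r \<longrightarrow> t vs = 0)"
    unfolding symmetric_multilinear_def using out by blast
next
  assume "symmetric_multilinear p t \<and> (\<forall>vs. length vs \<noteq> r \<longrightarrow> t vs = 0)"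
  then have t: "symmetric_multilinear p t" and len: "\<And>vs. length vs \<noteq> r \<Longrightarrow> t vs = 0" by auto
  have "t (vs[i := a *\<^sub>R u + b *\<^sub>R w]) = a * t (vs[i := u]) + b * t (vs[i := w])"
    if "length vs = r" "set vs \<subseteq> T p" "i < r" "u \<in> T p" "w \<in> T p" for vs i u w a b
  proof -
    let ?vs = "take i vs @ drop (Suc i) vs"
    have move: "t (vs[i := x]) = t (x # ?vs)" for x
      using that(1,3) by (intro symmetric_multilinearD(3)[OF t]) (simp add: upd_conv_take_nth_drop)
    have "set ?vs \<subseteq> T p"
      using that(2) set_take_subset[of i vs] set_drop_subset[of "Suc i" vs] by auto
    then show ?thesis unfolding move by (rule symmetric_multilinearD(2)[OF t that(4,5)])
  qed
  moreover have "t (permute_list \<pi> vs) = t vs" if "length vs = r" "\<pi> permutes {..<r}" for vs \<pi>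
    using that by (intro symmetric_multilinearD(3)[OF t]) simp
  ultimately show "t \<in> sym_tensors A r p"
    unfolding sym_tensors_def using len symmetric_multilinearD(1)[OF t] by blast
qed

text \<open>The C-infinity point of view on tensor fields: the degree is again the length of the list, so that
  inhomogeneous forms need no special treatment.\<close>

definition on_fields :: "('m, 'e) tensor_field \<Rightarrow> ('m \<Rightarrow> ('m, 'e) tvec) list \<Rightarrow> 'm \<Rightarrow> real" where
  "on_fields \<phi> Xs = (\<lambda>p. \<phi> p (map (\<lambda>X. X p) Xs))"

definition symmetric_field :: "('m, 'e) tensor_field \<Rightarrow> bool" where
  "symmetric_field \<phi> \<longleftrightarrow>
     (\<forall>p. symmetric_multilinear p (\<phi> p)) \<and> (\<forall>Xs. set Xs \<subseteq> V \<longrightarrow> on_fields \<phi> Xs \<in> C)"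

lemma symmetric_fieldD:
  "symmetric_field \<phi> \<Longrightarrow> symmetric_multilinear p (\<phi> p)"
  "symmetric_field \<phi> \<Longrightarrow> set Xs \<subseteq> V \<Longrightarrow> on_fields \<phi> Xs \<in> C"
  unfolding symmetric_field_def by auto

text \<open>Expanding one field after the other in the coordinate frame reduces smoothness on arbitrary
  fields to smoothness on coordinate fields; conversely, near a point the coordinate fields are
  restrictions of global ones.\<close>

lemma smooth_on_fields_and_frame:
  assumes c: "c \<in> A" and t: "\<And>p. symmetric_multilinear p (\<phi> p)"
    and frame: "\<And>bs. set bs \<subseteq> Basis \<Longrightarrow> length bs = r \<Longrightarrow>
      smooth_fun_on (fst c) (\<lambda>p. \<phi> p (map (coord_vec A c p) bs))"
    and "set Xs \<subseteq> V" "set bs \<subseteq> Basis" "length Xs + length bs = r"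
  shows "smooth_fun_on (fst c) (\<lambda>p. \<phi> p (map (\<lambda>X. X p) Xs @ map (coord_vec A c p) bs))"
  using assms(4-6)
proof (induction Xs arbitrary: bs rule: rev_induct)
  case Nil
  then show ?case using frame by simp
next
  case (snoc X Xs)
  have X: "X \<in> V" "set Xs \<subseteq> V" using snoc.prems by auto
  have "smooth_fun_on (fst c) (\<lambda>p. \<Sum>b\<in>Basis. (X p c \<bullet> b) *
      \<phi> p (map (\<lambda>X. X p) Xs @ map (coord_vec A c p) (b # bs)))"
    using snoc.prems
    by (intro smooth_fun_on_sum smooth_fun_on_mult smooth_fun_on_inner vector_fields_smooth snoc.IH
        chart_open c X) auto
  then show ?case
  proof (rule smooth_fun_on_cong[OF chart_open[OF c]])
    fix p assume p: "p \<in> fst c"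
    let ?vs = "map (\<lambda>X. X p) Xs @ map (coord_vec A c p) bs"
    have "\<phi> p (map (\<lambda>X. X p) (Xs @ [X]) @ map (coord_vec A c p) bs) = \<phi> p (X p # ?vs)"
      by (rule symmetric_multilinearD(3)[OF t]) simp
    also have "\<dots> = (\<Sum>b\<in>Basis. (X p c \<bullet> b) * \<phi> p (coord_vec A c p b # ?vs))"
      using X c p by (intro symmetric_multilinear_coord_expand t)
        (auto intro: vector_fields_tangent coord_vec_in_T)
    also have "\<dots> = (\<Sum>b\<in>Basis. (X p c \<bullet> b) * \<phi> p (map (\<lambda>X. X p) Xs @ map (coord_vec A c p) (b # bs)))"
      by (intro sum.cong refl arg_cong2[of _ _ _ _ "(*)"] symmetric_multilinearD(3)[OF t]) simp
    finally show "(\<Sum>b\<in>Basis. (X p c \<bullet> b) * \<phi> p (map (\<lambda>X. X p) Xs @ map (coord_vec A c p) (b # bs)))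
        = \<phi> p (map (\<lambda>X. X p) (Xs @ [X]) @ map (coord_vec A c p) bs)" by simp
  qed
qed

lemma smooth_on_frame_iff:
  assumes "c \<in> A"
  shows "smooth_on (chart_image c) (\<lambda>x. \<phi> (chart_inv c x) (map (coord_vec A c (chart_inv c x)) bs))
    \<longleftrightarrow> smooth_fun_on (fst c) (\<lambda>p. \<phi> p (map (coord_vec A c p) bs))"
  using smooth_fun_on_chartI[OF assms chart_open[OF assms] order_refl, of "\<lambda>p. \<phi> p (map (coord_vec A c p) bs)"]
    smooth_fun_on_chartD[OF _ assms order_refl, of "\<lambda>p. \<phi> p (map (coord_vec A c p) bs)"]
  by (auto simp: o_def chart_image_def)

text \<open>Multilinearity allows smoothness, which for forms is required on coordinate frames, to be tested on
  arbitrary vector fields.\<close>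

lemma sym_forms_iff:
  "\<phi> \<in> sym_forms A r \<longleftrightarrow> symmetric_field \<phi> \<and> (\<forall>p vs. length vs \<noteq> r \<longrightarrow> \<phi> p vs = 0)"
proof
  assume "\<phi> \<in> sym_forms A r"
  then have t: "\<And>p. symmetric_multilinear p (\<phi> p)" and len: "\<And>p vs. length vs \<noteq> r \<Longrightarrow> \<phi> p vs = 0"
    and frame: "\<And>c bs. c \<in> A \<Longrightarrow> set bs \<subseteq> Basis \<Longrightarrow> length bs = r \<Longrightarrow>
      smooth_fun_on (fst c) (\<lambda>p. \<phi> p (map (coord_vec A c p) bs))"
    unfolding sym_forms_def by (auto simp: sym_tensors_iff smooth_on_frame_iff)
  have "on_fields \<phi> Xs \<in> C" if Xs: "set Xs \<subseteq> V" for Xs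
  proof (cases "length Xs = r")
    case True
    show ?thesis
    proof (rule smooth_functionsI)
      fix p
      obtain c where c: "c \<in> A" "p \<in> fst c" by (rule ex_chart)
      have "smooth_fun_on (fst c) (on_fields \<phi> Xs)"
        using smooth_on_fields_and_frame[OF c(1) t frame[OF c(1)] Xs, where bs = "[]"] True
        by (simp add: on_fields_def[abs_def])
      then show "\<exists>W. open W \<and> p \<in> W \<and> smooth_fun_on W (on_fields \<phi> Xs)"
        using c chart_open by blast
    qed
  next
    case False
    then have "on_fields \<phi> Xs = 0" by (simp add: on_fields_def fun_eq_iff len)
    then show ?thesis using C_zero by simp
  qed
  then show "symmetric_field \<phi> \<and> (\<forall>p vs. length vs \<noteq> r \<longrightarrow> \<phi> p vs = 0)"
    using t len by (auto simp: symmetric_field_def)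
next
  assume "symmetric_field \<phi> \<and> (\<forall>p vs. length vs \<noteq> r \<longrightarrow> \<phi> p vs = 0)"
  then have \<phi>: "symmetric_field \<phi>" and len: "\<And>p vs. length vs \<noteq> r \<Longrightarrow> \<phi> p vs = 0" by auto
  have "smooth_fun_on (fst c) (\<lambda>p. \<phi> p (map (coord_vec A c p) bs))" if c: "c \<in> A" for c bs
  proof (rule smooth_fun_on_local)
    fix p assume "p \<in> fst c"
    then obtain \<eta> where \<eta>: "bump_at c \<eta> p" using ex_bump_at_chart c by blast
    obtain W where W: "open W" "p \<in> W" "W \<subseteq> fst c" "\<And>q. q \<in> W \<Longrightarrow> \<eta> q = 1"
      using bump_at_nbhd[OF \<eta>] by blast
    have "on_fields \<phi> (map (cut_field c \<eta>) bs) \<in> C"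
      by (rule symmetric_fieldD(2)[OF \<phi>]) (auto intro: cut_field_V[OF \<eta>])
    then have "smooth_fun_on W (on_fields \<phi> (map (cut_field c \<eta>) bs))"
      using smooth_fun_on_subset unfolding smooth_functions_iff by blast
    then have "smooth_fun_on W (\<lambda>p. \<phi> p (map (coord_vec A c p) bs))"
    proof (rule smooth_fun_on_cong[OF W(1)])
      fix q assume "q \<in> W"
      then have "cut_field c \<eta> b q = coord_vec A c q b" for b
        using W by (auto simp: cut_field_def)
      then show "on_fields \<phi> (map (cut_field c \<eta>) bs) q = \<phi> q (map (coord_vec A c q) bs)"
        by (simp add: on_fields_def o_def)
    qed
    then show "\<exists>W. open W \<and> p \<in> W \<and> smooth_fun_on W (\<lambda>p. \<phi> p (map (coord_vec A c p) bs))"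
      using W by blast
  qed
  then show "\<phi> \<in> sym_forms A r"
    using symmetric_fieldD(1)[OF \<phi>] len
    unfolding sym_forms_def by (auto simp: sym_tensors_iff smooth_on_frame_iff)
qed

lemma symmetric_field_component_iff:
  "symmetric_field \<phi> \<longleftrightarrow> (\<forall>r. symmetric_field (component r \<phi>))"
proof
  assume \<phi>: "symmetric_field \<phi>"
  show "\<forall>r. symmetric_field (component r \<phi>)"
  proof
    fix r
    have "symmetric_multilinear p (component r \<phi> p)" for p
      unfolding symmetric_multilinear_def
    proof (intro conjI allI impI)
      note t = symmetric_multilinearD[OF symmetric_fieldD(1)[OF \<phi>]]
      show "component r \<phi> p vs = 0" if "\<not> set vs \<subseteq> T p" for vs
        using t(1)[OF that] by (simp add: component_def)
      show "component r \<phi> p ((a *\<^sub>R u + b *\<^sub>R w) # vs) = a * component r \<phi> p (u # vs) + b * component r \<phi> p (w # vs)"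
        if "u \<in> T p" "w \<in> T p" "set vs \<subseteq> T p" for u w vs a b
        using t(2)[OF that] by (simp add: component_def)
      show "component r \<phi> p vs = component r \<phi> p ws" if "mset vs = mset ws" for vs ws
        using t(3)[OF that] mset_eq_length[OF that] by (simp add: component_def)
    qed
    moreover have "on_fields (component r \<phi>) Xs \<in> C" if "set Xs \<subseteq> V" for Xs
    proof -
      have "on_fields (component r \<phi>) Xs = (if length Xs = r then on_fields \<phi> Xs else 0)"
        by (simp add: fun_eq_iff on_fields_def component_def)
      then show ?thesis using symmetric_fieldD(2)[OF \<phi> that] C_zero by simp
    qed
    ultimately show "symmetric_field (component r \<phi>)" by (simp add: symmetric_field_def)
  qed
next
  assume \<phi>: "\<forall>r. symmetric_field (component r \<phi>)"
  have "symmetric_multilinear p (\<phi> p)" for p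
    unfolding symmetric_multilinear_def
  proof (intro conjI allI impI)
    have t: "symmetric_multilinear p (component r \<phi> p)" for r
      using symmetric_fieldD(1) \<phi> by blast
    show "\<phi> p vs = 0" if "\<not> set vs \<subseteq> T p" for vs
      using symmetric_multilinearD(1)[OF t[of "length vs"] that] by (simp add: component_def)
    show "\<phi> p ((a *\<^sub>R u + b *\<^sub>R w) # vs) = a * \<phi> p (u # vs) + b * \<phi> p (w # vs)"
      if "u \<in> T p" "w \<in> T p" "set vs \<subseteq> T p" for u w vs a b
      using symmetric_multilinearD(2)[OF t[of "Suc (length vs)"] that] by (simp add: component_def)
    show "\<phi> p vs = \<phi> p ws" if "mset vs = mset ws" for vs ws
      using symmetric_multilinearD(3)[OF t[of "length vs"] that] mset_eq_length[OF that] by (simp add: component_def)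
  qed
  moreover have "on_fields \<phi> Xs \<in> C" if "set Xs \<subseteq> V" for Xs
  proof -
    have "on_fields \<phi> Xs = on_fields (component (length Xs) \<phi>) Xs"
      by (simp add: fun_eq_iff on_fields_def component_def)
    then show ?thesis using symmetric_fieldD(2)[OF \<phi>[rule_format] that] by simp
  qed
  ultimately show "symmetric_field \<phi>" by (simp add: symmetric_field_def)
qed

lemma sym_algebra_iff:
  "\<phi> \<in> sym_algebra A \<longleftrightarrow> symmetric_field \<phi> \<and> (\<exists>n. \<forall>p vs. n < length vs \<longrightarrow> \<phi> p vs = 0)"
proof -
  have "component r \<phi> \<in> sym_forms A r \<longleftrightarrow> symmetric_field (component r \<phi>)" for r
    by (auto simp: sym_forms_iff component_def)
  moreover have "finite {r. component r \<phi> \<noteq> 0} \<longleftrightarrow> (\<exists>n. \<forall>p vs. n < length vs \<longrightarrow> \<phi> p vs = 0)"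
  proof -
    have "(\<forall>r. component r \<phi> \<noteq> 0 \<longrightarrow> r \<le> n) \<longleftrightarrow> (\<forall>p vs. n < length vs \<longrightarrow> \<phi> p vs = 0)" for n
    proof (intro iffI allI impI)
      show "\<phi> p vs = 0" if "\<forall>r. component r \<phi> \<noteq> 0 \<longrightarrow> r \<le> n" "n < length vs" for p vs
      proof -
        have "component (length vs) \<phi> = 0" using that not_less by blast
        from fun_cong[OF fun_cong[OF this]] show ?thesis
          unfolding component_def zero_fun_apply by metis
      qed
      show "r \<le> n" if out: "\<forall>p vs. n < length vs \<longrightarrow> \<phi> p vs = 0" and ne: "component r \<phi> \<noteq> 0" for r
      proof -
        obtain p where "component r \<phi> p \<noteq> 0" using ne by (metis ext zero_fun_apply)
        then obtain vs where "component r \<phi> p vs \<noteq> 0" by (metis ext zero_fun_apply)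
        then show ?thesis using out not_less unfolding component_def by metis
      qed
    qed
    then show ?thesis unfolding finite_nat_set_iff_bounded_le by simp
  qed
  ultimately show ?thesis
    unfolding sym_algebra_def symmetric_field_component_iff[of \<phi>] by simp
qed

lemma sym_forms_sym_algebra: "\<phi> \<in> sym_forms A r \<Longrightarrow> \<phi> \<in> sym_algebra A"
  unfolding sym_forms_iff sym_algebra_iff by (metis nat_neq_iff)

lemma on_fields_add: "on_fields (\<phi> + \<psi>) Xs = on_fields \<phi> Xs + on_fields \<psi> Xs"
  by (simp add: on_fields_def fun_eq_iff)

lemma on_fields_scale: "on_fields (f \<cdot> \<phi>) Xs = f * on_fields \<phi> Xs"
  by (simp add: on_fields_def fun_eq_iff)

lemma symmetric_field_add:
  assumes "symmetric_field \<phi>" "symmetric_field \<psi>"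
  shows "symmetric_field (\<phi> + \<psi>)"
proof -
  have "symmetric_multilinear p ((\<phi> + \<psi>) p)" for p
    unfolding symmetric_multilinear_def
  proof (intro conjI allI impI)
    note t = symmetric_multilinearD[OF symmetric_fieldD(1)[OF assms(1), of p]]
      and s = symmetric_multilinearD[OF symmetric_fieldD(1)[OF assms(2), of p]]
    show "(\<phi> + \<psi>) p vs = 0" if "\<not> set vs \<subseteq> T p" for vs
      using t(1)[OF that] s(1)[OF that] by simp
    show "(\<phi> + \<psi>) p ((a *\<^sub>R u + b *\<^sub>R w) # vs) = a * (\<phi> + \<psi>) p (u # vs) + b * (\<phi> + \<psi>) p (w # vs)"
      if "u \<in> T p" "w \<in> T p" "set vs \<subseteq> T p" for u w vs a b
      using t(2)[OF that] s(2)[OF that] by (simp add: algebra_simps)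
    show "(\<phi> + \<psi>) p vs = (\<phi> + \<psi>) p ws" if "mset vs = mset ws" for vs ws
      using t(3)[OF that] s(3)[OF that] by simp
  qed
  then show ?thesis
    using symmetric_fieldD(2)[OF assms(1)] symmetric_fieldD(2)[OF assms(2)]
    by (auto simp: symmetric_field_def on_fields_add intro: C_add)
qed

lemma symmetric_field_scale:
  assumes "f \<in> C" "symmetric_field \<phi>"
  shows "symmetric_field (f \<cdot> \<phi>)"
proof -
  have "symmetric_multilinear p ((f \<cdot> \<phi>) p)" for p
    unfolding symmetric_multilinear_def
  proof (intro conjI allI impI)
    note t = symmetric_multilinearD[OF symmetric_fieldD(1)[OF assms(2), of p]]
    show "(f \<cdot> \<phi>) p vs = 0" if "\<not> set vs \<subseteq> T p" for vs
      using t(1)[OF that] by simp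
    show "(f \<cdot> \<phi>) p ((a *\<^sub>R u + b *\<^sub>R w) # vs) = a * (f \<cdot> \<phi>) p (u # vs) + b * (f \<cdot> \<phi>) p (w # vs)"
      if "u \<in> T p" "w \<in> T p" "set vs \<subseteq> T p" for u w vs a b
      using t(2)[OF that] by (simp add: algebra_simps)
    show "(f \<cdot> \<phi>) p vs = (f \<cdot> \<phi>) p ws" if "mset vs = mset ws" for vs ws
      using t(3)[OF that] by simp
  qed
  then show ?thesis
    using symmetric_fieldD(2)[OF assms(2)] assms(1)
    by (auto simp: symmetric_field_def on_fields_scale intro: C_mult)
qed

lemma sym_forms_add: "\<phi> \<in> sym_forms A r \<Longrightarrow> \<psi> \<in> sym_forms A r \<Longrightarrow> \<phi> + \<psi> \<in> sym_forms A r"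
  by (simp add: sym_forms_iff symmetric_field_add)

lemma sym_forms_scale: "f \<in> C \<Longrightarrow> \<phi> \<in> sym_forms A r \<Longrightarrow> f \<cdot> \<phi> \<in> sym_forms A r"
  by (simp add: sym_forms_iff symmetric_field_scale)

lemma sym_forms_zero: "0 \<in> sym_forms A r"
proof -
  have "on_fields 0 Xs = 0" for Xs by (simp add: on_fields_def fun_eq_iff)
  then show ?thesis by (simp add: sym_forms_iff symmetric_field_def symmetric_multilinear_def C_zero)
qed

lemma sym_forms_sum: "(\<And>i. i \<in> I \<Longrightarrow> \<phi> i \<in> sym_forms A r) \<Longrightarrow> (\<Sum>i\<in>I. \<phi> i) \<in> sym_forms A r"
  by (induction I rule: infinite_finite_induct) (auto intro: sym_forms_add sym_forms_zero)

lemma fun_form_sym_forms: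
  assumes "f \<in> C"
  shows "fun_form f \<in> sym_forms A 0"
proof -
  have "on_fields (fun_form f) Xs = (if Xs = [] then f else 0)" for Xs
    by (simp add: on_fields_def fun_form_def fun_eq_iff)
  then show ?thesis
    by (auto simp: sym_forms_iff symmetric_field_def symmetric_multilinear_def fun_form_def C_zero assms)
qed


lemma sym_algebra_scaleR_add:
  assumes "\<phi> \<in> sym_algebra A" "\<psi> \<in> sym_algebra A"
  shows "a *\<^sub>R \<phi> + b *\<^sub>R \<psi> \<in> sym_algebra A"
proof -
  obtain m n where "\<And>p vs. m < length vs \<Longrightarrow> \<phi> p vs = 0" "\<And>p vs. n < length vs \<Longrightarrow> \<psi> p vs = 0"
    and f: "symmetric_field \<phi>" "symmetric_field \<psi>" using assms unfolding sym_algebra_iff by blast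
  then have "(a *\<^sub>R \<phi> + b *\<^sub>R \<psi>) p vs = 0" if "m + n < length vs" for p vs using that by simp
  moreover have "a *\<^sub>R \<phi> + b *\<^sub>R \<psi> = (\<lambda>_. a) \<cdot> \<phi> + (\<lambda>_. b) \<cdot> \<psi>" by (simp add: fun_eq_iff)
  then have "symmetric_field (a *\<^sub>R \<phi> + b *\<^sub>R \<psi>)"
    using symmetric_field_add[OF symmetric_field_scale[OF C_const f(1)] symmetric_field_scale[OF C_const f(2)]]
    by metis
  ultimately show ?thesis unfolding sym_algebra_iff by blast
qed

section \<open>Tensorial functions of vector fields\<close>

text \<open>Symmetry makes it sufficient to state linearity over the smooth functions in the first argument.\<close>

definition tensorial :: "(('m \<Rightarrow> ('m, 'e) tvec) list \<Rightarrow> 'm \<Rightarrow> real) \<Rightarrow> bool" where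
  "tensorial \<Phi> \<longleftrightarrow>
     (\<forall>Xs. set Xs \<subseteq> V \<longrightarrow> \<Phi> Xs \<in> C) \<and>
     (\<forall>Xs Ys. mset Xs = mset Ys \<longrightarrow> \<Phi> Xs = \<Phi> Ys) \<and>
     (\<forall>X Y Xs. X \<in> V \<longrightarrow> Y \<in> V \<longrightarrow> set Xs \<subseteq> V \<longrightarrow> \<Phi> ((X + Y) # Xs) = \<Phi> (X # Xs) + \<Phi> (Y # Xs)) \<and>
     (\<forall>f X Xs. f \<in> C \<longrightarrow> X \<in> V \<longrightarrow> set Xs \<subseteq> V \<longrightarrow> \<Phi> ((f \<cdot> X) # Xs) = f * \<Phi> (X # Xs))"

lemma tensorialD:
  assumes "tensorial \<Phi>"
  shows "set Xs \<subseteq> V \<Longrightarrow> \<Phi> Xs \<in> C"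
    and "mset Xs = mset Ys \<Longrightarrow> \<Phi> Xs = \<Phi> Ys"
    and "X \<in> V \<Longrightarrow> Y \<in> V \<Longrightarrow> set Xs \<subseteq> V \<Longrightarrow> \<Phi> ((X + Y) # Xs) = \<Phi> (X # Xs) + \<Phi> (Y # Xs)"
    and "f \<in> C \<Longrightarrow> X \<in> V \<Longrightarrow> set Xs \<subseteq> V \<Longrightarrow> \<Phi> ((f \<cdot> X) # Xs) = f * \<Phi> (X # Xs)"
  using assms unfolding tensorial_def by blast+

lemma tensorial_on_fields:
  assumes "symmetric_field \<phi>"
  shows "tensorial (on_fields \<phi>)"
proof -
  note t = symmetric_multilinearD[OF symmetric_fieldD(1)[OF assms]]
  have tangent: "set (map (\<lambda>X. X p) Xs) \<subseteq> T p" if "set Xs \<subseteq> V" for Xs p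
    using that vector_fields_tangent by auto
  show ?thesis
    unfolding tensorial_def
  proof (intro conjI allI impI)
    show "on_fields \<phi> Xs \<in> C" if "set Xs \<subseteq> V" for Xs
      by (rule symmetric_fieldD(2)[OF assms that])
    show "on_fields \<phi> Xs = on_fields \<phi> Ys" if "mset Xs = mset Ys" for Xs Ys
      unfolding on_fields_def by (rule ext, rule t(3)) (simp add: that)
    show "on_fields \<phi> ((X + Y) # Xs) = on_fields \<phi> (X # Xs) + on_fields \<phi> (Y # Xs)"
      if "X \<in> V" "Y \<in> V" "set Xs \<subseteq> V" for X Y Xs
      using t(2)[OF vector_fields_tangent[OF that(1)] vector_fields_tangent[OF that(2)] tangent[OF that(3)], where a = 1 and b = 1]
      by (simp add: on_fields_def fun_eq_iff)
    show "on_fields \<phi> ((f \<cdot> X) # Xs) = f * on_fields \<phi> (X # Xs)"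
      if "X \<in> V" "set Xs \<subseteq> V" for f X Xs
      using t(2)[OF vector_fields_tangent[OF that(1)] T_zero tangent[OF that(2)], where b = 0]
      by (simp add: on_fields_def fun_eq_iff)
  qed
qed

lemma tensorial_Cons:
  assumes \<Phi>: "tensorial \<Phi>" and X: "X \<in> V"
  shows "tensorial (\<lambda>Xs. \<Phi> (X # Xs))"
proof -
  have swap: "\<Phi> (X # Y # Xs) = \<Phi> (Y # X # Xs)" for Y Xs
    by (rule tensorialD(2)[OF \<Phi>]) simp
  show ?thesis
    unfolding tensorial_def
  proof (intro conjI allI impI)
    show "\<Phi> (X # Xs) \<in> C" if "set Xs \<subseteq> V" for Xs
      using that X by (intro tensorialD(1)[OF \<Phi>]) auto
    show "\<Phi> (X # Xs) = \<Phi> (X # Ys)" if "mset Xs = mset Ys" for Xs Ys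
      by (rule tensorialD(2)[OF \<Phi>]) (simp add: that)
    show "\<Phi> (X # (Y + Z) # Xs) = \<Phi> (X # Y # Xs) + \<Phi> (X # Z # Xs)"
      if "Y \<in> V" "Z \<in> V" "set Xs \<subseteq> V" for Y Z Xs
      using that X tensorialD(3)[OF \<Phi>, of Y Z "X # Xs"] unfolding swap by auto
    show "\<Phi> (X # (f \<cdot> Y) # Xs) = f * \<Phi> (X # Y # Xs)"
      if "f \<in> C" "Y \<in> V" "set Xs \<subseteq> V" for f Y Xs
      using that X tensorialD(4)[OF \<Phi>, of f Y "X # Xs"] unfolding swap by auto
  qed
qed

text \<open>The arguments are exchanged one after the other; each exchange is the case of a single field.\<close>

lemma tensorial_cong_at_point:
  assumes "tensorial \<Phi>" "set Xs \<subseteq> V" "set Ys \<subseteq> V" "map (\<lambda>X. X p) Xs = map (\<lambda>X. X p) Ys"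
  shows "\<Phi> Xs p = \<Phi> Ys p"
  using assms
proof (induction Xs arbitrary: \<Phi> Ys)
  case (Cons X Xs)
  then obtain Y Ys' where Ys: "Ys = Y # Ys'" "X p = Y p" "map (\<lambda>X. X p) Xs = map (\<lambda>X. X p) Ys'"
    by (cases Ys) auto
  have mem: "X \<in> V" "Y \<in> V" "set Xs \<subseteq> V" "set Ys' \<subseteq> V" using Cons.prems Ys by auto
  have mult: "f * h = f \<cdot> h" for f h :: "'m \<Rightarrow> real" by (simp add: fun_eq_iff)
  have "\<Phi> (X # Xs) p = \<Phi> (Y # Xs) p"
  proof (rule tensorial_pointwise[of "\<lambda>X. \<Phi> (X # Xs)", OF _ _ mem(1,2) Ys(2)])
    show "\<Phi> ((X + Y) # Xs) = \<Phi> (X # Xs) + \<Phi> (Y # Xs)" if "X \<in> V" "Y \<in> V" for X Y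
      using tensorialD(3)[OF Cons.prems(1) that mem(3)] .
    show "\<Phi> ((f \<cdot> X) # Xs) = f \<cdot> \<Phi> (X # Xs)" if "f \<in> C" "X \<in> V" for f X
      using tensorialD(4)[OF Cons.prems(1) that mem(3)] unfolding mult .
  qed
  also have "\<dots> = \<Phi> (Y # Ys') p"
    using Cons.IH[OF tensorial_Cons[OF Cons.prems(1) mem(2)] mem(3,4) Ys(3)] .
  finally show ?case using Ys by simp
qed simp

text \<open>The extensions of tangent vectors to fields are arbitrary; for tensorial functions the result does
  not depend on them.\<close>

definition tensor_of :: "(('m \<Rightarrow> ('m, 'e) tvec) list \<Rightarrow> 'm \<Rightarrow> real) \<Rightarrow> ('m, 'e) tensor_field" where
  "tensor_of \<Phi> p vs = (if set vs \<subseteq> T p then \<Phi> (map (extend p) vs) p else 0)"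

lemma on_fields_tensor_of:
  assumes "tensorial \<Phi>" "set Xs \<subseteq> V"
  shows "on_fields (tensor_of \<Phi>) Xs = \<Phi> Xs"
proof
  fix p
  have "set (map (\<lambda>X. X p) Xs) \<subseteq> T p" using assms(2) vector_fields_tangent by auto
  moreover have "\<Phi> (map (extend p) (map (\<lambda>X. X p) Xs)) p = \<Phi> Xs p"
    by (rule tensorial_cong_at_point[OF assms(1)])
      (use assms(2) extend vector_fields_tangent in \<open>auto simp: subset_eq\<close>)
  ultimately show "on_fields (tensor_of \<Phi>) Xs p = \<Phi> Xs p"
    by (simp add: on_fields_def tensor_of_def)
qed

lemma symmetric_field_tensor_of:
  assumes "tensorial \<Phi>"
  shows "symmetric_field (tensor_of \<Phi>)"
proof -
  note ev = on_fields_tensor_of[OF assms]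
  have at: "tensor_of \<Phi> p (map (\<lambda>X. X p) Xs) = \<Phi> Xs p" if "set Xs \<subseteq> V" for Xs p
    using ev[OF that] by (simp add: on_fields_def fun_eq_iff)
  have "symmetric_multilinear p (tensor_of \<Phi> p)" for p
    unfolding symmetric_multilinear_def
  proof (intro conjI allI impI)
    show "tensor_of \<Phi> p vs = 0" if "\<not> set vs \<subseteq> T p" for vs
      using that by (simp add: tensor_of_def)
    show "tensor_of \<Phi> p vs = tensor_of \<Phi> p ws" if eq: "mset vs = mset ws" for vs ws
    proof (cases "set vs \<subseteq> T p")
      case True
      have "\<Phi> (map (extend p) vs) = \<Phi> (map (extend p) ws)"
        by (rule tensorialD(2)[OF assms]) (simp add: eq)
      then show ?thesis using mset_eq_setD[OF eq] by (simp add: tensor_of_def)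
    qed (use mset_eq_setD[OF eq] in \<open>simp add: tensor_of_def\<close>)
    show "tensor_of \<Phi> p ((a *\<^sub>R u + b *\<^sub>R w) # vs) = a * tensor_of \<Phi> p (u # vs) + b * tensor_of \<Phi> p (w # vs)"
      if "u \<in> T p" "w \<in> T p" "set vs \<subseteq> T p" for u w vs a b
    proof -
      let ?U = "extend p u" and ?W = "extend p w" and ?Xs = "map (extend p) vs"
      have Xs: "set ?Xs \<subseteq> V" "map (\<lambda>X. X p) ?Xs = vs"
        using that(3) extend by (auto simp: subset_eq o_def intro!: map_idI)
      have UW: "?U \<in> V" "?U p = u" "?W \<in> V" "?W p = w" using that extend by auto
      let ?k = "\<lambda>a. (\<lambda>_::'m. a) :: 'm \<Rightarrow> real"
      have kUW: "?k a \<cdot> ?U \<in> V" "?k b \<cdot> ?W \<in> V" using V_scale C_const UW by auto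
      have "tensor_of \<Phi> p ((a *\<^sub>R u + b *\<^sub>R w) # vs) = \<Phi> ((?k a \<cdot> ?U + ?k b \<cdot> ?W) # ?Xs) p"
        using at[of "(?k a \<cdot> ?U + ?k b \<cdot> ?W) # ?Xs" p] Xs UW V_add[OF kUW] by simp
      also have "\<dots> = a * \<Phi> (?U # ?Xs) p + b * \<Phi> (?W # ?Xs) p"
        using tensorialD(3)[OF assms kUW Xs(1)] tensorialD(4)[OF assms C_const[of a] UW(1) Xs(1)]
          tensorialD(4)[OF assms C_const[of b] UW(3) Xs(1)] by simp
      finally show ?thesis using at[of "?U # ?Xs" p] at[of "?W # ?Xs" p] Xs UW by simp
    qed
  qed
  then show ?thesis
    using tensorialD(1)[OF assms] by (auto simp: symmetric_field_def ev)
qed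

lemma symmetric_field_eqI:
  assumes \<phi>: "symmetric_field \<phi>" and \<psi>: "symmetric_field \<psi>"
    and eq: "\<And>Xs p. set Xs \<subseteq> V \<Longrightarrow> on_fields \<phi> Xs p = on_fields \<psi> Xs p"
  shows "\<phi> = \<psi>"
proof (intro ext)
  fix p vs
  show "\<phi> p vs = \<psi> p vs"
  proof (cases "set vs \<subseteq> T p")
    case True
    then have "set (map (extend p) vs) \<subseteq> V" "map (\<lambda>X. X p) (map (extend p) vs) = vs"
      using extend by (auto simp: subset_eq o_def intro!: map_idI)
    then show ?thesis using eq[of "map (extend p) vs" p] by (simp add: on_fields_def)
  next
    case False
    then show ?thesis
      using symmetric_multilinearD(1)[OF symmetric_fieldD(1)[OF \<phi>]]
        symmetric_multilinearD(1)[OF symmetric_fieldD(1)[OF \<psi>]] by simp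
  qed
qed


section \<open>Duality of one-forms and vector fields\<close>

definition cut_form :: "('m, 'e) chart \<Rightarrow> ('m \<Rightarrow> real) \<Rightarrow> 'e \<Rightarrow> ('m, 'e) tensor_field" where
  "cut_form c \<eta> b q vs =
     (if q \<in> fst c \<and> length vs = 1 \<and> hd vs \<in> T q then \<eta> q * (hd vs c \<bullet> b) else 0)"

lemma cut_form_sym_forms:
  assumes \<eta>: "bump_at c \<eta> p"
  shows "cut_form c \<eta> b \<in> sym_forms A 1"
proof -
  have "symmetric_multilinear q (cut_form c \<eta> b q)" for q
    unfolding symmetric_multilinear_def
  proof (intro conjI allI impI)
    show "cut_form c \<eta> b q vs = 0" if "\<not> set vs \<subseteq> T q" for vs
      using that by (cases vs) (auto simp: cut_form_def)
    show "cut_form c \<eta> b q ((x *\<^sub>R u + y *\<^sub>R w) # vs)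
        = x * cut_form c \<eta> b q (u # vs) + y * cut_form c \<eta> b q (w # vs)"
      if "u \<in> T q" "w \<in> T q" for u w vs x y
      using that T_add[OF T_scaleR[OF that(1), of x] T_scaleR[OF that(2), of y]]
      by (auto simp: cut_form_def inner_add_left algebra_simps)
    show "cut_form c \<eta> b q vs = cut_form c \<eta> b q ws" if "mset vs = mset ws" for vs ws
    proof (cases "length vs = 1")
      case True
      then obtain v where "vs = [v]" by (auto simp: length_Suc_conv)
      then show ?thesis using that by simp
    qed (use mset_eq_length[OF that] in \<open>simp add: cut_form_def\<close>)
  qed
  moreover have "on_fields (cut_form c \<eta> b) Xs \<in> C" if Xs: "set Xs \<subseteq> V" for Xs
  proof (cases "length Xs = 1")
    case True
    then obtain X where X: "Xs = [X]" "X \<in> V" using Xs by (auto simp: length_Suc_conv)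
    then have "on_fields (cut_form c \<eta> b) Xs = cut_component c \<eta> b X"
      using vector_fields_tangent by (auto simp: on_fields_def cut_form_def cut_component_def fun_eq_iff)
    then show ?thesis using cut_component_C[OF \<eta> X(2)] by simp
  next
    case False
    then have "on_fields (cut_form c \<eta> b) Xs = 0" by (auto simp: on_fields_def cut_form_def fun_eq_iff)
    then show ?thesis using C_zero by simp
  qed
  ultimately show ?thesis
    by (auto simp: sym_forms_iff symmetric_field_def cut_form_def)
qed

lemma tangent_vector_eqI:
  assumes v: "v \<in> T p" and w: "w \<in> T p" and eq: "\<And>\<alpha>. \<alpha> \<in> sym_forms A 1 \<Longrightarrow> \<alpha> p [v] = \<alpha> p [w]"
  shows "v = w"
proof -
  obtain c \<eta> where \<eta>: "bump_at c \<eta> p" by (rule ex_bump_at)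
  show ?thesis
  proof (rule tangent_space_eqI[OF v w bump_atD(1,2)[OF \<eta>]], rule euclidean_eqI)
    fix b :: 'e
    show "v c \<bullet> b = w c \<bullet> b"
      using eq[OF cut_form_sym_forms[OF \<eta>], of b] v w bump_atD[OF \<eta>] by (simp add: cut_form_def)
  qed
qed

text \<open>Near p the components of Z are its pairings with the cut-off coordinate differentials.\<close>

lemma vector_fieldsI_one_forms:
  assumes tangent: "\<And>p. Z p \<in> T p"
    and smooth: "\<And>\<alpha>. \<alpha> \<in> sym_forms A 1 \<Longrightarrow> (\<lambda>p. \<alpha> p [Z p]) \<in> C"
  shows "Z \<in> V"
proof (rule vector_fieldsI[OF tangent])
  fix p
  obtain c \<eta> where \<eta>: "bump_at c \<eta> p" by (rule ex_bump_at)
  obtain W where W: "open W" "p \<in> W" "W \<subseteq> fst c" "\<And>q. q \<in> W \<Longrightarrow> \<eta> q = 1"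
    using bump_at_nbhd[OF \<eta>] by blast
  have "smooth_fun_on W (\<lambda>q. cut_form c \<eta> b q [Z q])" for b
    using smooth[OF cut_form_sym_forms[OF \<eta>], of b] smooth_fun_on_subset unfolding smooth_functions_iff by blast
  then have "smooth_fun_on W (\<lambda>q. \<Sum>b\<in>Basis. cut_form c \<eta> b q [Z q] *\<^sub>R b)"
    by (intro smooth_fun_on_sum smooth_fun_on_scaleR smooth_fun_on_const W(1))
  then have "smooth_fun_on W (\<lambda>q. Z q c)"
  proof (rule smooth_fun_on_cong[OF W(1)])
    fix q assume q: "q \<in> W"
    then have "cut_form c \<eta> b q [Z q] = Z q c \<bullet> b" for b
      using W tangent by (auto simp: cut_form_def)
    then show "(\<Sum>b\<in>Basis. cut_form c \<eta> b q [Z q] *\<^sub>R b) = Z q c"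
      by (simp add: euclidean_representation)
  qed
  then show "\<exists>c\<in>A. \<exists>W. open W \<and> p \<in> W \<and> W \<subseteq> fst c \<and> smooth_fun_on W (\<lambda>q. Z q c)"
    using bump_atD(1)[OF \<eta>] W by blast
qed

text \<open>The cut-off coordinate differentials and the cut-off coordinate fields are dual frames up to the
  factor \<open>\<eta>\<^sup>2\<close>.\<close>

lemma one_form_expand:
  assumes \<eta>: "bump_at c \<eta> p" and \<alpha>: "\<alpha> \<in> sym_forms A 1"
  shows "(\<eta> * \<eta>) \<cdot> \<alpha> = (\<Sum>b\<in>Basis. on_fields \<alpha> [cut_field c \<eta> b] \<cdot> cut_form c \<eta> b)"
proof (intro ext)
  fix q vs
  have t: "symmetric_multilinear q (\<alpha> q)" and len: "\<And>vs. length vs \<noteq> 1 \<Longrightarrow> \<alpha> q vs = 0"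
    using \<alpha> by (auto simp: sym_forms_iff symmetric_field_def)
  have rhs: "(\<Sum>b\<in>Basis. on_fields \<alpha> [cut_field c \<eta> b] \<cdot> cut_form c \<eta> b) q vs
      = (\<Sum>b\<in>Basis. \<alpha> q [cut_field c \<eta> b q] * cut_form c \<eta> b q vs)"
    by (simp add: sum_fun_apply on_fields_def)
  show "((\<eta> * \<eta>) \<cdot> \<alpha>) q vs = (\<Sum>b\<in>Basis. on_fields \<alpha> [cut_field c \<eta> b] \<cdot> cut_form c \<eta> b) q vs"
  proof (cases "q \<in> fst c \<and> (\<exists>v\<in>T q. vs = [v])")
    case True
    then obtain v where v: "v \<in> T q" "vs = [v]" and c: "c \<in> A" "q \<in> fst c" using bump_atD[OF \<eta>] by auto
    have "\<alpha> q [cut_field c \<eta> b q] = \<eta> q * \<alpha> q [coord_vec A c q b]" for b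
      using symmetric_multilinearD(2)[OF t coord_vec_in_T[OF c] T_zero, where vs = "[]" and a = "\<eta> q" and b = 0] c
      by (simp add: cut_field_def)
    then show ?thesis
      using symmetric_multilinear_coord_expand[OF t v(1) _ c, where vs = "[]"] v c unfolding rhs
      by (simp add: cut_form_def sum_distrib_left mult_ac)
  next
    case False
    then have "cut_form c \<eta> b q vs = 0" for b
      by (cases vs) (auto simp: cut_form_def)
    moreover have "\<eta> q * \<eta> q * \<alpha> q vs = 0"
    proof (cases "q \<in> fst c")
      case True
      then have "\<alpha> q vs = 0"
      proof (cases "length vs = 1")
        case l: True
        then obtain v where "vs = [v]" by (auto simp: length_Suc_conv)
        then show ?thesis using False True symmetric_multilinearD(1)[OF t, of vs] by auto
      qed (simp add: len)
      then show ?thesis by simp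
    qed (simp add: bump_atD(5)[OF \<eta>])
    ultimately show ?thesis unfolding rhs by simp
  qed
qed

text \<open>The value of such a functional at p is computed from the expansion of the form in the dual of
  a cut-off frame, whose coefficients are values of the form on the frame.\<close>

lemma functional_is_vector_field:
  assumes smooth: "\<And>\<alpha>. \<alpha> \<in> sym_forms A 1 \<Longrightarrow> a \<alpha> \<in> C"
    and add: "\<And>\<alpha> \<beta>. \<alpha> \<in> sym_forms A 1 \<Longrightarrow> \<beta> \<in> sym_forms A 1 \<Longrightarrow> a (\<alpha> + \<beta>) = a \<alpha> + a \<beta>"
    and scale: "\<And>f \<alpha>. f \<in> C \<Longrightarrow> \<alpha> \<in> sym_forms A 1 \<Longrightarrow> a (f \<cdot> \<alpha>) = f * a \<alpha>"
  shows "\<exists>X\<in>V. \<forall>\<alpha>\<in>sym_forms A 1. a \<alpha> = on_fields \<alpha> [X]"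
proof -
  have "\<exists>v\<in>T p. \<forall>\<alpha>\<in>sym_forms A 1. a \<alpha> p = \<alpha> p [v]" for p
  proof -
    obtain c \<eta> where \<eta>: "bump_at c \<eta> p" by (rule ex_bump_at)
    define v where "v = (\<Sum>b\<in>Basis. a (cut_form c \<eta> b) p *\<^sub>R cut_field c \<eta> b p)"
    have eta2: "\<eta> * \<eta> \<in> C" "1 - \<eta> * \<eta> \<in> C" using bump_atD(4)[OF \<eta>] by (auto intro: C_mult C_diff C_one)
    have zero: "a 0 = 0"
    proof -
      have "0 \<cdot> \<phi> = 0" for \<phi> :: "('m, 'e) tensor_field" by (intro ext) simp
      then show ?thesis using scale[OF C_zero sym_forms_zero] by (simp only: mult_zero_left)
    qed
    have sum: "a (\<Sum>b\<in>I. \<beta> b) p = (\<Sum>b\<in>I. a (\<beta> b) p)" if "\<And>b. b \<in> I \<Longrightarrow> \<beta> b \<in> sym_forms A 1"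
      for I :: "'e set" and \<beta>
      using that by (induction I rule: infinite_finite_induct) (auto simp: zero add sym_forms_sum)
    have "a \<alpha> p = \<alpha> p [v]" if \<alpha>: "\<alpha> \<in> sym_forms A 1" for \<alpha>
    proof -
      have "\<alpha> = (\<eta> * \<eta>) \<cdot> \<alpha> + (1 - \<eta> * \<eta>) \<cdot> \<alpha>" by (simp add: fun_eq_iff algebra_simps)
      then have "a \<alpha> = a ((\<eta> * \<eta>) \<cdot> \<alpha>) + a ((1 - \<eta> * \<eta>) \<cdot> \<alpha>)"
        using add[OF sym_forms_scale[OF eta2(1) \<alpha>] sym_forms_scale[OF eta2(2) \<alpha>]] by simp
      also have "a ((1 - \<eta> * \<eta>) \<cdot> \<alpha>) = (1 - \<eta> * \<eta>) * a \<alpha>" by (rule scale[OF eta2(2) \<alpha>])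
      finally have "a \<alpha> p = (a ((\<eta> * \<eta>) \<cdot> \<alpha>) + (1 - \<eta> * \<eta>) * a \<alpha>) p" by (rule fun_cong)
      also have "\<dots> = a ((\<eta> * \<eta>) \<cdot> \<alpha>) p" by (simp add: bump_atD(3)[OF \<eta>])
      also have "\<dots> = (\<Sum>b\<in>Basis. a (on_fields \<alpha> [cut_field c \<eta> b] \<cdot> cut_form c \<eta> b) p)"
        unfolding one_form_expand[OF \<eta> \<alpha>]
        by (intro sum sym_forms_scale cut_form_sym_forms[OF \<eta>] symmetric_fieldD(2))
          (use \<alpha> cut_field_V[OF \<eta>] in \<open>auto simp: sym_forms_iff\<close>)
      also have "\<dots> = (\<Sum>b\<in>Basis. a (cut_form c \<eta> b) p * \<alpha> p [cut_field c \<eta> b p])"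
      proof (rule sum.cong[OF refl])
        fix b :: 'e
        have coeff: "on_fields \<alpha> [cut_field c \<eta> b] \<in> C"
          using \<alpha> cut_field_V[OF \<eta>] by (auto simp: sym_forms_iff intro: symmetric_fieldD(2))
        show "a (on_fields \<alpha> [cut_field c \<eta> b] \<cdot> cut_form c \<eta> b) p = a (cut_form c \<eta> b) p * \<alpha> p [cut_field c \<eta> b p]"
          unfolding scale[OF coeff cut_form_sym_forms[OF \<eta>]] by (simp add: on_fields_def)
      qed
      also have "\<dots> = \<alpha> p [v]"
        unfolding v_def using \<alpha>
        by (intro symmetric_multilinear_sum[symmetric]) (auto simp: sym_forms_iff symmetric_field_def intro: cut_field_tangent[OF \<eta>])
      finally show ?thesis .
    qed
    moreover have "v \<in> T p"
      unfolding v_def by (intro T_sum T_scaleR cut_field_tangent[OF \<eta>])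
    ultimately show ?thesis by blast
  qed
  then obtain X where X: "\<And>p. X p \<in> T p" "\<And>p \<alpha>. \<alpha> \<in> sym_forms A 1 \<Longrightarrow> a \<alpha> p = \<alpha> p [X p]" by metis
  have eq: "a \<alpha> = on_fields \<alpha> [X]" if "\<alpha> \<in> sym_forms A 1" for \<alpha>
    using X(2)[OF that] by (simp add: on_fields_def fun_eq_iff)
  have "X \<in> V"
  proof (rule vector_fieldsI_one_forms[OF X(1)])
    show "(\<lambda>p. \<alpha> p [X p]) \<in> C" if "\<alpha> \<in> sym_forms A 1" for \<alpha>
      using smooth[OF that] eq[OF that] by (simp add: on_fields_def)
  qed
  then show ?thesis using eq by blast
qed

end


section \<open>The symmetric product as a shuffle product\<close>

text \<open>The symmetric product of two symmetric functions of lists sums over all ways of distributing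
  the arguments to the two factors. Deciding on the first argument gives a recursion which says that
  inserting a fixed first argument is a derivation of the product; it makes identities between
  products accessible to induction on the argument list.\<close>

primrec shuffle_prod :: "('v list \<Rightarrow> 'a::comm_ring_1) \<Rightarrow> ('v list \<Rightarrow> 'a) \<Rightarrow> 'v list \<Rightarrow> 'a" where
  "shuffle_prod t s [] = t [] * s []"
| "shuffle_prod t s (v # vs) = shuffle_prod (\<lambda>ws. t (v # ws)) s vs + shuffle_prod t (\<lambda>ws. s (v # ws)) vs"

lemma shuffle_prod_add_left:
  "shuffle_prod (\<lambda>ws. t ws + t' ws) s vs = shuffle_prod t s vs + shuffle_prod t' s vs"
  by (induction vs arbitrary: t t' s) (simp_all add: algebra_simps)

lemma shuffle_prod_scale_left: "shuffle_prod (\<lambda>ws. c * t ws) s vs = c * shuffle_prod t s vs"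
  by (induction vs arbitrary: t s) (simp_all add: algebra_simps)

lemma shuffle_prod_zero_left: "shuffle_prod (\<lambda>ws. 0) s vs = 0"
  by (induction vs arbitrary: s) simp_all

lemma shuffle_prod_commute: "shuffle_prod t s vs = shuffle_prod s t vs"
  by (induction vs arbitrary: t s) (simp_all add: mult.commute add.commute)

lemma shuffle_prod_add_right:
  "shuffle_prod s (\<lambda>ws. t ws + t' ws) vs = shuffle_prod s t vs + shuffle_prod s t' vs"
  unfolding shuffle_prod_commute[of s] by (rule shuffle_prod_add_left)

lemma shuffle_prod_scale_right: "shuffle_prod s (\<lambda>ws. c * t ws) vs = c * shuffle_prod s t vs"
  unfolding shuffle_prod_commute[of s] by (rule shuffle_prod_scale_left)

lemma shuffle_prod_zero_right: "shuffle_prod s (\<lambda>ws. 0) vs = 0"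
  unfolding shuffle_prod_commute[of s] by (rule shuffle_prod_zero_left)

lemma shuffle_prod_degree_0_left:
  "(\<And>v ws. t (v # ws) = 0) \<Longrightarrow> shuffle_prod t s vs = t [] * s vs"
  by (induction vs arbitrary: s) (simp_all add: shuffle_prod_zero_left)

lemma shuffle_prod_cong_left:
  assumes "set vs \<subseteq> U" "\<And>ws. set ws \<subseteq> U \<Longrightarrow> t ws = t' ws"
  shows "shuffle_prod t s vs = shuffle_prod t' s vs"
  using assms
proof (induction vs arbitrary: t t' s)
  case (Cons v vs)
  then have "shuffle_prod (\<lambda>ws. t (v # ws)) s vs = shuffle_prod (\<lambda>ws. t' (v # ws)) s vs"
    by (intro Cons.IH) auto
  moreover have "shuffle_prod t (\<lambda>ws. s (v # ws)) vs = shuffle_prod t' (\<lambda>ws. s (v # ws)) vs"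
    using Cons.prems by (intro Cons.IH) auto
  ultimately show ?case by (simp only: shuffle_prod.simps)
qed simp

definition symmetric_fun :: "('v list \<Rightarrow> 'a) \<Rightarrow> bool" where
  "symmetric_fun t \<longleftrightarrow> (\<forall>vs ws. mset vs = mset ws \<longrightarrow> t vs = t ws)"

lemma symmetric_funD: "symmetric_fun t \<Longrightarrow> mset vs = mset ws \<Longrightarrow> t vs = t ws"
  unfolding symmetric_fun_def by blast

lemma symmetric_fun_Cons: "symmetric_fun t \<Longrightarrow> symmetric_fun (\<lambda>ws. t (v # ws))"
  unfolding symmetric_fun_def[of "\<lambda>ws. t (v # ws)"] by (intro allI impI) (erule symmetric_funD, simp)

lemma symmetric_fun_swap: "symmetric_fun t \<Longrightarrow> t (v # w # ws) = t (w # v # ws)"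
  by (rule symmetric_funD) simp_all

text \<open>The induction step for proving symmetry on lists of a given length: any two arrangements are
  related by exchanging the first two arguments and permuting all but the first.\<close>

lemma symmetric_on_length_Suc:
  assumes swap: "\<And>v w ws. t (v # w # ws) = t (w # v # ws)"
    and tail: "\<And>v vs ws. length vs = n \<Longrightarrow> mset vs = mset ws \<Longrightarrow> t (v # vs) = t (v # ws)"
    and vs: "length vs = Suc n" and eq: "mset vs = mset ws"
  shows "t vs = t ws"
proof -
  obtain v vs' where vs': "vs = v # vs'" "length vs' = n" using vs by (cases vs) auto
  have "ws \<noteq> []" using eq vs' by auto
  then obtain w ws' where ws': "ws = w # ws'" by (cases ws) auto
  show ?thesis
  proof (cases "v = w")
    case True
    then show ?thesis using tail[OF vs'(2), of ws' v] eq vs' ws' by simp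
  next
    case False
    have m: "add_mset v (mset vs') = add_mset w (mset ws')" using eq vs' ws' by simp
    then obtain K where K: "mset vs' = add_mset w K" "mset ws' = add_mset v K"
      using False by (metis add_eq_conv_ex)
    obtain zs where zs: "mset zs = K" using ex_mset by blast
    have "t vs = t (v # w # zs)" unfolding vs'(1) by (rule tail[OF vs'(2)]) (simp add: K zs)
    also have "\<dots> = t (w # v # zs)" by (rule swap)
    also have "\<dots> = t (w # ws')"
    proof (rule tail)
      have "Suc (length zs) = length vs'" using K(1) zs by (metis size_add_mset size_mset)
      then show "length (v # zs) = n" using vs'(2) by simp
    qed (simp add: K zs)
    finally show ?thesis by (simp add: ws')
  qed
qed

lemma symmetric_fun_shuffle_prod:
  assumes "symmetric_fun t" "symmetric_fun s"
  shows "symmetric_fun (shuffle_prod t s)"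
proof -
  have by_length: "shuffle_prod t s vs = shuffle_prod t s ws"
    if "length vs = n" "mset vs = mset ws" "symmetric_fun t" "symmetric_fun s" for n vs ws and t s :: "'a list \<Rightarrow> 'b"
    using that
  proof (induction n arbitrary: t s vs ws)
    case 0
    then show ?case by simp
  next
    case (Suc n)
    note sym = Suc.prems(3,4)
    show ?case
    proof (rule symmetric_on_length_Suc[OF _ _ Suc.prems(1,2)])
      show "shuffle_prod t s (v # w # ws) = shuffle_prod t s (w # v # ws)" for v w ws
        using symmetric_fun_swap[OF sym(1), of v w] symmetric_fun_swap[OF sym(2), of v w]
        by (simp add: add_ac)
      show "shuffle_prod t s (v # vs) = shuffle_prod t s (v # ws)"
        if "length vs = n" "mset vs = mset ws" for v vs ws
        using Suc.IH[OF that symmetric_fun_Cons[OF sym(1)] sym(2)]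
          Suc.IH[OF that sym(1) symmetric_fun_Cons[OF sym(2)]] by simp
    qed
  qed
  show ?thesis
    unfolding symmetric_fun_def[of "shuffle_prod t s"] using by_length[OF refl _ assms] by blast
qed

lemma permute_list_transpose_last:
  assumes "b \<le> length ws"
  shows "permute_list (Transposition.transpose (length ws) b) (ws @ [v]) =
    (if b = length ws then ws @ [v] else ws[b := v] @ [ws ! b])"
  using assms
  by (auto simp: permute_list_def Transposition.transpose_def nth_append intro!: nth_equalityI)

text \<open>A permutation of \<open>n + 1\<close> places is a permutation of the first n places followed by an exchange of
  the last place with some place b.\<close>

lemma sum_permutations_snoc:
  fixes f :: "'v list \<Rightarrow> 'a::comm_monoid_add"
  shows "(\<Sum>\<pi> | \<pi> permutes {..<Suc (length vs)}. f (permute_list \<pi> (vs @ [v]))) =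
    (\<Sum>b\<le>length vs. \<Sum>\<pi> | \<pi> permutes {..<length vs}. f (let ws = permute_list \<pi> vs in
       if b = length vs then ws @ [v] else ws[b := v] @ [ws ! b]))"
proof -
  let ?n = "length vs"
  let ?P = "{\<pi>. \<pi> permutes {..<?n}}"
  let ?F = "\<lambda>\<pi>. f (permute_list \<pi> (vs @ [v]))"
  have "sum ?F {\<pi>. \<pi> permutes {..<Suc ?n}} = (\<Sum>\<pi> | \<pi> permutes (insert ?n {..<?n}). ?F (inv \<pi>))"
    by (subst sum_permutations_inverse) (simp add: lessThan_Suc)
  also have "\<dots> = (\<Sum>b\<in>insert ?n {..<?n}. \<Sum>q\<in>?P. ?F (inv (Transposition.transpose ?n b \<circ> q)))"
    by (rule sum_over_permutations_insert) auto
  also have "\<dots> = (\<Sum>b\<le>?n. \<Sum>q\<in>?P. ?F (inv q \<circ> Transposition.transpose ?n b))"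
    by (intro sum.cong) (auto simp: o_inv_distrib permutes_bij)
  also have "\<dots> = (\<Sum>b\<le>?n. \<Sum>q\<in>?P. ?F (q \<circ> Transposition.transpose ?n b))"
    by (intro sum.cong refl sum_permutations_inverse[symmetric, where f = "\<lambda>q. ?F (q \<circ> Transposition.transpose ?n b)" for b])
  also have "\<dots> = (\<Sum>b\<le>?n. \<Sum>\<pi>\<in>?P. f (let ws = permute_list \<pi> vs in
       if b = ?n then ws @ [v] else ws[b := v] @ [ws ! b]))"
  proof (intro sum.cong refl arg_cong[of _ _ f])
    fix b q assume b: "b \<in> {..?n}" and q: "q \<in> ?P"
    have "Transposition.transpose ?n b permutes {..<Suc ?n}" using b by (intro permutes_swap_id) auto
    then have "permute_list (q \<circ> Transposition.transpose ?n b) (vs @ [v])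
        = permute_list (Transposition.transpose ?n b) (permute_list q (vs @ [v]))"
      by (intro permute_list_compose) simp
    also have "permute_list q (vs @ [v]) = permute_list q vs @ [v]"
    proof (rule nth_equalityI)
      fix i assume "i < length (permute_list q (vs @ [v]))"
      then have i: "i < Suc ?n" by simp
      have "q i < ?n" if "i < ?n" using that q permutes_in_image[of q "{..<?n}" i] by auto
      moreover have "q ?n = ?n" using q permutes_not_in[of q "{..<?n}" ?n] by auto
      ultimately show "permute_list q (vs @ [v]) ! i = (permute_list q vs @ [v]) ! i"
        using i by (auto simp: permute_list_def nth_append less_Suc_eq)
    qed simp
    finally have compose: "permute_list (q \<circ> Transposition.transpose ?n b) (vs @ [v])
        = permute_list (Transposition.transpose ?n b) (permute_list q vs @ [v])" .
    show "permute_list (q \<circ> Transposition.transpose ?n b) (vs @ [v]) = (let ws = permute_list q vs in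
       if b = ?n then ws @ [v] else ws[b := v] @ [ws ! b])"
      unfolding compose Let_def using permute_list_transpose_last[of b "permute_list q vs" v] b by simp
  qed
  finally show ?thesis .
qed

lemma mset_update_snoc: "i < length xs \<Longrightarrow> mset (xs[i := x] @ [xs ! i]) = add_mset x (mset xs)"
  by (simp add: mset_update)

text \<open>The extra argument v occupies one of the \<open>n + 1\<close> places. For r of them it is an argument of the
  first factor, otherwise of the second one. By symmetry of the factors, it may be moved to the front
  of the block to which it belongs.\<close>

lemma sum_permutations_split_snoc:
  fixes t s :: "'v list \<Rightarrow> real"
  assumes t: "symmetric_fun t" and s: "symmetric_fun s" and r: "r \<le> Suc (length vs)"
  defines "S \<equiv> \<lambda>t s r. \<Sum>\<pi> | \<pi> permutes {..<length vs}.
    t (take r (permute_list \<pi> vs)) * s (drop r (permute_list \<pi> vs))"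
  shows "(\<Sum>\<pi> | \<pi> permutes {..<Suc (length vs)}.
      t (take r (permute_list \<pi> (vs @ [v]))) * s (drop r (permute_list \<pi> (vs @ [v])))) =
    real r * S (\<lambda>ws. t (v # ws)) s (r - 1) + real (Suc (length vs) - r) * S t (\<lambda>ws. s (v # ws)) r"
proof -
  let ?n = "length vs"
  let ?P = "{\<pi>. \<pi> permutes {..<?n}}"
  let ?H = "\<lambda>ws. t (take r ws) * s (drop r ws)"
  define R where "R b ws = (if b = ?n then ws @ [v] else ws[b := v] @ [ws ! b])" for b ws
  have late: "(\<Sum>\<pi>\<in>?P. ?H (R b (permute_list \<pi> vs))) = S t (\<lambda>ws. s (v # ws)) r" if b: "r \<le> b" "b \<le> ?n" for b
    unfolding S_def
  proof (intro sum.cong refl)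
    fix \<pi>
    define ws where "ws = permute_list \<pi> vs"
    have len: "length ws = ?n" by (simp add: ws_def)
    have "take r (R b ws) = take r ws" using b len by (simp add: R_def)
    moreover have "s (drop r (R b ws)) = s (v # drop r ws)"
    proof (rule symmetric_funD[OF s])
      show "mset (drop r (R b ws)) = mset (v # drop r ws)"
      proof (cases "b = ?n")
        case False
        then have "drop r (R b ws) = (drop r ws)[b - r := v] @ [drop r ws ! (b - r)]" "b - r < length (drop r ws)"
          using b len by (auto simp: R_def drop_update_swap)
        then show ?thesis by (simp only: mset_update_snoc mset.simps)
      qed (use b len in \<open>simp add: R_def\<close>)
    qed
    ultimately show "?H (R b (permute_list \<pi> vs)) = t (take r (permute_list \<pi> vs)) * s (v # drop r (permute_list \<pi> vs))"
      by (simp add: ws_def)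
  qed
  have early: "(\<Sum>\<pi>\<in>?P. ?H (R b (permute_list \<pi> vs))) = S (\<lambda>ws. t (v # ws)) s (r - 1)" if b: "b < r" for b
  proof -
    \<comment> \<open>The argument displaced by v goes to the last place. Summing over all permutations makes it
      possible to assume that it comes from place \<open>r - 1\<close>, so that it is adjacent to the second block. If \<open>r = n + 1\<close>, the
      second block is empty and nothing has to be exchanged.\<close>
    let ?\<tau> = "Transposition.transpose b (r - 1)"
    have \<tau>: "?\<tau> permutes {..<?n}" if "r \<noteq> Suc ?n" using b r that by (intro permutes_swap_id) auto
    have "(\<Sum>\<pi>\<in>?P. ?H (R b (permute_list \<pi> vs))) = (\<Sum>\<pi>\<in>?P. ?H (R b (permute_list (if r = Suc ?n then \<pi> else \<pi> \<circ> ?\<tau>) vs)))"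
      using sum_permutations_compose_right[OF \<tau>, of "\<lambda>\<pi>. ?H (R b (permute_list \<pi> vs))"]
      by (cases "r = Suc ?n") simp_all
    also have "\<dots> = S (\<lambda>ws. t (v # ws)) s (r - 1)"
      unfolding S_def
    proof (intro sum.cong refl)
      fix \<pi> assume \<pi>: "\<pi> \<in> ?P"
      define ws where "ws = permute_list \<pi> vs"
      have len: "length ws = ?n" by (simp add: ws_def)
      show "?H (R b (permute_list (if r = Suc ?n then \<pi> else \<pi> \<circ> ?\<tau>) vs))
          = t (v # take (r - 1) (permute_list \<pi> vs)) * s (drop (r - 1) (permute_list \<pi> vs))"
      proof (cases "r = Suc ?n")
        case True
        have "mset (R b ws) = mset (v # ws)"
          using b True len by (auto simp: R_def mset_update)
        then have "t (R b ws) = t (v # ws)" by (rule symmetric_funD[OF t])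
        moreover have "length (R b ws) = Suc ?n" by (simp add: R_def len)
        ultimately show ?thesis using True len by (simp add: ws_def)
      next
        case False
        then have rn: "r \<le> ?n" "b \<noteq> ?n" "b < ?n" using r b by auto
        have p: "permute_list (\<pi> \<circ> ?\<tau>) vs = permute_list ?\<tau> ws"
          unfolding ws_def by (rule permute_list_compose[OF \<tau>[OF False]])
        define ws' where "ws' = permute_list ?\<tau> ws"
        have nth: "ws' ! i = ws ! ?\<tau> i" if "i < ?n" for i
          using that len \<tau>[OF False] by (simp add: ws'_def permute_list_nth)
        have len': "length ws' = ?n" by (simp add: ws'_def len)
        have drop: "drop r ws' = drop r ws"
          by (rule nth_equalityI) (use rn b len len' in \<open>auto simp: nth Transposition.transpose_def\<close>)
        have b': "ws' ! b = ws ! (r - 1)" using nth[of b] rn by (simp add: Transposition.transpose_def)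
        have "s (drop r ws' @ [ws' ! b]) = s (drop (r - 1) ws)"
        proof (rule symmetric_funD[OF s])
          have "drop (r - 1) ws = ws ! (r - 1) # drop r ws"
            using Cons_nth_drop_Suc[of "r - 1" ws] b rn len by auto
          then show "mset (drop r ws' @ [ws' ! b]) = mset (drop (r - 1) ws)"
            by (simp add: drop b')
        qed
        moreover have "t ((take r ws')[b := v]) = t (v # take (r - 1) ws)"
        proof (rule symmetric_funD[OF t])
          have "mset (take r ws') = mset (take r ws)"
          proof -
            have "mset ws' = mset ws"
              unfolding ws'_def by (rule mset_permute_list) (use \<tau>[OF False] len in simp)
            then have "mset (take r ws') + mset (drop r ws') = mset (take r ws) + mset (drop r ws)"
              by (metis append_take_drop_id mset_append)
            then show ?thesis by (simp add: drop)
          qed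
          moreover have "take r ws = take (r - 1) ws @ [ws ! (r - 1)]"
            using take_Suc_conv_app_nth[of "r - 1" ws] b rn len by auto
          moreover have "take r ws' ! b = ws ! (r - 1)" using b b' by simp
          ultimately show "mset ((take r ws')[b := v]) = mset (v # take (r - 1) ws)"
            using b rn len' by (simp add: mset_update)
        qed
        moreover have "take r (R b ws') = (take r ws')[b := v]" "drop r (R b ws') = drop r ws' @ [ws' ! b]"
          using b rn len' by (auto simp: R_def take_update_swap drop_update_cancel)
        ultimately show ?thesis using rn p by (simp add: ws'_def ws_def)
      qed
    qed
    finally show ?thesis .
  qed
  have "(\<Sum>\<pi> | \<pi> permutes {..<Suc ?n}. ?H (permute_list \<pi> (vs @ [v])))
      = (\<Sum>b\<le>?n. \<Sum>\<pi>\<in>?P. ?H (R b (permute_list \<pi> vs)))"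
    unfolding R_def using sum_permutations_snoc[of ?H vs v] by (simp add: Let_def)
  also have "\<dots> = (\<Sum>b<Suc ?n. if b < r then S (\<lambda>ws. t (v # ws)) s (r - 1) else S t (\<lambda>ws. s (v # ws)) r)"
    unfolding lessThan_Suc_atMost by (intro sum.cong refl) (auto simp: early late)
  also have "\<dots> = (\<Sum>b<r. S (\<lambda>ws. t (v # ws)) s (r - 1)) + (\<Sum>b\<in>{r..<Suc ?n}. S t (\<lambda>ws. s (v # ws)) r)"
  proof -
    let ?F = "\<lambda>b. if b < r then S (\<lambda>ws. t (v # ws)) s (r - 1) else S t (\<lambda>ws. s (v # ws)) r"
    have "sum ?F {..<Suc ?n} = sum ?F {..<r} + sum ?F {r..<Suc ?n}"
      unfolding atLeast0LessThan[symmetric] by (rule sum.atLeastLessThan_concat[symmetric]) (use r in auto)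
    then show ?thesis by simp
  qed
  finally show ?thesis by simp
qed

text \<open>Both sides satisfy the same recursion: the weights r and \<open>n + 1 - r\<close> of the two cases cancel against
  the factorials.\<close>

lemma sum_splits_eq_shuffle_prod:
  fixes t s :: "'v list \<Rightarrow> real"
  assumes "symmetric_fun t" "symmetric_fun s"
  shows "(\<Sum>r\<le>length vs. (\<Sum>\<pi> | \<pi> permutes {..<length vs}.
      t (take r (permute_list \<pi> vs)) * s (drop r (permute_list \<pi> vs))) / (fact r * fact (length vs - r)))
    = shuffle_prod t s vs"
  using assms
proof (induction vs arbitrary: t s rule: rev_induct)
  case Nil
  then show ?case by (simp add: permute_list_def)
next
  case (snoc v vs)
  let ?n = "length vs"
  define S where "S t s r = (\<Sum>\<pi> | \<pi> permutes {..<length vs}.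
    t (take r (permute_list \<pi> vs)) * s (drop r (permute_list \<pi> vs)))" for t s :: "'v list \<Rightarrow> real" and r
  let ?t = "\<lambda>ws. t (v # ws)" and ?s = "\<lambda>ws. s (v # ws)"
  note sym = snoc.prems
  have "(\<Sum>r\<le>length (vs @ [v]). (\<Sum>\<pi> | \<pi> permutes {..<length (vs @ [v])}.
      t (take r (permute_list \<pi> (vs @ [v]))) * s (drop r (permute_list \<pi> (vs @ [v]))))
        / (fact r * fact (length (vs @ [v]) - r)))
    = (\<Sum>r\<le>Suc ?n. (real r * S ?t s (r - 1) + real (Suc ?n - r) * S t ?s r) / (fact r * fact (Suc ?n - r)))"
    by (intro sum.cong) (auto simp: S_def sum_permutations_split_snoc[OF sym])
  also have "\<dots> = (\<Sum>r\<le>Suc ?n. real r * S ?t s (r - 1) / (fact r * fact (Suc ?n - r)))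
      + (\<Sum>r\<le>Suc ?n. real (Suc ?n - r) * S t ?s r / (fact r * fact (Suc ?n - r)))"
    by (simp only: add_divide_distrib sum.distrib)
  also have "(\<Sum>r\<le>Suc ?n. real r * S ?t s (r - 1) / (fact r * fact (Suc ?n - r)))
      = (\<Sum>r\<le>?n. S ?t s r / (fact r * fact (?n - r)))"
    unfolding sum.atMost_Suc_shift by (simp add: field_simps del: of_nat_Suc)
  also have "(\<Sum>r\<le>Suc ?n. real (Suc ?n - r) * S t ?s r / (fact r * fact (Suc ?n - r)))
      = (\<Sum>r\<le>?n. S t ?s r / (fact r * fact (?n - r)))"
  proof -
    have "real (Suc k) * x / (fact r * fact (Suc k)) = x / (fact r * fact k)" for k r x
      by (simp add: field_simps del: of_nat_Suc)
    then have "real (Suc ?n - r) * S t ?s r / (fact r * fact (Suc ?n - r)) = S t ?s r / (fact r * fact (?n - r))"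
      if "r \<le> ?n" for r using that by (simp only: Suc_diff_le)
    then have "(\<Sum>r\<le>?n. real (Suc ?n - r) * S t ?s r / (fact r * fact (Suc ?n - r)))
        = (\<Sum>r\<le>?n. S t ?s r / (fact r * fact (?n - r)))"
      by (intro sum.cong refl) (simp only: atMost_iff)
    then show ?thesis
      by (simp only: sum.atMost_Suc diff_self_eq_0 of_nat_0 mult_zero_left div_0 add_0_right)
  qed
  also have "(\<Sum>r\<le>?n. S ?t s r / (fact r * fact (?n - r))) = shuffle_prod ?t s vs"
    unfolding S_def by (rule snoc.IH[OF symmetric_fun_Cons[OF sym(1)] sym(2)])
  also have "(\<Sum>r\<le>?n. S t ?s r / (fact r * fact (?n - r))) = shuffle_prod t ?s vs"
    unfolding S_def by (rule snoc.IH[OF sym(1) symmetric_fun_Cons[OF sym(2)]])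
  also have "shuffle_prod ?t s vs + shuffle_prod t ?s vs = shuffle_prod t s (vs @ [v])"
    using symmetric_funD[OF symmetric_fun_shuffle_prod[OF sym], of "v # vs" "vs @ [v]"] by simp
  finally show ?case .
qed

lemma sym_prod_eq_shuffle_prod:
  assumes "symmetric_fun (\<phi> p)" "symmetric_fun (\<psi> p)"
  shows "sym_prod \<phi> \<psi> p vs = shuffle_prod (\<phi> p) (\<psi> p) vs"
  unfolding sum_splits_eq_shuffle_prod[OF assms, symmetric] sym_prod_def symmetrise_def
  by (intro sum.cong) auto

lemma shuffle_prod_apply:
  assumes "\<And>Ys. \<Phi> Ys p = t (map g Ys)" "\<And>Ys. \<Psi> Ys p = s (map g Ys)"
  shows "shuffle_prod \<Phi> \<Psi> Xs p = shuffle_prod t s (map g Xs)"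
  using assms
proof (induction Xs arbitrary: \<Phi> \<Psi> t s)
  case (Cons X Xs)
  show ?case
    using Cons.IH[of "\<lambda>Ys. \<Phi> (X # Ys)" "\<lambda>vs. t (g X # vs)" \<Psi> s]
      Cons.IH[of \<Phi> t "\<lambda>Ys. \<Psi> (X # Ys)" "\<lambda>vs. s (g X # vs)"] Cons.prems by simp
qed simp

context smooth_mfd
begin

lemma symmetric_multilinear_symmetric_fun: "symmetric_multilinear p t \<Longrightarrow> symmetric_fun t"
  unfolding symmetric_multilinear_def symmetric_fun_def by blast

lemma sym_prod_eq:
  assumes "symmetric_field \<phi>" "symmetric_field \<psi>"
  shows "sym_prod \<phi> \<psi> p vs = shuffle_prod (\<phi> p) (\<psi> p) vs"
  using symmetric_fieldD(1)[OF assms(1)] symmetric_fieldD(1)[OF assms(2)]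
  by (intro sym_prod_eq_shuffle_prod symmetric_multilinear_symmetric_fun)

lemma on_fields_sym_prod:
  assumes "symmetric_field \<phi>" "symmetric_field \<psi>"
  shows "on_fields (sym_prod \<phi> \<psi>) Xs = shuffle_prod (on_fields \<phi>) (on_fields \<psi>) Xs"
proof
  fix p
  show "on_fields (sym_prod \<phi> \<psi>) Xs p = shuffle_prod (on_fields \<phi>) (on_fields \<psi>) Xs p"
    unfolding on_fields_def[of "sym_prod \<phi> \<psi>"] sym_prod_eq[OF assms]
    by (rule shuffle_prod_apply[symmetric]) (simp_all add: on_fields_def)
qed

lemma shuffle_prod_C:
  assumes "\<And>Xs. set Xs \<subseteq> V \<Longrightarrow> \<Phi> Xs \<in> C" "\<And>Xs. set Xs \<subseteq> V \<Longrightarrow> \<Psi> Xs \<in> C" "set Xs \<subseteq> V"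
  shows "shuffle_prod \<Phi> \<Psi> Xs \<in> C"
  using assms
proof (induction Xs arbitrary: \<Phi> \<Psi>)
  case (Cons X Xs)
  show ?case
    unfolding shuffle_prod.simps by (intro C_add Cons.IH) (use Cons.prems in auto)
qed (auto intro: C_mult)

lemma shuffle_prod_outside:
  assumes "\<And>vs. \<not> set vs \<subseteq> T p \<Longrightarrow> t vs = 0" "\<And>vs. \<not> set vs \<subseteq> T p \<Longrightarrow> s vs = 0" "\<not> set vs \<subseteq> T p"
  shows "shuffle_prod t s vs = 0"
  using assms
proof (induction vs arbitrary: t s)
  case (Cons v vs)
  show ?case
  proof (cases "v \<in> T p")
    case True
    then show ?thesis
      using Cons.IH[of "\<lambda>ws. t (v # ws)" s] Cons.IH[of t "\<lambda>ws. s (v # ws)"] Cons.prems by auto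
  next
    case False
    then have "(\<lambda>ws. t (v # ws)) = (\<lambda>ws. 0)" "(\<lambda>ws. s (v # ws)) = (\<lambda>ws. 0)" using Cons.prems by auto
    then show ?thesis by (simp add: shuffle_prod_zero_left shuffle_prod_zero_right)
  qed
qed simp

text \<open>Linearity is proved as an identity between functions of the remaining arguments, also of those that
  are not tangent, where both sides vanish; it can then be used inside the shuffle product.\<close>

lemma symmetric_multilinear_shuffle_prod:
  assumes t: "symmetric_multilinear p t" and s: "symmetric_multilinear p s"
  shows "symmetric_multilinear p (shuffle_prod t s)"
  unfolding symmetric_multilinear_def
proof (intro conjI allI impI)
  show "shuffle_prod t s vs = 0" if "\<not> set vs \<subseteq> T p" for vs
    by (rule shuffle_prod_outside[OF symmetric_multilinearD(1)[OF t] symmetric_multilinearD(1)[OF s] that])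
  show "shuffle_prod t s vs = shuffle_prod t s ws" if "mset vs = mset ws" for vs ws
    by (rule symmetric_funD[OF symmetric_fun_shuffle_prod[OF symmetric_multilinear_symmetric_fun[OF t]
            symmetric_multilinear_symmetric_fun[OF s]] that])
  show "shuffle_prod t s ((a *\<^sub>R u + b *\<^sub>R w) # vs) = a * shuffle_prod t s (u # vs) + b * shuffle_prod t s (w # vs)"
    if u: "u \<in> T p" and w: "w \<in> T p" for u w vs a b
  proof -
    have lin: "(\<lambda>ws. t ((a *\<^sub>R u + b *\<^sub>R w) # ws)) = (\<lambda>ws. a * t (u # ws) + b * t (w # ws))"
      if t: "symmetric_multilinear p t" for t
    proof
      fix ws
      show "t ((a *\<^sub>R u + b *\<^sub>R w) # ws) = a * t (u # ws) + b * t (w # ws)"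
      proof (cases "set ws \<subseteq> T p")
        case True
        then show ?thesis by (rule symmetric_multilinearD(2)[OF t u w])
      next
        case False
        then have "t (x # ws) = 0" for x using symmetric_multilinearD(1)[OF t, of "x # ws"] by simp
        then show ?thesis by simp
      qed
    qed
    show ?thesis
      by (simp add: lin[OF t] lin[OF s] shuffle_prod_add_left shuffle_prod_add_right
          shuffle_prod_scale_left shuffle_prod_scale_right algebra_simps)
  qed
qed

lemma symmetric_field_sym_prod:
  assumes "symmetric_field \<phi>" "symmetric_field \<psi>"
  shows "symmetric_field (sym_prod \<phi> \<psi>)"
proof -
  have "sym_prod \<phi> \<psi> p = shuffle_prod (\<phi> p) (\<psi> p)" for p
    by (rule ext) (rule sym_prod_eq[OF assms])
  then have "symmetric_multilinear p (sym_prod \<phi> \<psi> p)" for p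
    using symmetric_multilinear_shuffle_prod[OF symmetric_fieldD(1)[OF assms(1)] symmetric_fieldD(1)[OF assms(2)]]
    by metis
  moreover have "on_fields (sym_prod \<phi> \<psi>) Xs \<in> C" if "set Xs \<subseteq> V" for Xs
    unfolding on_fields_sym_prod[OF assms]
    by (rule shuffle_prod_C[OF symmetric_fieldD(2)[OF assms(1)] symmetric_fieldD(2)[OF assms(2)] that])
  ultimately show ?thesis by (simp add: symmetric_field_def)
qed

lemma shuffle_prod_degree:
  assumes "\<And>vs. m < length vs \<Longrightarrow> t vs = 0" "\<And>vs. n < length vs \<Longrightarrow> s vs = 0" "m + n < length vs"
  shows "shuffle_prod t s vs = 0"
  using assms
proof (induction vs arbitrary: t s m n)
  case (Cons v vs)
  have "shuffle_prod (\<lambda>ws. t (v # ws)) s vs = 0"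
  proof (cases m)
    case 0
    then have "(\<lambda>ws. t (v # ws)) = (\<lambda>ws. 0)" using Cons.prems(1) by auto
    then show ?thesis by (simp add: shuffle_prod_zero_left)
  next
    case (Suc k)
    then show ?thesis using Cons.prems by (intro Cons.IH[of k _ n]) auto
  qed
  moreover have "shuffle_prod t (\<lambda>ws. s (v # ws)) vs = 0"
  proof (cases n)
    case 0
    then have "(\<lambda>ws. s (v # ws)) = (\<lambda>ws. 0)" using Cons.prems(2) by auto
    then show ?thesis by (simp add: shuffle_prod_zero_right)
  next
    case (Suc k)
    then show ?thesis using Cons.prems by (intro Cons.IH[of m _ k]) auto
  qed
  ultimately show ?case by simp
qed simp

lemma sym_prod_sym_algebra:
  assumes "\<phi> \<in> sym_algebra A" "\<psi> \<in> sym_algebra A"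
  shows "sym_prod \<phi> \<psi> \<in> sym_algebra A"
proof -
  obtain m n where "\<And>p vs. m < length vs \<Longrightarrow> \<phi> p vs = 0" "\<And>p vs. n < length vs \<Longrightarrow> \<psi> p vs = 0"
    and f: "symmetric_field \<phi>" "symmetric_field \<psi>" using assms unfolding sym_algebra_iff by blast
  then have "sym_prod \<phi> \<psi> p vs = 0" if "m + n < length vs" for p vs
    using shuffle_prod_degree[of m "\<phi> p" n "\<psi> p" vs] that by (simp add: sym_prod_eq)
  then show ?thesis using symmetric_field_sym_prod[OF f] unfolding sym_algebra_iff by blast
qed

text \<open>A factor that vanishes on nonempty lists only contributes when all arguments go to the other one.\<close>

lemma sym_prod_fun_form:
  assumes "f \<in> C" "symmetric_field \<phi>"
  shows "sym_prod (fun_form f) \<phi> = f \<cdot> \<phi>"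
proof (intro ext)
  fix p vs
  have "symmetric_field (fun_form f :: ('m, 'e) tensor_field)"
    using fun_form_sym_forms[OF assms(1)] by (simp add: sym_forms_iff)
  then have "sym_prod (fun_form f) \<phi> p vs = shuffle_prod (fun_form f p) (\<phi> p) vs"
    by (rule sym_prod_eq[OF _ assms(2)])
  also have "\<dots> = fun_form f p ([] :: ('m, 'e) tvec list) * \<phi> p vs"
    by (rule shuffle_prod_degree_0_left) (simp add: fun_form_def)
  finally show "sym_prod (fun_form f) \<phi> p vs = (f \<cdot> \<phi>) p vs" by (simp add: fun_form_def)
qed

end


section \<open>The symmetric derivative\<close>

text \<open>The symmetrised covariant derivative \<open>\<nabla>\<^sub>X Y + \<nabla>\<^sub>Y X\<close> is all that the symmetric derivative
  depends on; the locale collects its properties.\<close>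

locale symmetric_bracket = smooth_mfd A
  for A :: "('m::{t2_space, second_countable_topology}, 'e::euclidean_space) chart set" +
  fixes S :: "('m \<Rightarrow> ('m, 'e) tvec) \<Rightarrow> ('m \<Rightarrow> ('m, 'e) tvec) \<Rightarrow> 'm \<Rightarrow> ('m, 'e) tvec"
  assumes bracket_V: "X \<in> V \<Longrightarrow> Y \<in> V \<Longrightarrow> S X Y \<in> V"
    and bracket_commute: "S X Y = S Y X"
    and bracket_add: "X \<in> V \<Longrightarrow> X' \<in> V \<Longrightarrow> Y \<in> V \<Longrightarrow> S (X + X') Y = S X Y + S X' Y"
    and bracket_scale: "f \<in> C \<Longrightarrow> X \<in> V \<Longrightarrow> Y \<in> V \<Longrightarrow> S (f \<cdot> X) Y = f \<cdot> S X Y + vf_apply A Y f \<cdot> X"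
begin

text \<open>The derivation of the shuffle product extending \<open>Y \<mapsto> S X Y\<close>: the sum over all arguments Y of the
  values in which Y is replaced by \<open>S X Y\<close>.\<close>

primrec bracket_insertion ::
    "('m \<Rightarrow> ('m, 'e) tvec) \<Rightarrow> (('m \<Rightarrow> ('m, 'e) tvec) list \<Rightarrow> 'm \<Rightarrow> real) \<Rightarrow>
     ('m \<Rightarrow> ('m, 'e) tvec) list \<Rightarrow> 'm \<Rightarrow> real" where
  "bracket_insertion X \<Phi> [] = 0"
| "bracket_insertion X \<Phi> (Y # Ys) = \<Phi> (S X Y # Ys) + bracket_insertion X (\<lambda>Zs. \<Phi> (Y # Zs)) Ys"

text \<open>On a form of degree r and fields \<open>X\<^sub>0, \<dots>, X\<^sub>r\<close> this is the sum of the \<open>X\<^sub>i\<close>-derivatives of the value on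
  the other fields minus the sum over all pairs \<open>i < j\<close> of the value in which the two fields are
  replaced by \<open>S X\<^sub>i X\<^sub>j\<close>. The recursion says that the commutator with the insertion of X is the
  operator \<open>\<Phi> \<mapsto> X \<circ> \<Phi> - bracket_insertion X \<Phi>\<close>, itself a derivation of the shuffle product.\<close>

primrec field_derivative ::
    "(('m \<Rightarrow> ('m, 'e) tvec) list \<Rightarrow> 'm \<Rightarrow> real) \<Rightarrow> ('m \<Rightarrow> ('m, 'e) tvec) list \<Rightarrow> 'm \<Rightarrow> real" where
  "field_derivative \<Phi> [] = 0"
| "field_derivative \<Phi> (X # Xs) = vf_apply A X (\<Phi> Xs) - bracket_insertion X \<Phi> Xs
     + field_derivative (\<lambda>Ys. \<Phi> (X # Ys)) Xs"

abbreviation smooth_valued :: "(('m \<Rightarrow> ('m, 'e) tvec) list \<Rightarrow> 'm \<Rightarrow> real) \<Rightarrow> bool" where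
  "smooth_valued \<Phi> \<equiv> \<forall>Xs. set Xs \<subseteq> V \<longrightarrow> \<Phi> Xs \<in> C"

lemma bracket_insertion_add:
  "bracket_insertion X (\<lambda>Zs. \<Phi> Zs + \<Psi> Zs) Ys = bracket_insertion X \<Phi> Ys + bracket_insertion X \<Psi> Ys"
  by (induction Ys arbitrary: \<Phi> \<Psi>) (simp_all only: bracket_insertion.simps add_0_left add_ac)

lemma bracket_insertion_zero:
  assumes "\<And>Zs. length Zs = length Ys \<Longrightarrow> \<Phi> Zs = 0"
  shows "bracket_insertion X \<Phi> Ys = 0"
  using assms
proof (induction Ys arbitrary: \<Phi>)
  case (Cons Y Ys)
  then show ?case using Cons.IH[of "\<lambda>Zs. \<Phi> (Y # Zs)"] by simp
qed simp

lemma bracket_insertion_cong: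
  assumes "X \<in> V" "set Ys \<subseteq> V" "\<And>Zs. set Zs \<subseteq> V \<Longrightarrow> \<Phi> Zs = \<Psi> Zs"
  shows "bracket_insertion X \<Phi> Ys = bracket_insertion X \<Psi> Ys"
  using assms(2,3)
proof (induction Ys arbitrary: \<Phi> \<Psi>)
  case (Cons Y Ys)
  have "\<Phi> (S X Y # Ys) = \<Psi> (S X Y # Ys)"
    using Cons.prems(1) bracket_V[OF assms(1)] by (intro Cons.prems(2)) auto
  moreover have "bracket_insertion X (\<lambda>Zs. \<Phi> (Y # Zs)) Ys = bracket_insertion X (\<lambda>Zs. \<Psi> (Y # Zs)) Ys"
    by (rule Cons.IH) (use Cons.prems in auto)
  ultimately show ?case by (simp only: bracket_insertion.simps)
qed simp

lemma bracket_insertion_C: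
  assumes "X \<in> V" "set Ys \<subseteq> V" "smooth_valued \<Phi>"
  shows "bracket_insertion X \<Phi> Ys \<in> C"
  using assms(2,3)
proof (induction Ys arbitrary: \<Phi>)
  case (Cons Y Ys)
  have "set (S X Y # Ys) \<subseteq> V" using Cons.prems(1) bracket_V[OF assms(1)] by auto
  then have "\<Phi> (S X Y # Ys) \<in> C" using Cons.prems(2) by blast
  moreover have "bracket_insertion X (\<lambda>Zs. \<Phi> (Y # Zs)) Ys \<in> C"
    by (rule Cons.IH) (use Cons.prems in auto)
  ultimately show ?case unfolding bracket_insertion.simps by (rule C_add)
qed (simp add: C_zero)

text \<open>The commutator of \<open>bracket_insertion X\<close> with the insertion of Y is the insertion of \<open>S X Y\<close>, a
  derivation; so the Leibniz rule passes to longer lists.\<close>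

lemma bracket_insertion_shuffle_prod:
  "bracket_insertion X (shuffle_prod \<Phi> \<Psi>) Ys =
     shuffle_prod (bracket_insertion X \<Phi>) \<Psi> Ys + shuffle_prod \<Phi> (bracket_insertion X \<Psi>) Ys"
proof (induction Ys arbitrary: \<Phi> \<Psi>)
  case (Cons Y Ys)
  show ?case
    by (simp only: bracket_insertion.simps shuffle_prod.simps bracket_insertion_add Cons.IH
        shuffle_prod_add_left shuffle_prod_add_right add_ac)
qed simp

lemma vf_apply_shuffle_prod:
  assumes "X \<in> V" "set Xs \<subseteq> V" "smooth_valued \<Phi>" "smooth_valued \<Psi>"
  shows "vf_apply A X (shuffle_prod \<Phi> \<Psi> Xs) =
    shuffle_prod (\<lambda>Ys. vf_apply A X (\<Phi> Ys)) \<Psi> Xs + shuffle_prod \<Phi> (\<lambda>Ys. vf_apply A X (\<Psi> Ys)) Xs"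
  using assms(2-4)
proof (induction Xs arbitrary: \<Phi> \<Psi>)
  case Nil
  then have "\<Phi> [] \<in> C" "\<Psi> [] \<in> C" by simp_all
  then show ?case unfolding shuffle_prod.simps by (rule vf_apply_mult[OF assms(1)])
next
  case (Cons Y Ys)
  have smooth: "smooth_valued (\<lambda>Zs. \<Phi> (Y # Zs))" "smooth_valued (\<lambda>Zs. \<Psi> (Y # Zs))" and Ys: "set Ys \<subseteq> V"
    using Cons.prems by auto
  have "shuffle_prod (\<lambda>Zs. \<Phi> (Y # Zs)) \<Psi> Ys \<in> C" "shuffle_prod \<Phi> (\<lambda>Zs. \<Psi> (Y # Zs)) Ys \<in> C"
    by (rule shuffle_prod_C; use smooth Ys Cons.prems in blast)+
  then show ?case
    using Cons.IH[OF Ys smooth(1) Cons.prems(3)] Cons.IH[OF Ys Cons.prems(2) smooth(2)]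
    by (simp only: shuffle_prod.simps vf_apply_add[OF assms(1)] add_ac)
qed

lemma field_derivative_cong:
  assumes "set Xs \<subseteq> V" "\<And>Zs. set Zs \<subseteq> V \<Longrightarrow> \<Phi> Zs = \<Psi> Zs"
  shows "field_derivative \<Phi> Xs = field_derivative \<Psi> Xs"
  using assms
proof (induction Xs arbitrary: \<Phi> \<Psi>)
  case (Cons X Xs)
  have X: "X \<in> V" "set Xs \<subseteq> V" using Cons.prems by auto
  have "field_derivative (\<lambda>Zs. \<Phi> (X # Zs)) Xs = field_derivative (\<lambda>Zs. \<Psi> (X # Zs)) Xs"
    by (rule Cons.IH) (use Cons.prems in auto)
  then show ?case
    using bracket_insertion_cong[OF X Cons.prems(2)] Cons.prems(2)[OF X(2)]
    by (simp only: field_derivative.simps)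
qed simp

lemma field_derivative_add:
  assumes "set Xs \<subseteq> V" "smooth_valued \<Phi>" "smooth_valued \<Psi>"
  shows "field_derivative (\<lambda>Zs. \<Phi> Zs + \<Psi> Zs) Xs = field_derivative \<Phi> Xs + field_derivative \<Psi> Xs"
  using assms
proof (induction Xs arbitrary: \<Phi> \<Psi>)
  case (Cons X Xs)
  have "smooth_valued (\<lambda>Zs. \<Phi> (X # Zs))" "smooth_valued (\<lambda>Zs. \<Psi> (X # Zs))" "X \<in> V" "set Xs \<subseteq> V"
    "\<Phi> Xs \<in> C" "\<Psi> Xs \<in> C"
    using Cons.prems by auto
  then show ?case
    by (simp only: field_derivative.simps Cons.IH bracket_insertion_add vf_apply_add) (simp only: algebra_simps)
qed simp

lemma field_derivative_zero:
  assumes "set Xs \<subseteq> V" "\<And>Zs. length Xs = Suc (length Zs) \<Longrightarrow> \<Phi> Zs = 0"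
  shows "field_derivative \<Phi> Xs = 0"
  using assms
proof (induction Xs arbitrary: \<Phi>)
  case (Cons X Xs)
  have "field_derivative (\<lambda>Zs. \<Phi> (X # Zs)) Xs = 0"
    by (rule Cons.IH) (use Cons.prems in auto)
  moreover have "bracket_insertion X \<Phi> Xs = 0"
    by (rule bracket_insertion_zero, rule Cons.prems(2)) simp
  moreover have "\<Phi> Xs = 0" by (rule Cons.prems(2)) simp
  moreover have "vf_apply A X 0 = 0" by (rule vf_apply_zero) (use Cons.prems(1) in simp)
  ultimately show ?case
    by (simp only: field_derivative.simps diff_0_right add_0_left)
qed simp

lemma field_derivative_C:
  assumes "set Xs \<subseteq> V" "smooth_valued \<Phi>"
  shows "field_derivative \<Phi> Xs \<in> C"
  using assms
proof (induction Xs arbitrary: \<Phi>)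
  case (Cons X Xs)
  have "field_derivative (\<lambda>Zs. \<Phi> (X # Zs)) Xs \<in> C"
    by (rule Cons.IH) (use Cons.prems in auto)
  then show ?case
    unfolding field_derivative.simps using Cons.prems
    by (intro C_add C_diff vf_apply_C bracket_insertion_C) auto
qed (simp add: C_zero)

text \<open>Insertion of X, the derivative along X of the values and the replacement of arguments by brackets
  with X are derivations of the shuffle product; by the defining recursion so is their combination.\<close>

lemma field_derivative_shuffle_prod:
  assumes "set Xs \<subseteq> V" "smooth_valued \<Phi>" "smooth_valued \<Psi>"
  shows "field_derivative (shuffle_prod \<Phi> \<Psi>) Xs =
    shuffle_prod (field_derivative \<Phi>) \<Psi> Xs + shuffle_prod \<Phi> (field_derivative \<Psi>) Xs"
  using assms
proof (induction Xs arbitrary: \<Phi> \<Psi>)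
  case (Cons X Xs)
  have smooth: "smooth_valued (\<lambda>Zs. \<Phi> (X # Zs))" "smooth_valued (\<lambda>Zs. \<Psi> (X # Zs))"
    and X: "X \<in> V" "set Xs \<subseteq> V"
    using Cons.prems by auto
  have neg: "shuffle_prod (\<lambda>Zs. - t Zs) s vs = - shuffle_prod t s vs"
    for t s :: "('m \<Rightarrow> ('m, 'e) tvec) list \<Rightarrow> 'm \<Rightarrow> real" and vs
    using shuffle_prod_scale_left[of "- 1" t s vs] by simp
  have diff_left: "shuffle_prod (\<lambda>Zs. t Zs - t' Zs) s vs = shuffle_prod t s vs - shuffle_prod t' s vs"
    for t t' s :: "('m \<Rightarrow> ('m, 'e) tvec) list \<Rightarrow> 'm \<Rightarrow> real" and vs
    using shuffle_prod_add_left[of t "\<lambda>Zs. - t' Zs" s vs] neg[of t' s vs] by simp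
  have diff_right: "shuffle_prod s (\<lambda>Zs. t Zs - t' Zs) vs = shuffle_prod s t vs - shuffle_prod s t' vs"
    for t t' s :: "('m \<Rightarrow> ('m, 'e) tvec) list \<Rightarrow> 'm \<Rightarrow> real" and vs
    unfolding shuffle_prod_commute[of s] by (rule diff_left)
  have "smooth_valued (shuffle_prod (\<lambda>Zs. \<Phi> (X # Zs)) \<Psi>)" "smooth_valued (shuffle_prod \<Phi> (\<lambda>Zs. \<Psi> (X # Zs)))"
    by (intro allI impI shuffle_prod_C; use smooth Cons.prems in blast)+
  then have "field_derivative (\<lambda>Ys. shuffle_prod \<Phi> \<Psi> (X # Ys)) Xs =
      field_derivative (shuffle_prod (\<lambda>Zs. \<Phi> (X # Zs)) \<Psi>) Xs
      + field_derivative (shuffle_prod \<Phi> (\<lambda>Zs. \<Psi> (X # Zs))) Xs"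
    unfolding shuffle_prod.simps by (rule field_derivative_add[OF X(2)])
  then show ?case
    using Cons.IH[OF X(2) smooth(1) Cons.prems(3)] Cons.IH[OF X(2) Cons.prems(2) smooth(2)]
      vf_apply_shuffle_prod[OF X Cons.prems(2,3)]
    by (simp only: field_derivative.simps bracket_insertion_shuffle_prod shuffle_prod.simps
        shuffle_prod_add_left shuffle_prod_add_right diff_left diff_right) (simp only: algebra_simps)
qed simp

text \<open>Multiplication with f is the shuffle product with this function of lists, which reduces linearity
  over functions to the Leibniz rule.\<close>

definition degree_0 :: "('m \<Rightarrow> real) \<Rightarrow> ('m \<Rightarrow> ('m, 'e) tvec) list \<Rightarrow> 'm \<Rightarrow> real" where
  "degree_0 f Xs = (if Xs = [] then f else 0)"

lemma degree_0_shuffle_prod: "shuffle_prod (degree_0 f) \<Phi> Xs = f * \<Phi> Xs"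
  by (subst shuffle_prod_degree_0_left) (simp_all add: degree_0_def)

lemma field_derivative_degree_0:
  assumes "set Xs \<subseteq> V"
  shows "field_derivative (degree_0 f) Xs = (case Xs of [X] \<Rightarrow> vf_apply A X f | _ \<Rightarrow> 0)"
proof (cases "length Xs = 1")
  case True
  then obtain X where "Xs = [X]" by (auto simp: length_Suc_conv)
  then show ?thesis by (simp add: degree_0_def)
next
  case False
  then have "field_derivative (degree_0 f) Xs = 0"
    by (intro field_derivative_zero assms) (auto simp: degree_0_def)
  then show ?thesis using False by (auto split: list.split)
qed

lemma field_derivative_scale:
  assumes "set Xs \<subseteq> V" "f \<in> C" "smooth_valued \<Phi>"
  shows "field_derivative (\<lambda>Zs. f * \<Phi> Zs) Xs =
    f * field_derivative \<Phi> Xs + shuffle_prod (field_derivative (degree_0 f)) \<Phi> Xs"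
proof -
  have smooth: "smooth_valued (degree_0 f)" using assms(2) by (auto simp: degree_0_def C_zero)
  have "(\<lambda>Zs. f * \<Phi> Zs) = shuffle_prod (degree_0 f) \<Phi>"
    by (rule ext) (rule degree_0_shuffle_prod[symmetric])
  then show ?thesis
    using field_derivative_shuffle_prod[OF assms(1) smooth assms(3)]
    by (simp only: degree_0_shuffle_prod add.commute)
qed

lemma symmetric_fun_bracket_insertion:
  assumes "symmetric_fun \<Phi>"
  shows "symmetric_fun (bracket_insertion X \<Phi>)"
proof -
  have by_length: "bracket_insertion X \<Phi> vs = bracket_insertion X \<Phi> ws"
    if "length vs = n" "mset vs = mset ws" "symmetric_fun \<Phi>" for n vs ws \<Phi>
    using that
  proof (induction n arbitrary: \<Phi> vs ws)
    case 0
    then show ?case by simp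
  next
    case (Suc n)
    note sym = Suc.prems(3)
    show ?case
    proof (rule symmetric_on_length_Suc[OF _ _ Suc.prems(1,2)])
      show "bracket_insertion X \<Phi> (v # w # ws) = bracket_insertion X \<Phi> (w # v # ws)" for v w ws
        using symmetric_fun_swap[OF sym, of v w] symmetric_fun_swap[OF sym, of v "S X w" ws]
          symmetric_fun_swap[OF sym, of w "S X v" ws]
        by (simp only: bracket_insertion.simps) (simp only: add_ac)
      show "bracket_insertion X \<Phi> (v # vs) = bracket_insertion X \<Phi> (v # ws)"
        if "length vs = n" "mset vs = mset ws" for v vs ws
        using Suc.IH[OF that symmetric_fun_Cons[OF sym], of v]
          symmetric_funD[OF sym, of "S X v # vs" "S X v # ws"] that by simp
    qed
  qed
  show ?thesis
    unfolding symmetric_fun_def[of "bracket_insertion X \<Phi>"] using by_length[OF refl _ assms] by blast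
qed

text \<open>Unfolding the recursion twice gives an expression that is symmetric in the first two arguments,
  because S is.\<close>

lemma symmetric_fun_field_derivative:
  assumes "symmetric_fun \<Phi>"
  shows "symmetric_fun (field_derivative \<Phi>)"
proof -
  have by_length: "field_derivative \<Phi> vs = field_derivative \<Phi> ws"
    if "length vs = n" "mset vs = mset ws" "symmetric_fun \<Phi>" for n vs ws \<Phi>
    using that
  proof (induction n arbitrary: \<Phi> vs ws)
    case 0
    then show ?case by simp
  next
    case (Suc n)
    note sym = Suc.prems(3)
    show ?case
    proof (rule symmetric_on_length_Suc[OF _ _ Suc.prems(1,2)])
      show "field_derivative \<Phi> (v # w # ws) = field_derivative \<Phi> (w # v # ws)" for v w ws
        using symmetric_fun_swap[OF sym, of v w] bracket_commute[of v w]
        by (simp only: field_derivative.simps bracket_insertion.simps) (simp only: algebra_simps)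
      show "field_derivative \<Phi> (v # vs) = field_derivative \<Phi> (v # ws)"
        if "length vs = n" "mset vs = mset ws" for v vs ws
        using Suc.IH[OF that symmetric_fun_Cons[OF sym], of v] symmetric_funD[OF sym that(2)]
          symmetric_funD[OF symmetric_fun_bracket_insertion[OF sym] that(2), of v] by simp
    qed
  qed
  show ?thesis
    unfolding symmetric_fun_def[of "field_derivative \<Phi>"] using by_length[OF refl _ assms] by blast
qed

lemma bracket_insertion_field_add:
  assumes "tensorial \<Phi>" "X \<in> V" "X' \<in> V" "set Ys \<subseteq> V"
  shows "bracket_insertion (X + X') \<Phi> Ys = bracket_insertion X \<Phi> Ys + bracket_insertion X' \<Phi> Ys"
  using assms(1,4)
proof (induction Ys arbitrary: \<Phi>)
  case (Cons Y Ys)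
  have Y: "Y \<in> V" "set Ys \<subseteq> V" using Cons.prems by auto
  have "\<Phi> (S (X + X') Y # Ys) = \<Phi> (S X Y # Ys) + \<Phi> (S X' Y # Ys)"
    unfolding bracket_add[OF assms(2,3) Y(1)]
    by (rule tensorialD(3)[OF Cons.prems(1) bracket_V[OF assms(2) Y(1)] bracket_V[OF assms(3) Y(1)] Y(2)])
  then show ?case
    using Cons.IH[OF tensorial_Cons[OF Cons.prems(1) Y(1)] Y(2)]
    by (simp only: bracket_insertion.simps add_ac)
qed simp

text \<open>The failure of the bracket to be linear over functions is compensated in the symmetric
  derivative by the failure of the derivative to be so.\<close>

lemma bracket_insertion_field_scale:
  assumes "tensorial \<Phi>" "f \<in> C" "X \<in> V" "set Ys \<subseteq> V"
  shows "bracket_insertion (f \<cdot> X) \<Phi> Ys =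
    f * bracket_insertion X \<Phi> Ys + shuffle_prod (field_derivative (degree_0 f)) (\<lambda>Zs. \<Phi> (X # Zs)) Ys"
  using assms(1,4)
proof (induction Ys arbitrary: \<Phi>)
  case Nil
  then show ?case by simp
next
  case (Cons Y Ys)
  have Y: "Y \<in> V" "set Ys \<subseteq> V" using Cons.prems by auto
  let ?df = "field_derivative (degree_0 f)"
  have "\<Phi> (S (f \<cdot> X) Y # Ys) = f * \<Phi> (S X Y # Ys) + vf_apply A Y f * \<Phi> (X # Ys)"
    unfolding bracket_scale[OF assms(2,3) Y(1)]
    using tensorialD(3)[OF Cons.prems(1) V_scale[OF assms(2) bracket_V[OF assms(3) Y(1)]]
        V_scale[OF vf_apply_C[OF Y(1) assms(2)] assms(3)] Y(2)]
      tensorialD(4)[OF Cons.prems(1) assms(2) bracket_V[OF assms(3) Y(1)] Y(2)]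
      tensorialD(4)[OF Cons.prems(1) vf_apply_C[OF Y(1) assms(2)] assms(3) Y(2)]
    by (simp only:)
  moreover have "shuffle_prod (\<lambda>Zs. ?df (Y # Zs)) (\<lambda>Zs. \<Phi> (X # Zs)) Ys = vf_apply A Y f * \<Phi> (X # Ys)"
  proof -
    have "shuffle_prod (\<lambda>Zs. ?df (Y # Zs)) (\<lambda>Zs. \<Phi> (X # Zs)) Ys
        = shuffle_prod (degree_0 (vf_apply A Y f)) (\<lambda>Zs. \<Phi> (X # Zs)) Ys"
    proof (rule shuffle_prod_cong_left[OF Y(2)])
      show "?df (Y # Zs) = degree_0 (vf_apply A Y f) Zs" if "set Zs \<subseteq> V" for Zs
        using field_derivative_degree_0[of "Y # Zs" f] that Y(1)
        by (auto simp: degree_0_def split: list.splits)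
    qed
    then show ?thesis by (simp only: degree_0_shuffle_prod)
  qed
  moreover have "(\<lambda>Zs. \<Phi> (X # Y # Zs)) = (\<lambda>Zs. \<Phi> (Y # X # Zs))"
    by (rule ext) (rule tensorialD(2)[OF Cons.prems(1)], simp)
  ultimately show ?case
    using Cons.IH[OF tensorial_Cons[OF Cons.prems(1) Y(1)] Y(2)]
    by (simp only: bracket_insertion.simps shuffle_prod.simps distrib_left) (simp only: add_ac)
qed

lemma tensorial_field_derivative:
  assumes \<Phi>: "tensorial \<Phi>"
  shows "tensorial (field_derivative \<Phi>)"
proof -
  have smooth: "smooth_valued (\<lambda>Zs. \<Phi> (X # Zs))" if "X \<in> V" for X
    using tensorialD(1)[OF tensorial_Cons[OF \<Phi> that]] by blast
  have sym: "symmetric_fun \<Phi>"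
    using tensorialD(2)[OF \<Phi>] unfolding symmetric_fun_def by blast
  show ?thesis
    unfolding tensorial_def
  proof (intro conjI allI impI)
    show "field_derivative \<Phi> Xs \<in> C" if "set Xs \<subseteq> V" for Xs
      using field_derivative_C[OF that] tensorialD(1)[OF \<Phi>] by blast
    show "field_derivative \<Phi> Xs = field_derivative \<Phi> Ys" if "mset Xs = mset Ys" for Xs Ys
      by (rule symmetric_funD[OF symmetric_fun_field_derivative[OF sym] that])
    show "field_derivative \<Phi> ((X + Y) # Xs) = field_derivative \<Phi> (X # Xs) + field_derivative \<Phi> (Y # Xs)"
      if X: "X \<in> V" and Y: "Y \<in> V" and Xs: "set Xs \<subseteq> V" for X Y Xs
    proof -
      have "field_derivative (\<lambda>Zs. \<Phi> ((X + Y) # Zs)) Xs = field_derivative (\<lambda>Zs. \<Phi> (X # Zs) + \<Phi> (Y # Zs)) Xs"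
        by (rule field_derivative_cong[OF Xs]) (rule tensorialD(3)[OF \<Phi> X Y])
      also have "\<dots> = field_derivative (\<lambda>Zs. \<Phi> (X # Zs)) Xs + field_derivative (\<lambda>Zs. \<Phi> (Y # Zs)) Xs"
        by (rule field_derivative_add[OF Xs smooth[OF X] smooth[OF Y]])
      finally show ?thesis
        using bracket_insertion_field_add[OF \<Phi> X Y Xs] vf_apply_field_add[OF X Y tensorialD(1)[OF \<Phi> Xs]]
        by (simp only: field_derivative.simps) (simp only: algebra_simps)
    qed
    show "field_derivative \<Phi> ((f \<cdot> X) # Xs) = f * field_derivative \<Phi> (X # Xs)"
      if f: "f \<in> C" and X: "X \<in> V" and Xs: "set Xs \<subseteq> V" for f X Xs
    proof -
      have "field_derivative (\<lambda>Zs. \<Phi> ((f \<cdot> X) # Zs)) Xs = field_derivative (\<lambda>Zs. f * \<Phi> (X # Zs)) Xs"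
        by (rule field_derivative_cong[OF Xs]) (rule tensorialD(4)[OF \<Phi> f X])
      also have "\<dots> = f * field_derivative (\<lambda>Zs. \<Phi> (X # Zs)) Xs
          + shuffle_prod (field_derivative (degree_0 f)) (\<lambda>Zs. \<Phi> (X # Zs)) Xs"
        by (rule field_derivative_scale[OF Xs f smooth[OF X]])
      finally show ?thesis
        using bracket_insertion_field_scale[OF \<Phi> f X Xs] vf_apply_field_scale[OF X f tensorialD(1)[OF \<Phi> Xs]]
        by (simp only: field_derivative.simps) (simp only: algebra_simps)
    qed
  qed
qed

definition bracket_derivation :: "('m, 'e) tensor_field \<Rightarrow> ('m, 'e) tensor_field" where
  "bracket_derivation = (\<lambda>\<phi>\<in>sym_algebra A. tensor_of (field_derivative (on_fields \<phi>)))"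

lemma on_fields_bracket_derivation:
  assumes "\<phi> \<in> sym_algebra A" "set Xs \<subseteq> V"
  shows "on_fields (bracket_derivation \<phi>) Xs = field_derivative (on_fields \<phi>) Xs"
  using assms on_fields_tensor_of[OF tensorial_field_derivative[OF tensorial_on_fields] assms(2)]
  by (simp add: bracket_derivation_def sym_algebra_iff)

lemma symmetric_field_bracket_derivation:
  assumes "\<phi> \<in> sym_algebra A"
  shows "symmetric_field (bracket_derivation \<phi>)"
  using assms symmetric_field_tensor_of[OF tensorial_field_derivative[OF tensorial_on_fields]]
  by (simp add: bracket_derivation_def sym_algebra_iff)

lemma bracket_derivation_zero:
  assumes "\<phi> \<in> sym_algebra A" "\<And>p ws. length vs = Suc (length ws) \<Longrightarrow> \<phi> p ws = 0"
  shows "bracket_derivation \<phi> p vs = 0"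
proof (cases "set vs \<subseteq> T p")
  case True
  have "field_derivative (on_fields \<phi>) (map (extend p) vs) = 0"
  proof (rule field_derivative_zero)
    show "set (map (extend p) vs) \<subseteq> V" using True extend by auto
    show "on_fields \<phi> Zs = 0" if "length (map (extend p) vs) = Suc (length Zs)" for Zs
      using assms(2) that by (simp add: on_fields_def fun_eq_iff)
  qed
  then show ?thesis using assms(1) by (simp add: bracket_derivation_def tensor_of_def)
qed (use assms(1) in \<open>simp add: bracket_derivation_def tensor_of_def\<close>)

lemma bracket_derivation_sym_algebra:
  assumes "\<phi> \<in> sym_algebra A"
  shows "bracket_derivation \<phi> \<in> sym_algebra A"
proof -
  obtain n where "\<And>p vs. n < length vs \<Longrightarrow> \<phi> p vs = 0" using assms unfolding sym_algebra_iff by blast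
  then have "bracket_derivation \<phi> p vs = 0" if "Suc n < length vs" for p vs
    using that by (intro bracket_derivation_zero[OF assms]) auto
  then show ?thesis
    using symmetric_field_bracket_derivation[OF assms] unfolding sym_algebra_iff by blast
qed

lemma bracket_derivation_linear:
  assumes "\<phi> \<in> sym_algebra A" "\<psi> \<in> sym_algebra A"
  shows "bracket_derivation (a *\<^sub>R \<phi> + b *\<^sub>R \<psi>) = a *\<^sub>R bracket_derivation \<phi> + b *\<^sub>R bracket_derivation \<psi>"
proof -
  let ?k = "\<lambda>a. (\<lambda>_::'m. a) :: 'm \<Rightarrow> real"
  have comb: "a *\<^sub>R \<phi> + b *\<^sub>R \<psi> = ?k a \<cdot> \<phi> + ?k b \<cdot> \<psi>" for a b and \<phi> \<psi> :: "('m, 'e) tensor_field"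
    by (simp add: fun_eq_iff)
  have f: "symmetric_field \<phi>" "symmetric_field \<psi>" using assms by (auto simp: sym_algebra_iff)
  note D = symmetric_field_bracket_derivation[OF assms(1)] symmetric_field_bracket_derivation[OF assms(2)]
  show ?thesis
  proof (rule symmetric_field_eqI)
    show "symmetric_field (bracket_derivation (a *\<^sub>R \<phi> + b *\<^sub>R \<psi>))"
      by (rule symmetric_field_bracket_derivation[OF sym_algebra_scaleR_add[OF assms]])
    show "symmetric_field (a *\<^sub>R bracket_derivation \<phi> + b *\<^sub>R bracket_derivation \<psi>)"
      unfolding comb by (intro symmetric_field_add symmetric_field_scale C_const D)
    fix Xs p assume Xs: "set Xs \<subseteq> V"
    have smooth: "smooth_valued (on_fields \<phi>)" "smooth_valued (on_fields \<psi>)"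
      using symmetric_fieldD(2)[OF f(1)] symmetric_fieldD(2)[OF f(2)] by auto
    \<comment> \<open>Constants have derivative 0, so they may be treated as coefficient functions.\<close>
    have kzero: "shuffle_prod (field_derivative (degree_0 (?k a))) \<Phi> Xs = 0" for \<Phi> and a
    proof -
      have "shuffle_prod (field_derivative (degree_0 (?k a))) \<Phi> Xs = shuffle_prod (\<lambda>Zs. 0) \<Phi> Xs"
      proof (rule shuffle_prod_cong_left[OF Xs])
        show "field_derivative (degree_0 (?k a)) Zs = 0" if "set Zs \<subseteq> V" for Zs
          using that vf_apply_const by (auto simp: field_derivative_degree_0 split: list.split)
      qed
      then show ?thesis by (simp only: shuffle_prod_zero_left)
    qed
    have "on_fields (bracket_derivation (a *\<^sub>R \<phi> + b *\<^sub>R \<psi>)) Xs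
        = field_derivative (\<lambda>Zs. ?k a * on_fields \<phi> Zs + ?k b * on_fields \<psi> Zs) Xs"
      unfolding on_fields_bracket_derivation[OF sym_algebra_scaleR_add[OF assms] Xs]
      unfolding comb on_fields_add[abs_def] on_fields_scale[abs_def] ..
    also have "\<dots> = ?k a * field_derivative (on_fields \<phi>) Xs + ?k b * field_derivative (on_fields \<psi>) Xs"
      using smooth C_const
      by (subst field_derivative_add[OF Xs]) (auto intro: C_mult simp: field_derivative_scale[OF Xs] kzero)
    finally show "on_fields (bracket_derivation (a *\<^sub>R \<phi> + b *\<^sub>R \<psi>)) Xs p
        = on_fields (a *\<^sub>R bracket_derivation \<phi> + b *\<^sub>R bracket_derivation \<psi>) Xs p"
      unfolding comb on_fields_add on_fields_scale on_fields_bracket_derivation[OF assms(1) Xs]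
        on_fields_bracket_derivation[OF assms(2) Xs] by simp
  qed
qed

lemma bracket_derivation_sym_prod:
  assumes "\<phi> \<in> sym_algebra A" "\<psi> \<in> sym_algebra A"
  shows "bracket_derivation (sym_prod \<phi> \<psi>)
    = sym_prod (bracket_derivation \<phi>) \<psi> + sym_prod \<phi> (bracket_derivation \<psi>)"
proof (rule symmetric_field_eqI)
  have f: "symmetric_field \<phi>" "symmetric_field \<psi>" using assms by (auto simp: sym_algebra_iff)
  note D = symmetric_field_bracket_derivation[OF assms(1)] symmetric_field_bracket_derivation[OF assms(2)]
  show "symmetric_field (bracket_derivation (sym_prod \<phi> \<psi>))"
    by (rule symmetric_field_bracket_derivation[OF sym_prod_sym_algebra[OF assms]])
  show "symmetric_field (sym_prod (bracket_derivation \<phi>) \<psi> + sym_prod \<phi> (bracket_derivation \<psi>))"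
    by (intro symmetric_field_add symmetric_field_sym_prod f D)
  fix Xs p assume Xs: "set Xs \<subseteq> V"
  have "on_fields (sym_prod \<phi> \<psi>) = shuffle_prod (on_fields \<phi>) (on_fields \<psi>)"
    by (rule ext) (rule on_fields_sym_prod[OF f])
  then have "on_fields (bracket_derivation (sym_prod \<phi> \<psi>)) Xs
      = field_derivative (shuffle_prod (on_fields \<phi>) (on_fields \<psi>)) Xs"
    using on_fields_bracket_derivation[OF sym_prod_sym_algebra[OF assms] Xs] by (simp only:)
  also have "\<dots> = shuffle_prod (field_derivative (on_fields \<phi>)) (on_fields \<psi>) Xs
      + shuffle_prod (on_fields \<phi>) (field_derivative (on_fields \<psi>)) Xs"
    by (rule field_derivative_shuffle_prod[OF Xs]; use symmetric_fieldD(2)[OF f(1)] symmetric_fieldD(2)[OF f(2)] in blast)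
  also have "shuffle_prod (field_derivative (on_fields \<phi>)) (on_fields \<psi>) Xs
      = shuffle_prod (on_fields (bracket_derivation \<phi>)) (on_fields \<psi>) Xs"
    by (rule shuffle_prod_cong_left[OF Xs]) (rule on_fields_bracket_derivation[OF assms(1), symmetric])
  also have "shuffle_prod (on_fields \<phi>) (field_derivative (on_fields \<psi>)) Xs
      = shuffle_prod (on_fields \<phi>) (on_fields (bracket_derivation \<psi>)) Xs"
    unfolding shuffle_prod_commute[of "on_fields \<phi>"]
    by (rule shuffle_prod_cong_left[OF Xs]) (rule on_fields_bracket_derivation[OF assms(2), symmetric])
  finally show "on_fields (bracket_derivation (sym_prod \<phi> \<psi>)) Xs p
      = on_fields (sym_prod (bracket_derivation \<phi>) \<psi> + sym_prod \<phi> (bracket_derivation \<psi>)) Xs p"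
    by (simp only: on_fields_add on_fields_sym_prod[OF D(1) f(2)] on_fields_sym_prod[OF f(1) D(2)])
qed

lemma bracket_derivation_sym_forms:
  assumes "\<phi> \<in> sym_forms A r"
  shows "bracket_derivation \<phi> \<in> sym_forms A (r + 1)"
proof -
  note a = sym_forms_sym_algebra[OF assms]
  have "bracket_derivation \<phi> p vs = 0" if "length vs \<noteq> r + 1" for p vs
    by (rule bracket_derivation_zero[OF a]) (use assms that in \<open>auto simp: sym_forms_iff\<close>)
  then show ?thesis using symmetric_field_bracket_derivation[OF a] by (simp add: sym_forms_iff)
qed

lemma bracket_derivation_geometric: "bracket_derivation \<in> geometric_derivations A"
proof -
  have "bracket_derivation (fun_form f) p [X p] = vf_apply A X f p" if f: "f \<in> C" and X: "X \<in> V" for f X p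
  proof -
    have "on_fields (bracket_derivation (fun_form f)) [X] = field_derivative (on_fields (fun_form f)) [X]"
      using sym_forms_sym_algebra[OF fun_form_sym_forms[OF f]] X by (intro on_fields_bracket_derivation) auto
    also have "\<dots> = vf_apply A X f"
      by (simp add: on_fields_def fun_form_def)
    finally show ?thesis by (simp add: on_fields_def fun_eq_iff)
  qed
  moreover have "bracket_derivation \<in> sym_algebra A \<rightarrow>\<^sub>E sym_algebra A"
    using bracket_derivation_sym_algebra by (auto simp: PiE_iff bracket_derivation_def extensional_def)
  ultimately show ?thesis
    using bracket_derivation_linear bracket_derivation_sym_prod bracket_derivation_sym_forms
    by (simp add: geometric_derivations_def sym_derivations_def)
qed

lemma bracket_derivation_one_form:
  assumes \<alpha>: "\<alpha> \<in> sym_forms A 1" and X: "X \<in> V" and Y: "Y \<in> V"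
  shows "on_fields (bracket_derivation \<alpha>) [X, Y]
    = vf_apply A X (on_fields \<alpha> [Y]) + vf_apply A Y (on_fields \<alpha> [X]) - on_fields \<alpha> [S X Y]"
proof -
  have "on_fields (bracket_derivation \<alpha>) [X, Y] = field_derivative (on_fields \<alpha>) [X, Y]"
    by (rule on_fields_bracket_derivation[OF sym_forms_sym_algebra[OF \<alpha>]]) (use X Y in simp)
  then show ?thesis by (simp add: algebra_simps)
qed


end

context smooth_mfd
begin

section \<open>Derivations are determined in degrees zero and one\<close>

definition interior :: "('m \<Rightarrow> ('m, 'e) tvec) \<Rightarrow> ('m, 'e) tensor_field \<Rightarrow> ('m, 'e) tensor_field" where
  "interior X \<phi> p vs = \<phi> p (X p # vs)"

lemma symmetric_multilinear_Cons:
  assumes t: "symmetric_multilinear p t" and u: "u \<in> T p"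
  shows "symmetric_multilinear p (\<lambda>vs. t (u # vs))"
  unfolding symmetric_multilinear_def
proof (intro conjI allI impI)
  have swap: "t (u # v # vs) = t (v # u # vs)" for v vs
    by (rule symmetric_multilinearD(3)[OF t]) simp
  show "t (u # vs) = 0" if "\<not> set vs \<subseteq> T p" for vs
    by (rule symmetric_multilinearD(1)[OF t]) (use that in auto)
  show "t (u # (a *\<^sub>R v + b *\<^sub>R w) # vs) = a * t (u # v # vs) + b * t (u # w # vs)"
    if "v \<in> T p" "w \<in> T p" "set vs \<subseteq> T p" for v w vs a b
    unfolding swap by (rule symmetric_multilinearD(2)[OF t that(1,2)]) (use that u in auto)
  show "t (u # vs) = t (u # ws)" if "mset vs = mset ws" for vs ws
    by (rule symmetric_multilinearD(3)[OF t]) (simp add: that)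
qed

lemma interior_sym_forms:
  assumes X: "X \<in> V" and \<phi>: "\<phi> \<in> sym_forms A (Suc r)"
  shows "interior X \<phi> \<in> sym_forms A r"
proof -
  have f: "symmetric_field \<phi>" and len: "\<And>p vs. length vs \<noteq> Suc r \<Longrightarrow> \<phi> p vs = 0"
    using \<phi> by (auto simp: sym_forms_iff)
  have "interior X \<phi> p = (\<lambda>vs. \<phi> p (X p # vs))" for p by (simp add: interior_def fun_eq_iff)
  then have "symmetric_multilinear p (interior X \<phi> p)" for p
    using symmetric_multilinear_Cons[OF symmetric_fieldD(1)[OF f] vector_fields_tangent[OF X]] by simp
  moreover have "on_fields (interior X \<phi>) Xs = on_fields \<phi> (X # Xs)" for Xs
    by (simp add: on_fields_def interior_def)
  ultimately show ?thesis
    using symmetric_fieldD(2)[OF f] X len by (simp add: sym_forms_iff symmetric_field_def interior_def)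
qed

text \<open>Euler's identity for homogeneous polynomials in polarised form: up to the factor k, the
  one-forms \<open>\<theta> i\<close> and the vectors \<open>e i\<close> are dual frames.\<close>

lemma euler_identity:
  fixes \<theta> :: "'i \<Rightarrow> ('m, 'e) tvec list \<Rightarrow> real"
  assumes \<theta>: "\<And>i. \<theta> i [] = 0" "\<And>i v w ws. \<theta> i (v # w # ws) = 0" and e: "\<And>i. e i \<in> T p"
    and dual: "\<And>t v vs. symmetric_multilinear p t \<Longrightarrow> v \<in> T p \<Longrightarrow> set vs \<subseteq> T p \<Longrightarrow>
      (\<Sum>i\<in>I. \<theta> i [v] * t (e i # vs)) = k * t (v # vs)"
    and t: "symmetric_multilinear p t" and vs: "set vs \<subseteq> T p"
  shows "(\<Sum>i\<in>I. shuffle_prod (\<theta> i) (\<lambda>ws. t (e i # ws)) vs) = k * real (length vs) * t vs"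
  using t vs
proof (induction vs arbitrary: t)
  case Nil
  then show ?case by (simp add: \<theta>)
next
  case (Cons v vs)
  have v: "v \<in> T p" "set vs \<subseteq> T p" using Cons.prems by auto
  have first: "shuffle_prod (\<lambda>ws. \<theta> i (v # ws)) (\<lambda>ws. t (e i # ws)) vs = \<theta> i [v] * t (e i # vs)" for i
    by (rule shuffle_prod_degree_0_left) (rule \<theta>(2))
  have rest: "(\<lambda>ws. t (e i # v # ws)) = (\<lambda>ws. t (v # e i # ws))" for i
    by (rule ext, rule symmetric_multilinearD(3)[OF Cons.prems(1)]) simp
  have "(\<Sum>i\<in>I. shuffle_prod (\<theta> i) (\<lambda>ws. t (e i # ws)) (v # vs))
      = (\<Sum>i\<in>I. \<theta> i [v] * t (e i # vs)) + (\<Sum>i\<in>I. shuffle_prod (\<theta> i) (\<lambda>ws. t (v # e i # ws)) vs)"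
    by (simp only: shuffle_prod.simps first rest sum.distrib)
  also have "\<dots> = k * t (v # vs) + k * real (length vs) * t (v # vs)"
    using dual[OF Cons.prems(1) v] Cons.IH[OF symmetric_multilinear_Cons[OF Cons.prems(1) v(1)] v(2)] by simp
  finally show ?case by (simp add: algebra_simps)
qed

text \<open>The cut-off frame and its dual satisfy the duality condition with \<open>k = \<eta>\<^sup>2\<close>.\<close>

lemma cut_frame_euler_identity:
  assumes \<eta>: "bump_at c \<eta> p" and \<phi>: "\<phi> \<in> sym_forms A (Suc r)"
  shows "(\<Sum>b\<in>Basis. sym_prod (cut_form c \<eta> b) (interior (cut_field c \<eta> b) \<phi>))
    = real (Suc r) *\<^sub>R ((\<eta> * \<eta>) \<cdot> \<phi>)"
proof (intro ext)
  fix q vs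
  have f: "symmetric_field \<phi>" and len: "\<And>p vs. length vs \<noteq> Suc r \<Longrightarrow> \<phi> p vs = 0"
    using \<phi> by (auto simp: sym_forms_iff)
  have \<theta>: "symmetric_field (cut_form c \<eta> b)" for b
    using cut_form_sym_forms[OF \<eta>] by (simp add: sym_forms_iff)
  have i: "symmetric_field (interior (cut_field c \<eta> b) \<phi>)" for b
    using interior_sym_forms[OF cut_field_V[OF \<eta>] \<phi>] by (simp add: sym_forms_iff)
  have lhs: "(\<Sum>b\<in>Basis. sym_prod (cut_form c \<eta> b) (interior (cut_field c \<eta> b) \<phi>)) q vs
      = (\<Sum>b\<in>Basis. shuffle_prod (cut_form c \<eta> b q) (\<lambda>ws. \<phi> q (cut_field c \<eta> b q # ws)) vs)"
  proof -
    have "interior X \<phi> q = (\<lambda>ws. \<phi> q (X q # ws))" for X by (simp add: interior_def fun_eq_iff)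
    then show ?thesis by (simp only: sum_fun_apply sym_prod_eq[OF \<theta> i])
  qed
  show "(\<Sum>b\<in>Basis. sym_prod (cut_form c \<eta> b) (interior (cut_field c \<eta> b) \<phi>)) q vs
      = (real (Suc r) *\<^sub>R ((\<eta> * \<eta>) \<cdot> \<phi>)) q vs"
  proof (cases "set vs \<subseteq> T q")
    case True
    have "(\<Sum>b\<in>Basis. shuffle_prod (cut_form c \<eta> b q) (\<lambda>ws. \<phi> q (cut_field c \<eta> b q # ws)) vs)
        = \<eta> q * \<eta> q * real (length vs) * \<phi> q vs"
    proof (rule euler_identity[OF _ _ cut_field_tangent[OF \<eta>] _ symmetric_fieldD(1)[OF f] True])
      show "(\<Sum>b\<in>Basis. cut_form c \<eta> b q [v] * t (cut_field c \<eta> b q # ws)) = \<eta> q * \<eta> q * t (v # ws)"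
        if t: "symmetric_multilinear q t" and v: "v \<in> T q" and ws: "set ws \<subseteq> T q" for t v ws
      proof (cases "q \<in> fst c")
        case in_chart: True
        note c = bump_atD(1)[OF \<eta>] in_chart
        have "t (cut_field c \<eta> b q # ws) = \<eta> q * t (coord_vec A c q b # ws)" for b
          using symmetric_multilinearD(2)[OF t coord_vec_in_T[OF c] T_zero ws, of "\<eta> q" b 0] c
          by (simp add: cut_field_def)
        then show ?thesis
          using symmetric_multilinear_coord_expand[OF t v ws c] v c
          by (simp add: cut_form_def sum_distrib_left mult_ac)
      qed (simp add: cut_form_def bump_atD(5)[OF \<eta>])
    qed (simp_all add: cut_form_def)
    then show ?thesis unfolding lhs using len[of vs q] by (cases "length vs = Suc r") simp_all
  next
    case False
    have "sym_prod (cut_form c \<eta> b) (interior (cut_field c \<eta> b) \<phi>) q vs = 0" for b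
      by (rule symmetric_multilinearD(1)[OF symmetric_fieldD(1)[OF symmetric_field_sym_prod[OF \<theta> i]] False])
    moreover have "\<phi> q vs = 0"
      by (rule symmetric_multilinearD(1)[OF symmetric_fieldD(1)[OF f] False])
    ultimately show ?thesis by (simp add: sum_fun_apply)
  qed
qed

lemma sym_derivationsD:
  assumes "D \<in> sym_derivations A k"
  shows "\<phi> \<in> sym_algebra A \<Longrightarrow> D \<phi> \<in> sym_algebra A"
    and "\<phi> \<in> sym_algebra A \<Longrightarrow> \<psi> \<in> sym_algebra A \<Longrightarrow> D (a *\<^sub>R \<phi> + b *\<^sub>R \<psi>) = a *\<^sub>R D \<phi> + b *\<^sub>R D \<psi>"
    and "\<phi> \<in> sym_forms A r \<Longrightarrow> D \<phi> \<in> sym_forms A (r + k)"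
    and "\<phi> \<in> sym_algebra A \<Longrightarrow> \<psi> \<in> sym_algebra A \<Longrightarrow> D (sym_prod \<phi> \<psi>) = sym_prod (D \<phi>) \<psi> + sym_prod \<phi> (D \<psi>)"
  using assms unfolding sym_derivations_def by auto

lemma zero_sym_algebra: "0 \<in> sym_algebra A"
  by (rule sym_forms_sym_algebra[OF sym_forms_zero])

lemma sym_derivation_zero: "D \<in> sym_derivations A k \<Longrightarrow> D 0 = 0"
  using sym_derivationsD(2)[OF _ zero_sym_algebra zero_sym_algebra, of D k 0 0] by simp

lemma sym_derivation_add:
  "D \<in> sym_derivations A k \<Longrightarrow> \<phi> \<in> sym_algebra A \<Longrightarrow> \<psi> \<in> sym_algebra A \<Longrightarrow> D (\<phi> + \<psi>) = D \<phi> + D \<psi>"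
  using sym_derivationsD(2)[of D k \<phi> \<psi> 1 1] by (simp only: scaleR_one)

lemma sym_derivation_scaleR:
  "D \<in> sym_derivations A k \<Longrightarrow> \<phi> \<in> sym_algebra A \<Longrightarrow> D (a *\<^sub>R \<phi>) = a *\<^sub>R D \<phi>"
  using sym_derivationsD(2)[of D k \<phi> \<phi> a 0] by (simp only: scaleR_zero_left add_0_right)

lemma sym_algebra_add: "\<phi> \<in> sym_algebra A \<Longrightarrow> \<psi> \<in> sym_algebra A \<Longrightarrow> \<phi> + \<psi> \<in> sym_algebra A"
  using sym_algebra_scaleR_add[of \<phi> \<psi> 1 1] by (simp only: scaleR_one)

lemma sym_algebra_sum: "(\<And>i. i \<in> I \<Longrightarrow> \<phi> i \<in> sym_algebra A) \<Longrightarrow> (\<Sum>i\<in>I. \<phi> i) \<in> sym_algebra A"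
  by (induction I rule: infinite_finite_induct) (auto intro: sym_algebra_add zero_sym_algebra)

lemma sym_derivation_sum:
  assumes "D \<in> sym_derivations A k" "\<And>i. i \<in> I \<Longrightarrow> \<phi> i \<in> sym_algebra A"
  shows "D (\<Sum>i\<in>I. \<phi> i) = (\<Sum>i\<in>I. D (\<phi> i))"
  using assms(2)
proof (induction I rule: infinite_finite_induct)
  case (insert i I)
  then have "D (\<phi> i + (\<Sum>i\<in>I. \<phi> i)) = D (\<phi> i) + D (\<Sum>i\<in>I. \<phi> i)"
    by (intro sym_derivation_add[OF assms(1)] sym_algebra_sum) auto
  moreover have "D (\<Sum>i\<in>I. \<phi> i) = (\<Sum>i\<in>I. D (\<phi> i))"
    by (rule insert.IH) (use insert.prems in auto)
  ultimately show ?case by (simp only: sum.insert[OF insert.hyps(1,2)])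
qed (simp_all add: sym_derivation_zero[OF assms(1)])

text \<open>Near p, a form of degree \<open>r + 1\<close> is a combination of products of one-forms with forms of
  degree r, after multiplication with a cut-off function that the Leibniz rule removes again.\<close>

lemma sym_derivations_eq_on_forms:
  assumes D: "D \<in> sym_derivations A 1" and D': "D' \<in> sym_derivations A 1"
    and fun_eq: "\<And>f. f \<in> C \<Longrightarrow> D (fun_form f) = D' (fun_form f)"
    and form_eq: "\<And>\<alpha>. \<alpha> \<in> sym_forms A 1 \<Longrightarrow> D \<alpha> = D' \<alpha>"
  shows "\<phi> \<in> sym_forms A r \<Longrightarrow> D \<phi> = D' \<phi>"
proof (induction r arbitrary: \<phi>)
  case 0
  have f: "symmetric_field \<phi>" and len: "\<And>p vs. vs \<noteq> [] \<Longrightarrow> \<phi> p vs = 0"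
    using 0 by (auto simp: sym_forms_iff)
  have "\<phi> = fun_form (on_fields \<phi> [])"
    by (intro ext) (auto simp: fun_form_def on_fields_def len)
  moreover have "on_fields \<phi> [] \<in> C" by (rule symmetric_fieldD(2)[OF f]) simp
  ultimately show ?case using fun_eq by metis
next
  case (Suc r)
  note \<phi> = Suc.prems
  show ?case
  proof
    fix p
    obtain c \<eta> where \<eta>: "bump_at c \<eta> p" by (rule ex_bump_at)
    have \<eta>2: "\<eta> * \<eta> \<in> C" using bump_atD(4)[OF \<eta>] by (auto intro: C_mult)
    define \<theta> where "\<theta> b = cut_form c \<eta> b" for b
    define \<iota> where "\<iota> b = interior (cut_field c \<eta> b) \<phi>" for b
    have \<theta>: "\<theta> b \<in> sym_forms A 1" and \<iota>: "\<iota> b \<in> sym_forms A r" for b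
      unfolding \<theta>_def \<iota>_def by (rule cut_form_sym_forms[OF \<eta>], rule interior_sym_forms[OF cut_field_V[OF \<eta>] \<phi>])
    note alg = sym_forms_sym_algebra
    have \<phi>2: "(\<eta> * \<eta>) \<cdot> \<phi> \<in> sym_forms A (Suc r)" by (rule sym_forms_scale[OF \<eta>2 \<phi>])
    have expand: "real (Suc r) *\<^sub>R E ((\<eta> * \<eta>) \<cdot> \<phi>) = (\<Sum>b\<in>Basis. sym_prod (E (\<theta> b)) (\<iota> b) + sym_prod (\<theta> b) (E (\<iota> b)))"
      if E: "E \<in> sym_derivations A 1" for E
    proof -
      have "real (Suc r) *\<^sub>R E ((\<eta> * \<eta>) \<cdot> \<phi>) = E (\<Sum>b\<in>Basis. sym_prod (\<theta> b) (\<iota> b))"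
        unfolding \<theta>_def \<iota>_def cut_frame_euler_identity[OF \<eta> \<phi>]
        by (rule sym_derivation_scaleR[OF E alg[OF \<phi>2], symmetric])
      also have "\<dots> = (\<Sum>b\<in>Basis. E (sym_prod (\<theta> b) (\<iota> b)))"
        by (rule sym_derivation_sum[OF E]) (intro sym_prod_sym_algebra alg[OF \<theta>] alg[OF \<iota>])
      finally show ?thesis
        by (simp only: sym_derivationsD(4)[OF E alg[OF \<theta>] alg[OF \<iota>]])
    qed
    have "real (Suc r) *\<^sub>R D ((\<eta> * \<eta>) \<cdot> \<phi>) = real (Suc r) *\<^sub>R D' ((\<eta> * \<eta>) \<cdot> \<phi>)"
      by (simp only: expand[OF D] expand[OF D'] form_eq[OF \<theta>] Suc.IH[OF \<iota>])
    then have eq: "D ((\<eta> * \<eta>) \<cdot> \<phi>) = D' ((\<eta> * \<eta>) \<cdot> \<phi>)" 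
      by (simp only: scaleR_cancel_left of_nat_eq_0_iff nat.distinct(2)) blast
    have leibniz: "E ((\<eta> * \<eta>) \<cdot> \<phi>) p = sym_prod (E (fun_form (\<eta> * \<eta>))) \<phi> p + E \<phi> p"
      if E: "E \<in> sym_derivations A 1" for E
    proof -
      have f: "symmetric_field \<phi>" "symmetric_field (E \<phi>)"
        using alg[OF \<phi>] sym_derivationsD(1)[OF E alg[OF \<phi>]] by (auto simp: sym_algebra_iff)
      have "E ((\<eta> * \<eta>) \<cdot> \<phi>) = E (sym_prod (fun_form (\<eta> * \<eta>)) \<phi>)"
        by (simp only: sym_prod_fun_form[OF \<eta>2 f(1)])
      also have "\<dots> = sym_prod (E (fun_form (\<eta> * \<eta>))) \<phi> + (\<eta> * \<eta>) \<cdot> E \<phi>"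
        by (simp only: sym_derivationsD(4)[OF E alg[OF fun_form_sym_forms[OF \<eta>2]] alg[OF \<phi>]]
            sym_prod_fun_form[OF \<eta>2 f(2)])
      finally show ?thesis by (simp only: plus_fun_apply module_scale_apply times_fun_apply bump_atD(3)[OF \<eta>] mult_1_left scaleR_one)
    qed
    show "D \<phi> p = D' \<phi> p"
      using leibniz[OF D] leibniz[OF D'] eq fun_eq[OF \<eta>2] by (simp only: add_left_cancel)
  qed
qed

text \<open>An element of the algebra is the finite sum of its components, and derivations are additive.\<close>

lemma sym_derivations_eqI:
  assumes D: "D \<in> sym_derivations A 1" and D': "D' \<in> sym_derivations A 1"
    and fun_eq: "\<And>f. f \<in> C \<Longrightarrow> D (fun_form f) = D' (fun_form f)"
    and form_eq: "\<And>\<alpha>. \<alpha> \<in> sym_forms A 1 \<Longrightarrow> D \<alpha> = D' \<alpha>"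
  shows "D = D'"
proof
  fix \<phi>
  show "D \<phi> = D' \<phi>"
  proof (cases "\<phi> \<in> sym_algebra A")
    case True
    then obtain n where n: "\<And>p vs. n < length vs \<Longrightarrow> \<phi> p vs = 0" unfolding sym_algebra_iff by blast
    have comp: "component r \<phi> \<in> sym_forms A r" for r using True by (simp add: sym_algebra_def)
    have sum: "\<phi> = (\<Sum>r\<le>n. component r \<phi>)"
    proof (intro ext)
      fix p vs
      show "\<phi> p vs = (\<Sum>r\<le>n. component r \<phi>) p vs"
        using n[of vs p] by (simp add: sum_fun_apply component_def sum.delta')
    qed
    have "E \<phi> = (\<Sum>r\<le>n. E (component r \<phi>))" if "E \<in> sym_derivations A 1" for E
      using sym_derivation_sum[OF that, of "{..n}" "\<lambda>r. component r \<phi>"] sym_forms_sym_algebra[OF comp] sum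
      by metis
    then show ?thesis
      using D D' sym_derivations_eq_on_forms[OF D D' fun_eq form_eq comp] by simp
  next
    case False
    then show ?thesis using D D' by (auto simp: sym_derivations_def PiE_iff extensional_def)
  qed
qed

end


lemma diff_eq_diff_swap: "a - b = c - d \<Longrightarrow> c - a = d - b" for a :: "'a::ab_group_add"
  by (drule sym) (simp add: diff_eq_eq algebra_simps)

context smooth_mfd
begin

section \<open>Torsion-free connections\<close>

lemma sym_forms_symmetric_field: "\<phi> \<in> sym_forms A r \<Longrightarrow> symmetric_field \<phi>"
  by (simp add: sym_forms_iff)

lemma one_form_C: "\<alpha> \<in> sym_forms A 1 \<Longrightarrow> X \<in> V \<Longrightarrow> on_fields \<alpha> [X] \<in> C"
  by (rule symmetric_fieldD(2)[OF sym_forms_symmetric_field]) simp_all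

lemma one_form_add:
  "\<alpha> \<in> sym_forms A 1 \<Longrightarrow> X \<in> V \<Longrightarrow> Y \<in> V \<Longrightarrow> on_fields \<alpha> [X + Y] = on_fields \<alpha> [X] + on_fields \<alpha> [Y]"
  by (rule tensorialD(3)[OF tensorial_on_fields[OF sym_forms_symmetric_field]]) simp_all

lemma one_form_scale:
  "\<alpha> \<in> sym_forms A 1 \<Longrightarrow> f \<in> C \<Longrightarrow> X \<in> V \<Longrightarrow> on_fields \<alpha> [f \<cdot> X] = f * on_fields \<alpha> [X]"
  by (rule tensorialD(4)[OF tensorial_on_fields[OF sym_forms_symmetric_field]]) simp_all

lemma one_form_uminus:
  assumes "\<alpha> \<in> sym_forms A 1" "X \<in> V"
  shows "on_fields \<alpha> [- X] = - on_fields \<alpha> [X]"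
proof -
  have "- X = (\<lambda>_. - 1) \<cdot> X" by (simp add: fun_eq_iff)
  then have "on_fields \<alpha> [- X] = (\<lambda>_. - 1) * on_fields \<alpha> [X]"
    using one_form_scale[OF assms(1) C_const assms(2), of "- 1"] by metis
  then show ?thesis by (simp only:) (simp add: fun_eq_iff)
qed

lemma one_form_diff:
  "\<alpha> \<in> sym_forms A 1 \<Longrightarrow> X \<in> V \<Longrightarrow> Y \<in> V \<Longrightarrow> on_fields \<alpha> [X - Y] = on_fields \<alpha> [X] - on_fields \<alpha> [Y]"
  using one_form_add[of \<alpha> X "- Y"] one_form_uminus[of \<alpha> Y] V_uminus[of Y]
  by (simp only: diff_conv_add_uminus)

lemma vector_field_eqI_one_forms:
  assumes "X \<in> V" "Y \<in> V" "\<And>\<alpha>. \<alpha> \<in> sym_forms A 1 \<Longrightarrow> on_fields \<alpha> [X] = on_fields \<alpha> [Y]"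
  shows "X = Y"
proof
  fix p
  show "X p = Y p"
    by (rule tangent_vector_eqI[OF vector_fields_tangent[OF assms(1)] vector_fields_tangent[OF assms(2)]])
      (use assms(3) in \<open>simp add: on_fields_def fun_eq_iff\<close>)
qed

lemma connectionsD:
  assumes "N \<in> connections A"
  shows "X \<in> V \<Longrightarrow> Y \<in> V \<Longrightarrow> N X Y \<in> V"
    and "X \<in> V \<Longrightarrow> X' \<in> V \<Longrightarrow> Y \<in> V \<Longrightarrow> N (X + X') Y = N X Y + N X' Y"
    and "f \<in> C \<Longrightarrow> X \<in> V \<Longrightarrow> Y \<in> V \<Longrightarrow> N (f \<cdot> X) Y = f \<cdot> N X Y"
    and "X \<in> V \<Longrightarrow> Y \<in> V \<Longrightarrow> Y' \<in> V \<Longrightarrow> N X (Y + Y') = N X Y + N X Y'"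
    and "f \<in> C \<Longrightarrow> X \<in> V \<Longrightarrow> Y \<in> V \<Longrightarrow> N X (f \<cdot> Y) = vf_apply A X f \<cdot> Y + f \<cdot> N X Y"
proof -
  show "X \<in> V \<Longrightarrow> Y \<in> V \<Longrightarrow> N X Y \<in> V"
    using assms unfolding connections_def by (auto dest: PiE_mem)
  show "X \<in> V \<Longrightarrow> X' \<in> V \<Longrightarrow> Y \<in> V \<Longrightarrow> N (X + X') Y = N X Y + N X' Y"
    using assms unfolding connections_def by blast
  show "f \<in> C \<Longrightarrow> X \<in> V \<Longrightarrow> Y \<in> V \<Longrightarrow> N (f \<cdot> X) Y = f \<cdot> N X Y"
    using assms unfolding connections_def module_scale_def by blast
  show "N X (Y + Y') = N X Y + N X Y'" if "X \<in> V" "Y \<in> V" "Y' \<in> V"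
  proof -
    have "N X (1 *\<^sub>R Y + 1 *\<^sub>R Y') = 1 *\<^sub>R N X Y + 1 *\<^sub>R N X Y'"
      using assms that unfolding connections_def by blast
    then show ?thesis by (simp only: scaleR_one)
  qed
  show "N X (f \<cdot> Y) = vf_apply A X f \<cdot> Y + f \<cdot> N X Y" if "f \<in> C" "X \<in> V" "Y \<in> V"
  proof -
    have "N X (\<lambda>p. f p *\<^sub>R Y p) = (\<lambda>p. vf_apply A X f p *\<^sub>R Y p + f p *\<^sub>R N X Y p)"
      using assms that unfolding connections_def by blast
    then show ?thesis unfolding module_scale_def plus_fun_def .
  qed
qed

lemma torsion_free_connectionsD:
  assumes "N \<in> torsion_free_connections A"
  shows "N \<in> connections A"
    and "X \<in> V \<Longrightarrow> Y \<in> V \<Longrightarrow> N X Y - N Y X = lie_bracket A X Y"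
  using assms unfolding torsion_free_connections_def by auto

lemma connection_eqI:
  assumes "N \<in> connections A" "N' \<in> connections A" "\<And>X Y. X \<in> V \<Longrightarrow> Y \<in> V \<Longrightarrow> N X Y = N' X Y"
  shows "N = N'"
proof (rule PiE_ext)
  show "N \<in> V \<rightarrow>\<^sub>E (V \<rightarrow>\<^sub>E V)" "N' \<in> V \<rightarrow>\<^sub>E (V \<rightarrow>\<^sub>E V)"
    using assms by (auto simp: connections_def)
  then show "N X = N' X" if "X \<in> V" for X
    using that assms(3) by (intro PiE_ext[of "N X" V "\<lambda>_. V" "N' X"]) (auto dest: PiE_mem)
qed

text \<open>Compatibility with real combinations in the second argument is the Leibniz rule for constants.\<close>

lemma connectionsI:
  assumes N_V: "\<And>X Y. X \<in> V \<Longrightarrow> Y \<in> V \<Longrightarrow> N X Y \<in> V"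
    and add_left: "\<And>X X' Y. X \<in> V \<Longrightarrow> X' \<in> V \<Longrightarrow> Y \<in> V \<Longrightarrow> N (X + X') Y = N X Y + N X' Y"
    and scale_left: "\<And>f X Y. f \<in> C \<Longrightarrow> X \<in> V \<Longrightarrow> Y \<in> V \<Longrightarrow> N (f \<cdot> X) Y = f \<cdot> N X Y"
    and add_right: "\<And>X Y Y'. X \<in> V \<Longrightarrow> Y \<in> V \<Longrightarrow> Y' \<in> V \<Longrightarrow> N X (Y + Y') = N X Y + N X Y'"
    and leibniz: "\<And>f X Y. f \<in> C \<Longrightarrow> X \<in> V \<Longrightarrow> Y \<in> V \<Longrightarrow> N X (f \<cdot> Y) = vf_apply A X f \<cdot> Y + f \<cdot> N X Y"
  shows "(\<lambda>X\<in>V. \<lambda>Y\<in>V. N X Y) \<in> connections A"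
proof -
  let ?N = "\<lambda>X\<in>V. \<lambda>Y\<in>V. N X Y"
  have scaleR: "a *\<^sub>R Z = (\<lambda>_. a) \<cdot> Z" for a and Z :: "'m \<Rightarrow> ('m, 'e) tvec"
    by (simp add: fun_eq_iff)
  have lin: "N X (a *\<^sub>R Y + b *\<^sub>R Y') = a *\<^sub>R N X Y + b *\<^sub>R N X Y'"
    if "X \<in> V" "Y \<in> V" "Y' \<in> V" for X Y Y' a b
  proof -
    have k: "N X (a *\<^sub>R Y) = a *\<^sub>R N X Y" if "Y \<in> V" for Y a
      using leibniz[OF C_const[of a] \<open>X \<in> V\<close> that] vf_apply_const[OF \<open>X \<in> V\<close>, of a]
      unfolding scaleR by (simp add: fun_eq_iff)
    show ?thesis
      using add_right[OF that(1) V_scaleR[OF that(2), of a] V_scaleR[OF that(3), of b]] k that by simp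
  qed
  show ?thesis
    unfolding connections_def mem_Collect_eq
  proof (intro conjI ballI allI)
    show "?N \<in> V \<rightarrow>\<^sub>E (V \<rightarrow>\<^sub>E V)" using N_V by auto
    show "?N (X + X') Y = ?N X Y + ?N X' Y" if "X \<in> V" "X' \<in> V" "Y \<in> V" for X X' Y
      using that V_add add_left by simp
    show "?N (\<lambda>p. f p *\<^sub>R X p) Y = (\<lambda>p. f p *\<^sub>R ?N X Y p)" if "f \<in> C" "X \<in> V" "Y \<in> V" for f X Y
      using that V_scale[OF that(1,2)] scale_left[OF that] by (simp add: module_scale_def)
    show "?N X (a *\<^sub>R Y + b *\<^sub>R Y') = a *\<^sub>R ?N X Y + b *\<^sub>R ?N X Y'"
      if "X \<in> V" "Y \<in> V" "Y' \<in> V" for X Y Y' a b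
      using that lin[OF that] V_add[OF V_scaleR V_scaleR, of Y Y' a b] by simp
    show "?N X (\<lambda>p. f p *\<^sub>R Y p) = (\<lambda>p. vf_apply A X f p *\<^sub>R Y p + f p *\<^sub>R ?N X Y p)"
      if "f \<in> C" "X \<in> V" "Y \<in> V" for f X Y
      using that V_scale[OF that(1,3)] leibniz[OF that] by (simp add: module_scale_def fun_eq_iff)
  qed
qed

lemma torsion_freeI:
  assumes "(\<lambda>X\<in>V. \<lambda>Y\<in>V. N X Y) \<in> connections A"
    and "\<And>X Y. X \<in> V \<Longrightarrow> Y \<in> V \<Longrightarrow> N X Y - N Y X = lie_bracket A X Y"
  shows "(\<lambda>X\<in>V. \<lambda>Y\<in>V. N X Y) \<in> torsion_free_connections A"
  using assms by (simp add: torsion_free_connections_def)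


section \<open>The symmetric derivative of a connection\<close>

lemma symmetric_bracket_connection:
  assumes "N \<in> connections A"
  shows "symmetric_bracket A (\<lambda>X Y. N X Y + N Y X)"
proof
  note N = connectionsD[OF assms]
  show "N X Y + N Y X \<in> V" if "X \<in> V" "Y \<in> V" for X Y
    using that by (intro V_add N)
  show "N X Y + N Y X = N Y X + N X Y" for X Y by (rule add.commute)
  show "N (X + X') Y + N Y (X + X') = N X Y + N Y X + (N X' Y + N Y X')"
    if "X \<in> V" "X' \<in> V" "Y \<in> V" for X X' Y
    by (simp only: N(2)[OF that] N(4)[OF that(3,1,2)]) (simp add: fun_eq_iff)
  show "N (f \<cdot> X) Y + N Y (f \<cdot> X) = f \<cdot> (N X Y + N Y X) + vf_apply A Y f \<cdot> X"
    if "f \<in> C" "X \<in> V" "Y \<in> V" for f X Y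
    unfolding N(3)[OF that] N(5)[OF that(1,3,2)] by (simp add: fun_eq_iff algebra_simps)
qed

lemma geometric_derivationsD:
  assumes "D \<in> geometric_derivations A"
  shows "D \<in> sym_derivations A 1"
    and "f \<in> C \<Longrightarrow> X \<in> V \<Longrightarrow> on_fields (D (fun_form f)) [X] = vf_apply A X f"
    and "\<alpha> \<in> sym_forms A 1 \<Longrightarrow> D \<alpha> \<in> sym_forms A 2"
proof -
  show D: "D \<in> sym_derivations A 1" using assms by (simp add: geometric_derivations_def)
  show "f \<in> C \<Longrightarrow> X \<in> V \<Longrightarrow> on_fields (D (fun_form f)) [X] = vf_apply A X f"
    using assms by (simp add: geometric_derivations_def on_fields_def fun_eq_iff)
  show "\<alpha> \<in> sym_forms A 1 \<Longrightarrow> D \<alpha> \<in> sym_forms A 2"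
    using sym_derivationsD(3)[OF D, of \<alpha> 1] by (simp only: one_add_one)
qed

lemma sym_forms_eqI:
  assumes "\<phi> \<in> sym_forms A r" "\<psi> \<in> sym_forms A r"
    and eq: "\<And>Xs. set Xs \<subseteq> V \<Longrightarrow> length Xs = r \<Longrightarrow> on_fields \<phi> Xs = on_fields \<psi> Xs"
  shows "\<phi> = \<psi>"
proof (rule symmetric_field_eqI)
  fix Xs p assume Xs: "set Xs \<subseteq> V"
  show "on_fields \<phi> Xs p = on_fields \<psi> Xs p"
  proof (cases "length Xs = r")
    case False
    then show ?thesis using assms(1,2) by (simp add: sym_forms_iff on_fields_def)
  qed (simp add: eq[OF Xs])
qed (use assms in \<open>auto simp: sym_forms_iff\<close>)

text \<open>The derivative of a function is a one-form, hence determined by its values on vector fields, which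
  are the same for all geometric derivations.\<close>

lemma geometric_derivations_eqI:
  assumes D: "D \<in> geometric_derivations A" and D': "D' \<in> geometric_derivations A"
    and eq: "\<And>\<alpha> X Y. \<alpha> \<in> sym_forms A 1 \<Longrightarrow> X \<in> V \<Longrightarrow> Y \<in> V \<Longrightarrow> on_fields (D \<alpha>) [X, Y] = on_fields (D' \<alpha>) [X, Y]"
  shows "D = D'"
proof (rule sym_derivations_eqI)
  note d = geometric_derivationsD[OF D] and d' = geometric_derivationsD[OF D']
  show "D \<in> sym_derivations A 1" "D' \<in> sym_derivations A 1" by (rule d(1), rule d'(1))
  show "D (fun_form f) = D' (fun_form f)" if f: "f \<in> C" for f
  proof (rule sym_forms_eqI)
    show "D (fun_form f) \<in> sym_forms A 1" "D' (fun_form f) \<in> sym_forms A 1"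
      using sym_derivationsD(3)[OF d(1) fun_form_sym_forms[OF f]]
        sym_derivationsD(3)[OF d'(1) fun_form_sym_forms[OF f]] by (simp_all only: add_0_left)
    fix Xs :: "('m \<Rightarrow> ('m, 'e) tvec) list" assume "set Xs \<subseteq> V" "length Xs = 1"
    then obtain X where "Xs = [X]" "X \<in> V" by (auto simp: length_Suc_conv)
    then show "on_fields (D (fun_form f)) Xs = on_fields (D' (fun_form f)) Xs"
      using d(2)[OF f] d'(2)[OF f] by simp
  qed
  show "D \<alpha> = D' \<alpha>" if \<alpha>: "\<alpha> \<in> sym_forms A 1" for \<alpha>
  proof (rule sym_forms_eqI[OF d(3)[OF \<alpha>] d'(3)[OF \<alpha>]])
    fix Xs :: "('m \<Rightarrow> ('m, 'e) tvec) list" assume "set Xs \<subseteq> V" "length Xs = 2"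
    then obtain X Y where "Xs = [X, Y]" "X \<in> V" "Y \<in> V" by (auto simp: length_Suc_conv numeral_2_eq_2)
    then show "on_fields (D \<alpha>) Xs = on_fields (D' \<alpha>) Xs" using eq[OF \<alpha>] by simp
  qed
qed

text \<open>The defining property involves the covariant derivatives of one-forms only through S; the
  derivation constructed from S satisfies it, and no other does.\<close>

lemma symmetric_derivative:
  assumes N: "N \<in> torsion_free_connections A"
  shows symmetric_derivative_geometric: "symmetric_derivative A N \<in> geometric_derivations A"
    and symmetric_derivative_one_form: "\<alpha> \<in> sym_forms A 1 \<Longrightarrow> X \<in> V \<Longrightarrow> Y \<in> V \<Longrightarrow>
      on_fields (symmetric_derivative A N \<alpha>) [X, Y] = vf_apply A X (on_fields \<alpha> [Y])
        + vf_apply A Y (on_fields \<alpha> [X]) - on_fields \<alpha> [N X Y + N Y X]"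
    and symmetric_derivative_eqI: "D \<in> geometric_derivations A \<Longrightarrow>
      (\<And>\<alpha> X Y. \<alpha> \<in> sym_forms A 1 \<Longrightarrow> X \<in> V \<Longrightarrow> Y \<in> V \<Longrightarrow>
        on_fields (D \<alpha>) [X, Y] = vf_apply A X (on_fields \<alpha> [Y])
          + vf_apply A Y (on_fields \<alpha> [X]) - on_fields \<alpha> [N X Y + N Y X]) \<Longrightarrow>
      symmetric_derivative A N = D"
proof -
  note N' = torsion_free_connectionsD(1)[OF N]
  interpret S: symmetric_bracket A "\<lambda>X Y. N X Y + N Y X"
    by (rule symmetric_bracket_connection[OF N'])
  let ?R = "\<lambda>D \<alpha> X Y. on_fields (D \<alpha>) [X, Y] = vf_apply A X (on_fields \<alpha> [Y])
          + vf_apply A Y (on_fields \<alpha> [X]) - on_fields \<alpha> [N X Y + N Y X]"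
  have dual: "(\<forall>p. D \<alpha> p [X p, Y p] = dual_connection A N X \<alpha> Y p + dual_connection A N Y \<alpha> X p)
      \<longleftrightarrow> ?R D \<alpha> X Y"
    if "\<alpha> \<in> sym_forms A 1" "X \<in> V" "Y \<in> V" for D \<alpha> X Y
  proof -
    have "on_fields \<alpha> [N X Y + N Y X] = on_fields \<alpha> [N X Y] + on_fields \<alpha> [N Y X]"
      by (rule one_form_add[OF that(1)]) (use that connectionsD(1)[OF N'] in auto)
    then show ?thesis
      by (simp add: dual_connection_def on_fields_def fun_eq_iff algebra_simps)
  qed
  let ?P = "\<lambda>D. D \<in> geometric_derivations A \<and> (\<forall>\<alpha>\<in>sym_forms A 1. \<forall>X\<in>V. \<forall>Y\<in>V. \<forall>p.
        D \<alpha> p [X p, Y p] = dual_connection A N X \<alpha> Y p + dual_connection A N Y \<alpha> X p)"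
  have P: "?P D \<longleftrightarrow> D \<in> geometric_derivations A \<and> (\<forall>\<alpha>\<in>sym_forms A 1. \<forall>X\<in>V. \<forall>Y\<in>V. ?R D \<alpha> X Y)" for D
    using dual by (auto simp del: One_nat_def)
  have unique: "D = D'" if "?P D" "?P D'" for D D'
  proof (rule geometric_derivations_eqI)
    show "on_fields (D \<alpha>) [X, Y] = on_fields (D' \<alpha>) [X, Y]" if "\<alpha> \<in> sym_forms A 1" "X \<in> V" "Y \<in> V" for \<alpha> X Y
      using \<open>?P D\<close>[unfolded P] \<open>?P D'\<close>[unfolded P] that by metis
  qed (use that in auto)
  have ex: "?P S.bracket_derivation"
    unfolding P using S.bracket_derivation_geometric S.bracket_derivation_one_form by blast
  have "\<exists>!D. ?P D"
  proof (rule ex_ex1I)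
    show "\<exists>D. ?P D" by (rule exI, rule ex)
  qed (rule unique)
  then have SD: "?P (symmetric_derivative A N)" unfolding symmetric_derivative_def by (rule theI')
  then show "symmetric_derivative A N \<in> geometric_derivations A"
    and "\<alpha> \<in> sym_forms A 1 \<Longrightarrow> X \<in> V \<Longrightarrow> Y \<in> V \<Longrightarrow> ?R (symmetric_derivative A N) \<alpha> X Y"
    unfolding P by blast+
  show "symmetric_derivative A N = D" if "D \<in> geometric_derivations A"
    "\<And>\<alpha> X Y. \<alpha> \<in> sym_forms A 1 \<Longrightarrow> X \<in> V \<Longrightarrow> Y \<in> V \<Longrightarrow> ?R D \<alpha> X Y"
    by (rule unique[OF SD]) (unfold P, use that in blast)
qed

text \<open>Splitting into symmetric and antisymmetric part; the latter is prescribed, so the symmetric part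
  determines the connection.\<close>

lemma torsion_free_connection_twice:
  assumes "N \<in> torsion_free_connections A" "X \<in> V" "Y \<in> V"
  shows "2 *\<^sub>R N X Y = (N X Y + N Y X) + lie_bracket A X Y"
  unfolding torsion_free_connectionsD(2)[OF assms, symmetric] by (simp add: scaleR_2)

lemma inj_on_symmetric_derivative: "inj_on (symmetric_derivative A) (torsion_free_connections A)"
proof (rule inj_onI)
  fix N N' assume N: "N \<in> torsion_free_connections A" and N': "N' \<in> torsion_free_connections A"
    and eq: "symmetric_derivative A N = symmetric_derivative A N'"
  note c = torsion_free_connectionsD(1)[OF N] and c' = torsion_free_connectionsD(1)[OF N']
  show "N = N'"
  proof (rule connection_eqI[OF c c'])
    fix X Y assume X: "X \<in> V" and Y: "Y \<in> V"
    have "N X Y + N Y X = N' X Y + N' Y X"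
    proof (rule vector_field_eqI_one_forms)
      show "N X Y + N Y X \<in> V" "N' X Y + N' Y X \<in> V"
        using X Y connectionsD(1)[OF c] connectionsD(1)[OF c'] by (auto intro: V_add)
      show "on_fields \<alpha> [N X Y + N Y X] = on_fields \<alpha> [N' X Y + N' Y X]" if \<alpha>: "\<alpha> \<in> sym_forms A 1" for \<alpha>
        using symmetric_derivative_one_form[OF N \<alpha> X Y] symmetric_derivative_one_form[OF N' \<alpha> X Y]
        unfolding eq by (simp add: fun_eq_iff)
    qed
    then have "2 *\<^sub>R N X Y = 2 *\<^sub>R N' X Y"
      by (simp only: torsion_free_connection_twice[OF N X Y] torsion_free_connection_twice[OF N' X Y])
    then show "N X Y = N' X Y" by (simp only: scaleR_cancel_left) simp
  qed
qed

text \<open>Conversely, the formula for \<open>2 \<nabla>\<^sub>X Y\<close>, paired with a one-form, defines a connection for every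
  geometric derivation; this is a Koszul formula.\<close>

lemma ex_connection_of_geometric_derivation:
  assumes D: "D \<in> geometric_derivations A"
  shows "\<exists>N\<in>torsion_free_connections A. symmetric_derivative A N = D"
proof -
  note d = geometric_derivationsD[OF D]
  define koszul where "koszul X Y \<alpha> = (1/2) *\<^sub>R (vf_apply A X (on_fields \<alpha> [Y]) + vf_apply A Y (on_fields \<alpha> [X])
      - on_fields (D \<alpha>) [X, Y] + on_fields \<alpha> [lie_bracket A X Y])" for X Y \<alpha>
  have D_C: "on_fields (D \<alpha>) [X, Y] \<in> C" if "\<alpha> \<in> sym_forms A 1" "X \<in> V" "Y \<in> V" for \<alpha> X Y
    by (rule symmetric_fieldD(2)[OF sym_forms_symmetric_field[OF d(3)[OF that(1)]]]) (use that in auto)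
  have D_sym: "on_fields (D \<alpha>) [Y, X] = on_fields (D \<alpha>) [X, Y]" if "\<alpha> \<in> sym_forms A 1" for \<alpha> X Y
    by (rule tensorialD(2)[OF tensorial_on_fields[OF sym_forms_symmetric_field[OF d(3)[OF that]]]]) simp
  have D_scale: "on_fields (D (f \<cdot> \<alpha>)) [X, Y] = vf_apply A X f * on_fields \<alpha> [Y]
      + vf_apply A Y f * on_fields \<alpha> [X] + f * on_fields (D \<alpha>) [X, Y]"
    if f: "f \<in> C" and \<alpha>: "\<alpha> \<in> sym_forms A 1" and X: "X \<in> V" and Y: "Y \<in> V" for f \<alpha> X Y
  proof -
    have df: "D (fun_form f) \<in> sym_forms A 1"
      using sym_derivationsD(3)[OF d(1) fun_form_sym_forms[OF f]] by (simp only: add_0_left)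
    note fields = sym_forms_symmetric_field[OF df] sym_forms_symmetric_field[OF \<alpha>] sym_forms_symmetric_field[OF d(3)[OF \<alpha>]]
    have "D (f \<cdot> \<alpha>) = D (sym_prod (fun_form f) \<alpha>)" by (simp only: sym_prod_fun_form[OF f fields(2)])
    also have "\<dots> = sym_prod (D (fun_form f)) \<alpha> + f \<cdot> D \<alpha>"
      by (simp only: sym_derivationsD(4)[OF d(1) sym_forms_sym_algebra[OF fun_form_sym_forms[OF f]]
            sym_forms_sym_algebra[OF \<alpha>]] sym_prod_fun_form[OF f fields(3)])
    finally have "on_fields (D (f \<cdot> \<alpha>)) [X, Y]
        = shuffle_prod (on_fields (D (fun_form f))) (on_fields \<alpha>) [X, Y] + f * on_fields (D \<alpha>) [X, Y]"
      by (simp only: on_fields_add on_fields_scale on_fields_sym_prod[OF fields(1,2)])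
    moreover have "on_fields \<beta> [] = 0" if "\<beta> \<in> sym_forms A 1" for \<beta>
      using that by (simp add: sym_forms_iff on_fields_def fun_eq_iff)
    ultimately show ?thesis
      using d(2)[OF f X] d(2)[OF f Y] \<alpha> df by (simp del: One_nat_def)
  qed
  have ex: "\<exists>Z\<in>V. \<forall>\<alpha>\<in>sym_forms A 1. koszul X Y \<alpha> = on_fields \<alpha> [Z]" if X: "X \<in> V" and Y: "Y \<in> V" for X Y
  proof (rule functional_is_vector_field)
    note L = lie_bracket_V[OF X Y]
    show "koszul X Y \<alpha> \<in> C" if "\<alpha> \<in> sym_forms A 1" for \<alpha>
      unfolding koszul_def by (intro C_scaleR C_add C_diff vf_apply_C one_form_C D_C X Y L that)
    show "koszul X Y (\<alpha> + \<beta>) = koszul X Y \<alpha> + koszul X Y \<beta>"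
      if \<alpha>: "\<alpha> \<in> sym_forms A 1" and \<beta>: "\<beta> \<in> sym_forms A 1" for \<alpha> \<beta>
    proof -
      have "D (\<alpha> + \<beta>) = D \<alpha> + D \<beta>"
        by (rule sym_derivation_add[OF d(1) sym_forms_sym_algebra[OF \<alpha>] sym_forms_sym_algebra[OF \<beta>]])
      then show ?thesis
        unfolding koszul_def using X Y \<alpha> \<beta>
        by (simp only: on_fields_add vf_apply_add one_form_C) (simp add: fun_eq_iff field_simps)
    qed
    show "koszul X Y (f \<cdot> \<alpha>) = f * koszul X Y \<alpha>" if f: "f \<in> C" and \<alpha>: "\<alpha> \<in> sym_forms A 1" for f \<alpha>
      unfolding koszul_def D_scale[OF f \<alpha> X Y] using X Y \<alpha> f
      by (simp only: on_fields_scale vf_apply_mult one_form_C) (simp add: fun_eq_iff field_simps)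
  qed
  define N where "N X Y = (SOME Z. Z \<in> V \<and> (\<forall>\<alpha>\<in>sym_forms A 1. koszul X Y \<alpha> = on_fields \<alpha> [Z]))" for X Y
  have some: "N X Y \<in> V \<and> (\<forall>\<alpha>\<in>sym_forms A 1. koszul X Y \<alpha> = on_fields \<alpha> [N X Y])" if "X \<in> V" "Y \<in> V" for X Y
  proof -
    have "\<exists>Z. Z \<in> V \<and> (\<forall>\<alpha>\<in>sym_forms A 1. koszul X Y \<alpha> = on_fields \<alpha> [Z])"
      using ex[OF that] by blast
    from someI_ex[OF this] show ?thesis unfolding N_def .
  qed
  have N: "X \<in> V \<Longrightarrow> Y \<in> V \<Longrightarrow> N X Y \<in> V"
    "X \<in> V \<Longrightarrow> Y \<in> V \<Longrightarrow> \<alpha> \<in> sym_forms A 1 \<Longrightarrow> on_fields \<alpha> [N X Y] = koszul X Y \<alpha>" for X Y \<alpha>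
    using some[of X Y] by simp_all
  have D_add: "on_fields (D \<alpha>) [X + X', Y] = on_fields (D \<alpha>) [X, Y] + on_fields (D \<alpha>) [X', Y]"
    if "\<alpha> \<in> sym_forms A 1" "X \<in> V" "X' \<in> V" "Y \<in> V" for \<alpha> X X' Y
    by (rule tensorialD(3)[OF tensorial_on_fields[OF sym_forms_symmetric_field[OF d(3)[OF that(1)]]] that(2,3)])
      (use that in auto)
  have D_mult: "on_fields (D \<alpha>) [f \<cdot> X, Y] = f * on_fields (D \<alpha>) [X, Y]"
    if "\<alpha> \<in> sym_forms A 1" "f \<in> C" "X \<in> V" "Y \<in> V" for \<alpha> f X Y
    by (rule tensorialD(4)[OF tensorial_on_fields[OF sym_forms_symmetric_field[OF d(3)[OF that(1)]]] that(2,3)])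
      (use that in auto)
  have D_add': "on_fields (D \<alpha>) [Y, X + X'] = on_fields (D \<alpha>) [Y, X] + on_fields (D \<alpha>) [Y, X']"
    if "\<alpha> \<in> sym_forms A 1" "X \<in> V" "X' \<in> V" "Y \<in> V" for \<alpha> X X' Y
    using D_add[OF that] unfolding D_sym[OF that(1), of _ Y] .
  have D_mult': "on_fields (D \<alpha>) [Y, f \<cdot> X] = f * on_fields (D \<alpha>) [Y, X]"
    if "\<alpha> \<in> sym_forms A 1" "f \<in> C" "X \<in> V" "Y \<in> V" for \<alpha> f X Y
    using D_mult[OF that] unfolding D_sym[OF that(1), of _ Y] .
  have "(\<lambda>X\<in>V. \<lambda>Y\<in>V. N X Y) \<in> connections A"
  proof (rule connectionsI[OF N(1)])
    show "N (X + X') Y = N X Y + N X' Y" if X: "X \<in> V" "X' \<in> V" and Y: "Y \<in> V" for X X' Y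
    proof (rule vector_field_eqI_one_forms)
      fix \<alpha> assume \<alpha>: "\<alpha> \<in> sym_forms A 1"
      show "on_fields \<alpha> [N (X + X') Y] = on_fields \<alpha> [N X Y + N X' Y]"
        using X Y \<alpha>
        by (simp only: one_form_add N V_add koszul_def D_add lie_bracket_add_left lie_bracket_V
            vf_apply_field_add vf_apply_add one_form_C) (simp add: fun_eq_iff field_simps)
    qed (use X Y in \<open>auto intro: N V_add\<close>)
    show "N (f \<cdot> X) Y = f \<cdot> N X Y" if f: "f \<in> C" and X: "X \<in> V" and Y: "Y \<in> V" for f X Y
    proof (rule vector_field_eqI_one_forms)
      fix \<alpha> assume \<alpha>: "\<alpha> \<in> sym_forms A 1"
      show "on_fields \<alpha> [N (f \<cdot> X) Y] = on_fields \<alpha> [f \<cdot> N X Y]"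
        using X Y \<alpha> f
        by (simp only: one_form_scale one_form_diff N V_scale koszul_def D_mult lie_bracket_scale_left lie_bracket_V
            vf_apply_field_scale vf_apply_mult vf_apply_C one_form_C) (simp add: fun_eq_iff field_simps)
    qed (use X Y f in \<open>auto intro: N V_scale\<close>)
    show "N X (Y + Y') = N X Y + N X Y'" if X: "X \<in> V" and Y: "Y \<in> V" "Y' \<in> V" for X Y Y'
    proof (rule vector_field_eqI_one_forms)
      fix \<alpha> assume \<alpha>: "\<alpha> \<in> sym_forms A 1"
      show "on_fields \<alpha> [N X (Y + Y')] = on_fields \<alpha> [N X Y + N X Y']"
        using X Y \<alpha>
        by (simp only: one_form_add N V_add koszul_def D_add' lie_bracket_add_right lie_bracket_V
            vf_apply_field_add vf_apply_add one_form_C) (simp add: fun_eq_iff field_simps)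
    qed (use X Y in \<open>auto intro: N V_add\<close>)
    show "N X (f \<cdot> Y) = vf_apply A X f \<cdot> Y + f \<cdot> N X Y" if f: "f \<in> C" and X: "X \<in> V" and Y: "Y \<in> V" for f X Y
    proof (rule vector_field_eqI_one_forms)
      fix \<alpha> assume \<alpha>: "\<alpha> \<in> sym_forms A 1"
      show "on_fields \<alpha> [N X (f \<cdot> Y)] = on_fields \<alpha> [vf_apply A X f \<cdot> Y + f \<cdot> N X Y]"
        using X Y \<alpha> f
        by (simp only: one_form_add one_form_scale N V_scale koszul_def D_mult' lie_bracket_scale_right lie_bracket_V
            vf_apply_field_scale vf_apply_mult vf_apply_C one_form_C) (simp add: fun_eq_iff field_simps)
    qed (use X Y f in \<open>auto intro: N V_scale V_add vf_apply_C\<close>)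
  qed
  moreover have "N X Y - N Y X = lie_bracket A X Y" if X: "X \<in> V" and Y: "Y \<in> V" for X Y
  proof (rule vector_field_eqI_one_forms)
    fix \<alpha> assume \<alpha>: "\<alpha> \<in> sym_forms A 1"
    show "on_fields \<alpha> [N X Y - N Y X] = on_fields \<alpha> [lie_bracket A X Y]"
      using X Y \<alpha>
      by (simp only: one_form_diff N koszul_def D_sym[OF \<alpha>, of Y X] lie_bracket_antisym[OF X Y]
          one_form_uminus lie_bracket_V) (simp add: fun_eq_iff field_simps)
  qed (use X Y in \<open>auto intro: N V_diff lie_bracket_V\<close>)
  ultimately have tf: "(\<lambda>X\<in>V. \<lambda>Y\<in>V. N X Y) \<in> torsion_free_connections A" by (rule torsion_freeI)
  have "symmetric_derivative A (\<lambda>X\<in>V. \<lambda>Y\<in>V. N X Y) = D"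
  proof (rule symmetric_derivative_eqI[OF tf D])
    fix \<alpha> X Y assume \<alpha>: "\<alpha> \<in> sym_forms A 1" and X: "X \<in> V" and Y: "Y \<in> V"
    have "on_fields \<alpha> [N X Y + N Y X] = vf_apply A X (on_fields \<alpha> [Y]) + vf_apply A Y (on_fields \<alpha> [X])
        - on_fields (D \<alpha>) [X, Y]"
      using X Y \<alpha>
      by (simp only: one_form_add N koszul_def D_sym[OF \<alpha>, of Y X] lie_bracket_antisym[OF X Y]
          one_form_uminus lie_bracket_V) (simp add: fun_eq_iff field_simps)
    then show "on_fields (D \<alpha>) [X, Y] = vf_apply A X (on_fields \<alpha> [Y]) + vf_apply A Y (on_fields \<alpha> [X])
        - on_fields \<alpha> [(\<lambda>X\<in>V. \<lambda>Y\<in>V. N X Y) X Y + (\<lambda>X\<in>V. \<lambda>Y\<in>V. N X Y) Y X]"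
      using X Y by simp
  qed
  with tf show ?thesis by blast
qed


section \<open>The affine structures\<close>

lemma tangent_valued_formsD:
  assumes "\<sigma> \<in> tangent_valued_forms A"
  shows "u \<in> T p \<Longrightarrow> v \<in> T p \<Longrightarrow> \<sigma> p u v \<in> T p"
    and "\<sigma> p u v = \<sigma> p v u"
    and "\<not> (u \<in> T p \<and> v \<in> T p) \<Longrightarrow> \<sigma> p u v = 0"
    and "u \<in> T p \<Longrightarrow> v \<in> T p \<Longrightarrow> w \<in> T p \<Longrightarrow> \<sigma> p (a *\<^sub>R u + b *\<^sub>R v) w = a *\<^sub>R \<sigma> p u w + b *\<^sub>R \<sigma> p v w"
proof -
  have 1: "\<forall>p u v. u \<in> T p \<longrightarrow> v \<in> T p \<longrightarrow> \<sigma> p u v \<in> T p \<and> \<sigma> p u v = \<sigma> p v u"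
    and 2: "\<forall>p u v. \<not> (u \<in> T p \<and> v \<in> T p) \<longrightarrow> \<sigma> p u v = 0"
    and 3: "\<forall>p u v w a b. u \<in> T p \<longrightarrow> v \<in> T p \<longrightarrow> w \<in> T p \<longrightarrow>
        \<sigma> p (a *\<^sub>R u + b *\<^sub>R v) w = a *\<^sub>R \<sigma> p u w + b *\<^sub>R \<sigma> p v w"
    using assms unfolding tangent_valued_forms_def by blast+
  show "u \<in> T p \<Longrightarrow> v \<in> T p \<Longrightarrow> \<sigma> p u v \<in> T p" using 1 by blast
  show "\<sigma> p u v = \<sigma> p v u" using 1 2 by metis
  show "\<not> (u \<in> T p \<and> v \<in> T p) \<Longrightarrow> \<sigma> p u v = 0" using 2 by blast
  show "u \<in> T p \<Longrightarrow> v \<in> T p \<Longrightarrow> w \<in> T p \<Longrightarrow> \<sigma> p (a *\<^sub>R u + b *\<^sub>R v) w = a *\<^sub>R \<sigma> p u w + b *\<^sub>R \<sigma> p v w"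
    using 3 by blast
qed

lemma smooth_on_frame_tangent_valued_iff:
  assumes c: "c \<in> A"
  shows "smooth_on (chart_image c) (\<lambda>x. let p = chart_inv c x in \<sigma> p (coord_vec A c p b) (coord_vec A c p b') c)
    \<longleftrightarrow> smooth_fun_on (fst c) (\<lambda>p. \<sigma> p (coord_vec A c p b) (coord_vec A c p b') c)"
  using smooth_fun_on_chartI[OF c chart_open[OF c] order_refl, of "\<lambda>p. \<sigma> p (coord_vec A c p b) (coord_vec A c p b') c"]
    smooth_fun_on_chartD[OF _ c order_refl, of "\<lambda>p. \<sigma> p (coord_vec A c p b) (coord_vec A c p b') c"]
  by (auto simp: o_def chart_image_def Let_def)

lemma tangent_valued_forms_smooth:
  assumes "\<sigma> \<in> tangent_valued_forms A" "c \<in> A" "b \<in> Basis" "b' \<in> Basis"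
  shows "smooth_fun_on (fst c) (\<lambda>p. \<sigma> p (coord_vec A c p b) (coord_vec A c p b') c)"
  unfolding smooth_on_frame_tangent_valued_iff[OF assms(2), symmetric]
  using assms unfolding tangent_valued_forms_def by blast

lemma tangent_valued_formsI:
  assumes "\<And>p u v. u \<in> T p \<Longrightarrow> v \<in> T p \<Longrightarrow> \<sigma> p u v \<in> T p"
    and "\<And>p u v. u \<in> T p \<Longrightarrow> v \<in> T p \<Longrightarrow> \<sigma> p u v = \<sigma> p v u"
    and "\<And>p u v. \<not> (u \<in> T p \<and> v \<in> T p) \<Longrightarrow> \<sigma> p u v = 0"
    and "\<And>p u v w a b. u \<in> T p \<Longrightarrow> v \<in> T p \<Longrightarrow> w \<in> T p \<Longrightarrow>
        \<sigma> p (a *\<^sub>R u + b *\<^sub>R v) w = a *\<^sub>R \<sigma> p u w + b *\<^sub>R \<sigma> p v w"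
    and "\<And>c b b'. c \<in> A \<Longrightarrow> b \<in> Basis \<Longrightarrow> b' \<in> Basis \<Longrightarrow>
        smooth_fun_on (fst c) (\<lambda>p. \<sigma> p (coord_vec A c p b) (coord_vec A c p b') c)"
  shows "\<sigma> \<in> tangent_valued_forms A"
  unfolding tangent_valued_forms_def mem_Collect_eq
proof (intro conjI ballI)
  fix c b b' assume "c \<in> A" "b \<in> (Basis :: 'e set)" "b' \<in> (Basis :: 'e set)"
  then show "smooth_on (chart_image c) (\<lambda>x. let p = chart_inv c x in \<sigma> p (coord_vec A c p b) (coord_vec A c p b') c)"
    using assms(5) by (simp only: smooth_on_frame_tangent_valued_iff)
qed (use assms(1-4) in blast)+

lemma subspace_tangent_valued_forms: "subspace (tangent_valued_forms A)"
proof (rule subspaceI)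
  show "0 \<in> tangent_valued_forms A"
    by (rule tangent_valued_formsI) (auto simp: T_zero smooth_fun_on_const chart_open)
  show "\<sigma> + \<tau> \<in> tangent_valued_forms A"
    if \<sigma>: "\<sigma> \<in> tangent_valued_forms A" and \<tau>: "\<tau> \<in> tangent_valued_forms A" for \<sigma> \<tau>
  proof (rule tangent_valued_formsI)
    note s = tangent_valued_formsD[OF \<sigma>] and t = tangent_valued_formsD[OF \<tau>]
    show "(\<sigma> + \<tau>) p u v \<in> T p" if "u \<in> T p" "v \<in> T p" for p u v
      using T_add[OF s(1)[OF that] t(1)[OF that]] by simp
    show "(\<sigma> + \<tau>) p u v = (\<sigma> + \<tau>) p v u" for p u v
      using s(2)[of p u v] t(2)[of p u v] by simp
    show "(\<sigma> + \<tau>) p u v = 0" if "\<not> (u \<in> T p \<and> v \<in> T p)" for p u v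
      using s(3)[OF that] t(3)[OF that] by simp
    show "(\<sigma> + \<tau>) p (a *\<^sub>R u + b *\<^sub>R v) w = a *\<^sub>R (\<sigma> + \<tau>) p u w + b *\<^sub>R (\<sigma> + \<tau>) p v w"
      if "u \<in> T p" "v \<in> T p" "w \<in> T p" for p u v w a b
      unfolding plus_fun_apply s(4)[OF that] t(4)[OF that] by (simp add: fun_eq_iff algebra_simps)
    show "smooth_fun_on (fst c) (\<lambda>p. (\<sigma> + \<tau>) p (coord_vec A c p b) (coord_vec A c p b') c)"
      if "c \<in> A" "b \<in> Basis" "b' \<in> Basis" for c b b'
      using smooth_fun_on_add[OF chart_open[OF that(1)] tangent_valued_forms_smooth[OF \<sigma> that] tangent_valued_forms_smooth[OF \<tau> that]]
      by simp
  qed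
  show "k *\<^sub>R \<sigma> \<in> tangent_valued_forms A" if \<sigma>: "\<sigma> \<in> tangent_valued_forms A" for k \<sigma>
  proof (rule tangent_valued_formsI)
    note s = tangent_valued_formsD[OF \<sigma>]
    show "(k *\<^sub>R \<sigma>) p u v \<in> T p" if "u \<in> T p" "v \<in> T p" for p u v
      using T_scaleR[OF s(1)[OF that]] by simp
    show "(k *\<^sub>R \<sigma>) p u v = (k *\<^sub>R \<sigma>) p v u" for p u v
      using s(2)[of p u v] by simp
    show "(k *\<^sub>R \<sigma>) p u v = 0" if "\<not> (u \<in> T p \<and> v \<in> T p)" for p u v
      using s(3)[OF that] by simp
    show "(k *\<^sub>R \<sigma>) p (a *\<^sub>R u + b *\<^sub>R v) w = a *\<^sub>R (k *\<^sub>R \<sigma>) p u w + b *\<^sub>R (k *\<^sub>R \<sigma>) p v w"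
      if "u \<in> T p" "v \<in> T p" "w \<in> T p" for p u v w a b
      unfolding scaleR_fun_apply s(4)[OF that] by (simp add: fun_eq_iff algebra_simps)
    show "smooth_fun_on (fst c) (\<lambda>p. (k *\<^sub>R \<sigma>) p (coord_vec A c p b) (coord_vec A c p b') c)"
      if "c \<in> A" "b \<in> Basis" "b' \<in> Basis" for c b b'
      using smooth_fun_on_scaleR[OF chart_open[OF that(1)] smooth_fun_on_const[OF chart_open[OF that(1)]]
          tangent_valued_forms_smooth[OF \<sigma> that], of k] by simp
  qed
qed

definition evaluate ::
    "('m \<Rightarrow> ('m, 'e) tvec \<Rightarrow> ('m, 'e) tvec \<Rightarrow> ('m, 'e) tvec) \<Rightarrow>
     ('m \<Rightarrow> ('m, 'e) tvec) \<Rightarrow> ('m \<Rightarrow> ('m, 'e) tvec) \<Rightarrow> 'm \<Rightarrow> ('m, 'e) tvec" where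
  "evaluate \<sigma> X Y = (\<lambda>p. \<sigma> p (X p) (Y p))"

lemma tangent_valued_form_sum:
  assumes \<sigma>: "\<sigma> \<in> tangent_valued_forms A" and v: "\<And>i. i \<in> I \<Longrightarrow> v i \<in> T p" and w: "w \<in> T p"
  shows "\<sigma> p (\<Sum>i\<in>I. k i *\<^sub>R v i) w = (\<Sum>i\<in>I. k i *\<^sub>R \<sigma> p (v i) w)"
proof -
  have zero: "\<sigma> p 0 w = 0"
    using tangent_valued_formsD(4)[OF \<sigma> T_zero T_zero w, of 0 0] by (simp only: scaleR_zero_left add_0_left)
  show ?thesis
    using v
  proof (induction I rule: infinite_finite_induct)
    case (insert i I)
    then have "(\<Sum>i\<in>I. k i *\<^sub>R v i) \<in> T p" by (intro T_sum T_scaleR) auto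
    then have "\<sigma> p (k i *\<^sub>R v i + 1 *\<^sub>R (\<Sum>i\<in>I. k i *\<^sub>R v i)) w
        = k i *\<^sub>R \<sigma> p (v i) w + 1 *\<^sub>R \<sigma> p (\<Sum>i\<in>I. k i *\<^sub>R v i) w"
      using insert.prems by (intro tangent_valued_formsD(4)[OF \<sigma> _ _ w]) auto
    moreover have "\<sigma> p (\<Sum>i\<in>I. k i *\<^sub>R v i) w = (\<Sum>i\<in>I. k i *\<^sub>R \<sigma> p (v i) w)"
      by (rule insert.IH) (use insert.prems in auto)
    ultimately show ?case
      by (simp only: sum.insert[OF insert.hyps(1,2)] scaleR_one)
  next
    case (infinite I)
    then show ?case by (simp only: sum.infinite[OF infinite(1)] zero)
  next
    case empty
    then show ?case by (simp only: sum.empty zero)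
  qed
qed

lemma evaluate_V:
  assumes \<sigma>: "\<sigma> \<in> tangent_valued_forms A" and X: "X \<in> V" and Y: "Y \<in> V"
  shows "evaluate \<sigma> X Y \<in> V"
proof (rule vector_fieldsI')
  note XT = vector_fields_tangent[OF X] and YT = vector_fields_tangent[OF Y]
  show "evaluate \<sigma> X Y p \<in> T p" for p
    unfolding evaluate_def by (rule tangent_valued_formsD(1)[OF \<sigma> XT YT])
  fix c assume c: "c \<in> A"
  have "smooth_fun_on (fst c) (\<lambda>q. \<Sum>b\<in>Basis. (X q c \<bullet> b) *\<^sub>R
      (\<Sum>b'\<in>Basis. (Y q c \<bullet> b') *\<^sub>R \<sigma> q (coord_vec A c q b) (coord_vec A c q b') c))"
    by (intro smooth_fun_on_sum smooth_fun_on_scaleR smooth_fun_on_inner vector_fields_smooth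
        tangent_valued_forms_smooth[OF \<sigma>] chart_open c X Y)
  then show "smooth_fun_on (fst c) (\<lambda>q. evaluate \<sigma> X Y q c)"
  proof (rule smooth_fun_on_cong[OF chart_open[OF c]])
    fix q assume q: "q \<in> fst c"
    note cv = coord_vec_in_T[OF c q]
    have right: "\<sigma> q u (Y q) = (\<Sum>b'\<in>Basis. (Y q c \<bullet> b') *\<^sub>R \<sigma> q u (coord_vec A c q b'))" if u: "u \<in> T q" for u
    proof -
      have "\<sigma> q u (Y q) = \<sigma> q (\<Sum>b'\<in>Basis. (Y q c \<bullet> b') *\<^sub>R coord_vec A c q b') u"
        using coord_vec_expand[OF YT c q] tangent_valued_formsD(2)[OF \<sigma>] by metis
      also have "\<dots> = (\<Sum>b'\<in>Basis. (Y q c \<bullet> b') *\<^sub>R \<sigma> q (coord_vec A c q b') u)"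
        by (rule tangent_valued_form_sum[OF \<sigma> cv u])
      finally show ?thesis by (simp only: tangent_valued_formsD(2)[OF \<sigma>, of q u])
    qed
    have "\<sigma> q (X q) (Y q) = \<sigma> q (\<Sum>b\<in>Basis. (X q c \<bullet> b) *\<^sub>R coord_vec A c q b) (Y q)"
      using coord_vec_expand[OF XT c q] by metis
    also have "\<dots> = (\<Sum>b\<in>Basis. (X q c \<bullet> b) *\<^sub>R \<sigma> q (coord_vec A c q b) (Y q))"
      by (rule tangent_valued_form_sum[OF \<sigma> cv YT])
    finally show "(\<Sum>b\<in>Basis. (X q c \<bullet> b) *\<^sub>R
        (\<Sum>b'\<in>Basis. (Y q c \<bullet> b') *\<^sub>R \<sigma> q (coord_vec A c q b) (coord_vec A c q b') c)) = evaluate \<sigma> X Y q c"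
      by (simp add: evaluate_def right[OF cv] sum_fun_apply)
  qed
qed

lemma tangent_valued_forms_eqI:
  assumes \<sigma>: "\<sigma> \<in> tangent_valued_forms A" and \<tau>: "\<tau> \<in> tangent_valued_forms A"
    and eq: "\<And>X Y p. X \<in> V \<Longrightarrow> Y \<in> V \<Longrightarrow> \<sigma> p (X p) (Y p) = \<tau> p (X p) (Y p)"
  shows "\<sigma> = \<tau>"
proof (intro ext)
  fix p u v
  have "\<sigma> p u v = \<tau> p u v"
  proof (cases "u \<in> T p \<and> v \<in> T p")
    case True
    then show ?thesis using eq[of "extend p u" "extend p v" p] extend by simp
  next
    case False
    then show ?thesis using tangent_valued_formsD(3)[OF \<sigma>] tangent_valued_formsD(3)[OF \<tau>] by metis
  qed
  then show "\<sigma> p u v c = \<tau> p u v c" for c by simp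
qed

lemma tangent_valued_forms_eqI_evaluate:
  assumes "\<sigma> \<in> tangent_valued_forms A" "\<tau> \<in> tangent_valued_forms A"
    and "\<And>X Y. X \<in> V \<Longrightarrow> Y \<in> V \<Longrightarrow> evaluate \<sigma> X Y = evaluate \<tau> X Y"
  shows "\<sigma> = \<tau>"
  by (rule tangent_valued_forms_eqI[OF assms(1,2)]) (use assms(3) in \<open>simp add: evaluate_def fun_eq_iff\<close>)

text \<open>Symmetry transfers tensoriality from the first to the second argument, so B acts pointwise.\<close>

lemma ex_tangent_valued_form:
  assumes B_V: "\<And>X Y. X \<in> V \<Longrightarrow> Y \<in> V \<Longrightarrow> B X Y \<in> V"
    and B_sym: "\<And>X Y. X \<in> V \<Longrightarrow> Y \<in> V \<Longrightarrow> B X Y = B Y X"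
    and B_add: "\<And>X X' Y. X \<in> V \<Longrightarrow> X' \<in> V \<Longrightarrow> Y \<in> V \<Longrightarrow> B (X + X') Y = B X Y + B X' Y"
    and B_scale: "\<And>f X Y. f \<in> C \<Longrightarrow> X \<in> V \<Longrightarrow> Y \<in> V \<Longrightarrow> B (f \<cdot> X) Y = f \<cdot> B X Y"
  shows "\<exists>\<sigma>\<in>tangent_valued_forms A. \<forall>X\<in>V. \<forall>Y\<in>V. evaluate \<sigma> X Y = B X Y"
proof -
  have left: "B X Y p = B X' Y p" if "X \<in> V" "X' \<in> V" "Y \<in> V" "X p = X' p" for X X' Y p
    by (rule tensorial_pointwise[of "\<lambda>X. B X Y", OF _ _ that(1,2,4)])
      (use that(3) in \<open>auto simp: B_add B_scale\<close>)
  have point: "B X Y p = B X' Y' p"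
    if "X \<in> V" "X' \<in> V" "Y \<in> V" "Y' \<in> V" "X p = X' p" "Y p = Y' p" for X X' Y Y' p
  proof -
    have "B X Y p = B X' Y p" by (rule left) (use that in auto)
    also have "\<dots> = B Y X' p" using B_sym that by simp
    also have "\<dots> = B Y' X' p" by (rule left) (use that in auto)
    finally show ?thesis using B_sym that by simp
  qed
  define \<sigma> where "\<sigma> p u v = (if u \<in> T p \<and> v \<in> T p then B (extend p u) (extend p v) p else 0)" for p u v
  have ev: "\<sigma> p (X p) (Y p) = B X Y p" if "X \<in> V" "Y \<in> V" for X Y p
    using that vector_fields_tangent[OF that(1)] vector_fields_tangent[OF that(2)] extend[of _ p]
    unfolding \<sigma>_def by (auto intro!: point)
  have "\<sigma> \<in> tangent_valued_forms A"
  proof (rule tangent_valued_formsI)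
    show "\<sigma> p u v \<in> T p" if "u \<in> T p" "v \<in> T p" for p u v
      using that extend(1) B_V by (simp add: \<sigma>_def vector_fields_tangent)
    show "\<sigma> p u v = \<sigma> p v u" if "u \<in> T p" "v \<in> T p" for p u v
      using that extend(1) B_sym[of "extend p u" "extend p v"] by (simp add: \<sigma>_def)
    show "\<sigma> p u v = 0" if "\<not> (u \<in> T p \<and> v \<in> T p)" for p u v
      using that unfolding \<sigma>_def by (rule if_not_P)
    show "\<sigma> p (a *\<^sub>R u + b *\<^sub>R v) w = a *\<^sub>R \<sigma> p u w + b *\<^sub>R \<sigma> p v w"
      if "u \<in> T p" "v \<in> T p" "w \<in> T p" for p u v w a b
    proof -
      let ?U = "extend p u" and ?V = "extend p v" and ?W = "extend p w"
      have mem: "?U \<in> V" "?V \<in> V" "?W \<in> V" "?U p = u" "?V p = v" "?W p = w"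
        using that extend by auto
      let ?k = "\<lambda>a. (\<lambda>_::'m. a) :: 'm \<Rightarrow> real"
      have k: "?k a \<cdot> ?U \<in> V" "?k b \<cdot> ?V \<in> V" using mem V_scale C_const by auto
      have "\<sigma> p (a *\<^sub>R u + b *\<^sub>R v) w = B (?k a \<cdot> ?U + ?k b \<cdot> ?V) ?W p"
        using ev[OF V_add[OF k] mem(3), of p] mem by simp
      also have "\<dots> = a *\<^sub>R B ?U ?W p + b *\<^sub>R B ?V ?W p"
        by (simp only: B_add[OF k mem(3)] B_scale[OF C_const mem(1,3)] B_scale[OF C_const mem(2,3)]
            plus_fun_apply module_scale_apply)
      finally show ?thesis using ev[OF mem(1,3), of p] ev[OF mem(2,3), of p] mem by simp
    qed
    show "smooth_fun_on (fst c) (\<lambda>p. \<sigma> p (coord_vec A c p b) (coord_vec A c p b') c)"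
      if c: "c \<in> A" for c b b'
    proof (rule smooth_fun_on_local)
      fix p assume "p \<in> fst c"
      then obtain \<eta> where \<eta>: "bump_at c \<eta> p" using ex_bump_at_chart c by blast
      obtain W where W: "open W" "p \<in> W" "W \<subseteq> fst c" "\<And>q. q \<in> W \<Longrightarrow> \<eta> q = 1"
        using bump_at_nbhd[OF \<eta>] by blast
      note E = cut_field_V[OF \<eta>]
      have "smooth_fun_on W (\<lambda>q. B (cut_field c \<eta> b) (cut_field c \<eta> b') q c)"
        by (rule smooth_fun_on_subset[OF vector_fields_smooth[OF B_V[OF E E] c] W(3)])
      then have "smooth_fun_on W (\<lambda>p. \<sigma> p (coord_vec A c p b) (coord_vec A c p b') c)"
      proof (rule smooth_fun_on_cong[OF W(1)])
        fix q assume "q \<in> W"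
        then have "cut_field c \<eta> b q = coord_vec A c q b" for b
          using W by (auto simp: cut_field_def)
        then show "B (cut_field c \<eta> b) (cut_field c \<eta> b') q c = \<sigma> q (coord_vec A c q b) (coord_vec A c q b') c"
          using ev[OF E[of b] E[of b'], of q] by simp
      qed
      then show "\<exists>W. open W \<and> p \<in> W \<and> smooth_fun_on W (\<lambda>p. \<sigma> p (coord_vec A c p b) (coord_vec A c p b') c)"
        using W by blast
    qed
  qed
  moreover have "evaluate \<sigma> X Y = B X Y" if "X \<in> V" "Y \<in> V" for X Y
    by (rule ext) (simp add: evaluate_def ev[OF that])
  ultimately show ?thesis by blast
qed

text \<open>The derivative terms in the Leibniz rules of the two connections cancel, so the difference is
  tensorial; it is symmetric since both torsions vanish.\<close>

lemma connection_diff: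
  assumes N: "N \<in> torsion_free_connections A" and N': "N' \<in> torsion_free_connections A"
  shows connection_diff_tangent_valued: "connection_diff A N' N \<in> tangent_valued_forms A"
    and evaluate_connection_diff: "X \<in> V \<Longrightarrow> Y \<in> V \<Longrightarrow> evaluate (connection_diff A N' N) X Y = N' X Y - N X Y"
proof -
  note c = connectionsD[OF torsion_free_connectionsD(1)[OF N]]
    and c' = connectionsD[OF torsion_free_connectionsD(1)[OF N']]
  have P: "(\<forall>X\<in>V. \<forall>Y\<in>V. \<forall>p. \<sigma> p (X p) (Y p) = N' X Y p - N X Y p)
      \<longleftrightarrow> (\<forall>X\<in>V. \<forall>Y\<in>V. evaluate \<sigma> X Y = N' X Y - N X Y)" for \<sigma>
    by (simp add: evaluate_def fun_eq_iff)
  let ?P = "\<lambda>\<sigma>. \<sigma> \<in> tangent_valued_forms A \<and> (\<forall>X\<in>V. \<forall>Y\<in>V. evaluate \<sigma> X Y = N' X Y - N X Y)"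
  have "\<exists>\<sigma>\<in>tangent_valued_forms A. \<forall>X\<in>V. \<forall>Y\<in>V. evaluate \<sigma> X Y = N' X Y - N X Y"
  proof (rule ex_tangent_valued_form)
    show "N' X Y - N X Y \<in> V" if "X \<in> V" "Y \<in> V" for X Y
      by (rule V_diff[OF c'(1)[OF that] c(1)[OF that]])
    show "N' X Y - N X Y = N' Y X - N Y X" if "X \<in> V" "Y \<in> V" for X Y
      by (rule diff_eq_diff_swap) (simp only: torsion_free_connectionsD(2)[OF N that] torsion_free_connectionsD(2)[OF N' that])
    show "N' (X + X') Y - N (X + X') Y = N' X Y - N X Y + (N' X' Y - N X' Y)"
      if "X \<in> V" "X' \<in> V" "Y \<in> V" for X X' Y
      by (simp only: c(2)[OF that] c'(2)[OF that] add_diff_add)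
    show "N' (f \<cdot> X) Y - N (f \<cdot> X) Y = f \<cdot> (N' X Y - N X Y)" if "f \<in> C" "X \<in> V" "Y \<in> V" for f X Y
      unfolding c(3)[OF that] c'(3)[OF that] by (simp add: fun_eq_iff scaleR_diff_right)
  qed
  then obtain \<sigma> where \<sigma>: "\<sigma> \<in> tangent_valued_forms A" "\<And>X Y. X \<in> V \<Longrightarrow> Y \<in> V \<Longrightarrow> evaluate \<sigma> X Y = N' X Y - N X Y"
    by blast
  have "connection_diff A N' N = \<sigma>"
    unfolding connection_diff_def P
  proof (rule the_equality)
    show "?P \<sigma>" using \<sigma> by blast
    fix \<tau> assume \<tau>: "?P \<tau>"
    show "\<tau> = \<sigma>"
    proof (rule tangent_valued_forms_eqI_evaluate)
      show "evaluate \<tau> X Y = evaluate \<sigma> X Y" if "X \<in> V" "Y \<in> V" for X Y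
        unfolding \<sigma>(2)[OF that] using \<tau> that by blast
    qed (use \<sigma> \<tau> in auto)
  qed
  then show "connection_diff A N' N \<in> tangent_valued_forms A"
    and "X \<in> V \<Longrightarrow> Y \<in> V \<Longrightarrow> evaluate (connection_diff A N' N) X Y = N' X Y - N X Y" using \<sigma> by blast+
qed

text \<open>A symmetric tensor changes neither the Leibniz rule nor the torsion.\<close>

lemma ex_connection_translate:
  assumes N: "N \<in> torsion_free_connections A" and \<sigma>: "\<sigma> \<in> tangent_valued_forms A"
  shows "\<exists>N'\<in>torsion_free_connections A. connection_diff A N' N = \<sigma>"
proof -
  note c = connectionsD[OF torsion_free_connectionsD(1)[OF N]] and s = tangent_valued_formsD[OF \<sigma>]
  let ?N = "\<lambda>X Y. N X Y + evaluate \<sigma> X Y"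
  have sym: "evaluate \<sigma> X Y = evaluate \<sigma> Y X" for X Y
    unfolding evaluate_def by (rule ext) (rule s(2))
  have add: "evaluate \<sigma> (X + X') Y = evaluate \<sigma> X Y + evaluate \<sigma> X' Y"
    if "X \<in> V" "X' \<in> V" "Y \<in> V" for X X' Y
  proof
    fix p
    show "evaluate \<sigma> (X + X') Y p = (evaluate \<sigma> X Y + evaluate \<sigma> X' Y) p"
      using s(4)[of "X p" p "X' p" "Y p" 1 1] that vector_fields_tangent
      by (simp only: evaluate_def plus_fun_apply scaleR_one)
  qed
  have scale: "evaluate \<sigma> (f \<cdot> X) Y = f \<cdot> evaluate \<sigma> X Y" if "X \<in> V" "Y \<in> V" for f X Y
  proof
    fix p
    show "evaluate \<sigma> (f \<cdot> X) Y p = (f \<cdot> evaluate \<sigma> X Y) p"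
      using s(4)[of "X p" p "X p" "Y p" "f p" 0] that vector_fields_tangent
      by (simp only: evaluate_def module_scale_apply scaleR_zero_left add_0_right)
  qed
  have "(\<lambda>X\<in>V. \<lambda>Y\<in>V. ?N X Y) \<in> torsion_free_connections A"
  proof (rule torsion_freeI[OF connectionsI])
    show "?N X Y \<in> V" if "X \<in> V" "Y \<in> V" for X Y
      by (rule V_add[OF c(1)[OF that] evaluate_V[OF \<sigma> that]])
    show "?N (X + X') Y = ?N X Y + ?N X' Y" if "X \<in> V" "X' \<in> V" "Y \<in> V" for X X' Y
      by (simp only: c(2)[OF that] add[OF that]) (simp add: fun_eq_iff)
    show "?N (f \<cdot> X) Y = f \<cdot> ?N X Y" if "f \<in> C" "X \<in> V" "Y \<in> V" for f X Y
      unfolding c(3)[OF that] scale[OF that(2,3)] by (simp add: fun_eq_iff scaleR_add_right)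
    show "?N X (Y + Y') = ?N X Y + ?N X Y'" if "X \<in> V" "Y \<in> V" "Y' \<in> V" for X Y Y'
      unfolding sym[of X] by (simp only: c(4)[OF that] add[OF that(2,3,1)]) (simp add: fun_eq_iff)
    show "?N X (f \<cdot> Y) = vf_apply A X f \<cdot> Y + f \<cdot> ?N X Y" if "f \<in> C" "X \<in> V" "Y \<in> V" for f X Y
      unfolding sym[of X] c(5)[OF that] scale[OF that(3,2)] by (simp add: fun_eq_iff scaleR_add_right add.assoc)
    show "?N X Y - ?N Y X = lie_bracket A X Y" if "X \<in> V" "Y \<in> V" for X Y
      using torsion_free_connectionsD(2)[OF N that] sym[of X Y] by simp
  qed
  moreover from this have "connection_diff A (\<lambda>X\<in>V. \<lambda>Y\<in>V. ?N X Y) N = \<sigma>"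
    by (intro tangent_valued_forms_eqI_evaluate connection_diff_tangent_valued N \<sigma>)
      (simp_all add: evaluate_connection_diff[OF N])
  ultimately show ?thesis by blast
qed

lemma affine_space_connections:
  "affine_space_over (tangent_valued_forms A) (torsion_free_connections A) (connection_diff A)"
  unfolding affine_space_over_def
proof (intro conjI ballI)
  show "subspace (tangent_valued_forms A)" by (rule subspace_tangent_valued_forms)
  show "connection_diff A N' N \<in> tangent_valued_forms A"
    if "N \<in> torsion_free_connections A" "N' \<in> torsion_free_connections A" for N N'
    by (rule connection_diff_tangent_valued[OF that])
  show "\<exists>!N'. N' \<in> torsion_free_connections A \<and> connection_diff A N' N = \<sigma>"
    if N: "N \<in> torsion_free_connections A" and \<sigma>: "\<sigma> \<in> tangent_valued_forms A" for N \<sigma>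
  proof (rule ex_ex1I)
    show "\<exists>N'. N' \<in> torsion_free_connections A \<and> connection_diff A N' N = \<sigma>"
      using ex_connection_translate[OF N \<sigma>] by blast
    fix N1 N2 assume "N1 \<in> torsion_free_connections A \<and> connection_diff A N1 N = \<sigma>"
      "N2 \<in> torsion_free_connections A \<and> connection_diff A N2 N = \<sigma>"
    then have N12: "N1 \<in> torsion_free_connections A" "N2 \<in> torsion_free_connections A"
      and eq: "connection_diff A N1 N = connection_diff A N2 N" by auto
    show "N1 = N2"
    proof (rule connection_eqI[OF torsion_free_connectionsD(1)[OF N12(1)] torsion_free_connectionsD(1)[OF N12(2)]])
      fix X Y assume "X \<in> V" "Y \<in> V"
      then have "N1 X Y - N X Y = N2 X Y - N X Y"
        using evaluate_connection_diff[OF N N12(1)] evaluate_connection_diff[OF N N12(2)] eq by metis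
      then show "N1 X Y = N2 X Y" by (metis diff_add_cancel)
    qed
  qed
  show "connection_diff A N3 N2 + connection_diff A N2 N1 = connection_diff A N3 N1"
    if N: "N1 \<in> torsion_free_connections A" "N2 \<in> torsion_free_connections A" "N3 \<in> torsion_free_connections A" for N1 N2 N3
  proof (rule tangent_valued_forms_eqI_evaluate)
    show "connection_diff A N3 N2 + connection_diff A N2 N1 \<in> tangent_valued_forms A"
      by (intro subspace_add[OF subspace_tangent_valued_forms] connection_diff_tangent_valued N)
    show "connection_diff A N3 N1 \<in> tangent_valued_forms A" by (intro connection_diff_tangent_valued N)
    have "evaluate (\<sigma> + \<tau>) X Y = evaluate \<sigma> X Y + evaluate \<tau> X Y" for \<sigma> \<tau> X Y
      by (simp add: evaluate_def fun_eq_iff)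
    then show "evaluate (connection_diff A N3 N2 + connection_diff A N2 N1) X Y = evaluate (connection_diff A N3 N1) X Y"
      if "X \<in> V" "Y \<in> V" for X Y
      using evaluate_connection_diff[OF N(1,2) that] evaluate_connection_diff[OF N(2,3) that]
        evaluate_connection_diff[OF N(1,3) that] by simp
  qed
qed

text \<open>Changing \<open>\<nabla>\<close> by \<open>\<sigma>\<close> changes \<open>(\<nabla>\<^sup>s \<alpha>)(X, Y)\<close> by \<open>- \<alpha> (\<sigma> X Y) - \<alpha> (\<sigma> Y X)\<close>; hence the linear part of
  the isomorphism is multiplication by - 2.\<close>

lemma derivation_diff_symmetric_derivative:
  assumes N: "N \<in> torsion_free_connections A" and N': "N' \<in> torsion_free_connections A"
  shows "derivation_diff A (symmetric_derivative A N') (symmetric_derivative A N) = (- 2) *\<^sub>R connection_diff A N' N"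
  unfolding derivation_diff_def
proof (rule the_equality)
  let ?\<sigma> = "(- 2) *\<^sub>R connection_diff A N' N"
  let ?D = "symmetric_derivative A N" and ?D' = "symmetric_derivative A N'"
  note d = connection_diff_tangent_valued[OF N N']
  note g = geometric_derivationsD[OF symmetric_derivative_geometric[OF N]]
    and g' = geometric_derivationsD[OF symmetric_derivative_geometric[OF N']]
  note c = connectionsD(1)[OF torsion_free_connectionsD(1)[OF N]] and c' = connectionsD(1)[OF torsion_free_connectionsD(1)[OF N']]
  have \<sigma>: "?\<sigma> \<in> tangent_valued_forms A" by (rule subspace_scale[OF subspace_tangent_valued_forms d])
  have contract: "?D' \<alpha> - ?D \<alpha> = contract ?\<sigma> \<alpha>" if \<alpha>: "\<alpha> \<in> sym_forms A 1" for \<alpha>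
  proof (intro ext)
    fix p vs
    note t = symmetric_fieldD(1)[OF sym_forms_symmetric_field]
    show "(?D' \<alpha> - ?D \<alpha>) p vs = contract ?\<sigma> \<alpha> p vs"
    proof (cases "length vs = 2")
      case True
      then obtain u v where vs: "vs = [u, v]" by (auto simp: length_Suc_conv numeral_2_eq_2)
      show ?thesis
      proof (cases "u \<in> T p \<and> v \<in> T p")
        case True
        define X where "X = extend p u"
        define Y where "Y = extend p v"
        have X: "X \<in> V" "X p = u" and Y: "Y \<in> V" "Y p = v" using True extend by (auto simp: X_def Y_def)
        have diff: "N' X Y - N X Y = evaluate (connection_diff A N' N) X Y" "N' Y X - N Y X = evaluate (connection_diff A N' N) X Y"
        proof -
          show "N' X Y - N X Y = evaluate (connection_diff A N' N) X Y"
            by (rule evaluate_connection_diff[OF N N' X(1) Y(1), symmetric])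
          have "evaluate (connection_diff A N' N) Y X = evaluate (connection_diff A N' N) X Y"
            unfolding evaluate_def by (rule ext) (rule tangent_valued_formsD(2)[OF d])
          then show "N' Y X - N Y X = evaluate (connection_diff A N' N) X Y"
            using evaluate_connection_diff[OF N N' Y(1) X(1)] by simp
        qed
        have "on_fields (?D' \<alpha>) [X, Y] - on_fields (?D \<alpha>) [X, Y]
            = - (on_fields \<alpha> [N' X Y - N X Y] + on_fields \<alpha> [N' Y X - N Y X])"
          unfolding symmetric_derivative_one_form[OF N \<alpha> X(1) Y(1)] symmetric_derivative_one_form[OF N' \<alpha> X(1) Y(1)]
          using c[OF X(1) Y(1)] c[OF Y(1) X(1)] c'[OF X(1) Y(1)] c'[OF Y(1) X(1)] \<alpha>
          by (simp only: one_form_add one_form_diff) (simp add: fun_eq_iff)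
        from fun_cong[OF this[unfolded diff], of p]
        have "(?D' \<alpha> - ?D \<alpha>) p [u, v] = - (2 * \<alpha> p [connection_diff A N' N p u v])"
          by (simp add: on_fields_def evaluate_def X Y)
        moreover have "\<alpha> p [?\<sigma> p u v] = - 2 * \<alpha> p [connection_diff A N' N p u v]"
          using symmetric_multilinearD(2)[OF t[OF \<alpha>] tangent_valued_formsD(1)[OF d, of u p v] T_zero, of "[]" "- 2" 0] True
          by (simp only: scaleR_fun_apply) simp
        ultimately show ?thesis by (simp add: vs contract_def)
      next
        case False
        have zero: "\<phi> p [u, v] = 0" if "\<phi> \<in> sym_forms A 2" for \<phi>
          by (rule symmetric_multilinearD(1)[OF t[OF that]]) (use False in auto)
        have "?\<sigma> p u v = 0" by (rule tangent_valued_formsD(3)[OF \<sigma> False])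
        then show ?thesis
          using zero[OF g(3)[OF \<alpha>]] zero[OF g'(3)[OF \<alpha>]] symmetric_multilinear_zero[OF t[OF \<alpha>], of p "[]"]
          unfolding contract_def vs by simp
      qed
    next
      case False
      then show ?thesis using g(3)[OF \<alpha>] g'(3)[OF \<alpha>] by (simp add: contract_def sym_forms_iff)
    qed
  qed
  then show "?\<sigma> \<in> tangent_valued_forms A \<and> (\<forall>\<alpha>\<in>sym_forms A 1. ?D' \<alpha> - ?D \<alpha> = contract ?\<sigma> \<alpha>)"
    using \<sigma> by blast
  fix \<tau> assume \<tau>: "\<tau> \<in> tangent_valued_forms A \<and> (\<forall>\<alpha>\<in>sym_forms A 1. ?D' \<alpha> - ?D \<alpha> = contract \<tau> \<alpha>)"
  show "\<tau> = ?\<sigma>"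
  proof (rule tangent_valued_forms_eqI[OF _ \<sigma>])
    show "\<tau> \<in> tangent_valued_forms A" using \<tau> by blast
    show "\<tau> p (X p) (Y p) = ?\<sigma> p (X p) (Y p)" if X: "X \<in> V" and Y: "Y \<in> V" for X Y p
    proof (rule tangent_vector_eqI)
      note tangent = vector_fields_tangent[OF X] vector_fields_tangent[OF Y]
      show "\<tau> p (X p) (Y p) \<in> T p" using tangent_valued_formsD(1)[OF _ tangent] \<tau> by blast
      show "?\<sigma> p (X p) (Y p) \<in> T p" using tangent_valued_formsD(1)[OF \<sigma> tangent] .
      fix \<alpha> assume \<alpha>: "\<alpha> \<in> sym_forms A 1"
      have "contract \<tau> \<alpha> = contract ?\<sigma> \<alpha>" using \<tau> contract \<alpha> by metis
      then have "contract \<tau> \<alpha> p [X p, Y p] = contract ?\<sigma> \<alpha> p [X p, Y p]" by simp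
      then show "\<alpha> p [\<tau> p (X p) (Y p)] = \<alpha> p [?\<sigma> p (X p) (Y p)]" by (simp add: contract_def)
    qed
  qed
qed

lemma bij_betw_symmetric_derivative:
  "bij_betw (symmetric_derivative A) (torsion_free_connections A) (geometric_derivations A)"
  unfolding bij_betw_def
  using inj_on_symmetric_derivative symmetric_derivative_geometric ex_connection_of_geometric_derivation by blast

end

text \<open>The affine structure of the target is transported from the source: the difference of two points of
  the target is the image under L of the difference of their preimages.\<close>

lemma affine_isomorphismI:
  assumes S: "affine_space_over V S diff" and F: "bij_betw F S T"
    and L: "bij_betw L V V" "\<And>v w a b. v \<in> V \<Longrightarrow> w \<in> V \<Longrightarrow> L (a *\<^sub>R v + b *\<^sub>R w) = a *\<^sub>R L v + b *\<^sub>R L w"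
    and diff': "\<And>s t. s \<in> S \<Longrightarrow> t \<in> S \<Longrightarrow> diff' (F t) (F s) = L (diff t s)"
  shows "affine_isomorphism V S diff T diff' F"
proof -
  have sub: "subspace V" and mem: "\<And>s t. s \<in> S \<Longrightarrow> t \<in> S \<Longrightarrow> diff t s \<in> V"
    and ex1: "\<And>s v. s \<in> S \<Longrightarrow> v \<in> V \<Longrightarrow> \<exists>!t. t \<in> S \<and> diff t s = v"
    and chasles: "\<And>s t u. s \<in> S \<Longrightarrow> t \<in> S \<Longrightarrow> u \<in> S \<Longrightarrow> diff u t + diff t s = diff u s"
    using S unfolding affine_space_over_def by blast+
  have LV: "L v \<in> V" if "v \<in> V" for v using bij_betwE[OF L(1)] that by blast
  have T: "T = F ` S" using F by (simp add: bij_betw_def)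
  have "affine_space_over V T diff'"
    unfolding affine_space_over_def T
  proof (intro conjI ballI)
    show "subspace V" by (rule sub)
    show "diff' t s \<in> V" if "s \<in> F ` S" "t \<in> F ` S" for s t
      using that by (auto simp: diff' LV mem)
    show "\<exists>!t. t \<in> F ` S \<and> diff' t s = v" if "s \<in> F ` S" and v: "v \<in> V" for s v
    proof -
      obtain s0 where s0: "s0 \<in> S" "s = F s0" using \<open>s \<in> F ` S\<close> by (elim imageE)
      have "v \<in> L ` V" using v L(1) by (simp only: bij_betw_imp_surj_on)
      then obtain w where w: "w \<in> V" "L w = v" by (elim imageE) simp
      from ex1[OF s0(1) w(1)] obtain t0 where t0: "t0 \<in> S" "diff t0 s0 = w"
        and unique: "\<And>t. t \<in> S \<Longrightarrow> diff t s0 = w \<Longrightarrow> t = t0" by (elim ex1E) blast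
      show ?thesis
      proof (rule ex1I[of _ "F t0"])
        show "F t0 \<in> F ` S \<and> diff' (F t0) s = v" using s0 t0 w by (simp add: diff')
        fix t assume t: "t \<in> F ` S \<and> diff' t s = v"
        then obtain t1 where t1: "t1 \<in> S" "t = F t1" by (elim conjE imageE)
        then have "L (diff t1 s0) = L w" using t s0 w by (simp add: diff')
        then have "diff t1 s0 = w"
          using inj_onD[OF bij_betw_imp_inj_on[OF L(1)]] mem[OF s0(1) t1(1)] w(1) by simp
        then show "t = F t0" using unique[OF t1(1)] t1(2) by simp
      qed
    qed
    show "diff' u t + diff' t s = diff' u s" if stu: "s \<in> F ` S" "t \<in> F ` S" "u \<in> F ` S" for s t u
    proof -
      obtain s0 t0 u0 where 0: "s0 \<in> S" "s = F s0" "t0 \<in> S" "t = F t0" "u0 \<in> S" "u = F u0"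
        using stu by (elim imageE) blast
      have "L (1 *\<^sub>R diff u0 t0 + 1 *\<^sub>R diff t0 s0) = 1 *\<^sub>R L (diff u0 t0) + 1 *\<^sub>R L (diff t0 s0)"
        using 0 by (intro L(2) mem)
      then show ?thesis using 0 chasles[of s0 t0 u0] by (simp add: diff')
    qed
  qed
  then show ?thesis
    unfolding affine_isomorphism_def using S F L diff' by blast
qed

theorem proposition2p9:
  fixes A :: "('m::{t2_space, second_countable_topology}, 'e::euclidean_space) chart set"
  assumes "smooth_manifold A"
  shows "affine_isomorphism (tangent_valued_forms A)
           (torsion_free_connections A) (connection_diff A)
           (geometric_derivations A) (derivation_diff A)
           (symmetric_derivative A)"
proof -
  interpret smooth_mfd A by unfold_locales (rule assms)
  show ?thesis
  proof (rule affine_isomorphismI[where L = "\<lambda>\<sigma>. (- 2) *\<^sub>R \<sigma>"])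
    show "affine_space_over (tangent_valued_forms A) (torsion_free_connections A) (connection_diff A)"
      by (rule affine_space_connections)
    show "bij_betw (symmetric_derivative A) (torsion_free_connections A) (geometric_derivations A)"
      by (rule bij_betw_symmetric_derivative)
    show "bij_betw (\<lambda>\<sigma>. (- 2) *\<^sub>R \<sigma>) (tangent_valued_forms A) (tangent_valued_forms A)"
      by (rule bij_betw_byWitness[where f' = "\<lambda>\<sigma>. (- 1 / 2) *\<^sub>R \<sigma>"])
        (auto intro: subspace_scale[OF subspace_tangent_valued_forms] simp del: scaleR_minus_left)
    show "(- 2) *\<^sub>R (a *\<^sub>R \<sigma> + b *\<^sub>R \<tau>) = a *\<^sub>R (- 2) *\<^sub>R \<sigma> + b *\<^sub>R (- 2) *\<^sub>R \<tau>"
      for a b and \<sigma> \<tau> :: "'m \<Rightarrow> ('m, 'e) tvec \<Rightarrow> ('m, 'e) tvec \<Rightarrow> ('m, 'e) tvec"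
      by (simp only: scaleR_add_right scaleR_scaleR mult.commute)
    show "derivation_diff A (symmetric_derivative A N') (symmetric_derivative A N) = (- 2) *\<^sub>R connection_diff A N' N"
      if "N \<in> torsion_free_connections A" "N' \<in> torsion_free_connections A" for N N'
      by (rule derivation_diff_symmetric_derivative[OF that])
  qed
qed

end
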